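(* Let $n$ be a positive integer and $X=\{x_1,\ldots,x_n\}$. For a nonempty subset $S\subseteq[n]$ put $X_S=\sum_{i\in S}x_i$. For integers $1\le k\le n$ define \[ B_{n,k}(X)=\prod_{S\subseteq[n],\,|S|=k} X_S,\qquad B_n(X)=\prod_{k=1}^n B_{n,k}(X). \] Then for any positive integers $k\le n$, $B_{n,k}(X)$ is Schur-positive, i.e. there exist nonnegative integers $\kappa^{(n,k)}_\lambda$ such that \[ B_{n,k}(X)=\sum_{\lambda}\kappa^{(n,k)}_\lambda s_\lambda(x_1,\ldots,x_n). \] Furthermore, $B_n(X)$ is Schur-positive, i.e. it is a linear combination of the Schur polynomials $s_\lambda(x_1,\ldots,x_n)$ with nonnegative integer coefficients.
   Context: $s_\lambda(x_1,\ldots,x_n)$ denotes the Schur polynomial in $n$ variables indexed by the partition $\lambda$, i.e. the sum of $x^{T}$ over semistandard Young tableaux $T$ of shape $\lambda$ with entries in $[n]$. *)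

theory Defs
  imports Main "HOL-Library.Poly_Mapping" "HOL-Library.FuncSet"
begin

text \<open>
  Polynomials over the integers in variables indexed by natural numbers: a monomial is a finitely
  supported exponent vector, a polynomial a finitely supported coefficient function on monomials,
  and multiplication is convolution.
\<close>

type_synonym mpolynomial = "(nat \<Rightarrow>\<^sub>0 nat) \<Rightarrow>\<^sub>0 int"

definition X :: "nat \<Rightarrow> mpolynomial" where
  "X i = Poly_Mapping.single (Poly_Mapping.single i 1) 1"

definition is_partition :: "nat list \<Rightarrow> bool" where
  "is_partition \<mu> \<longleftrightarrow> sorted_wrt (\<ge>) \<mu> \<and> 0 \<notin> set \<mu>"

text \<open>Cells are pairs (row, column), both counted from 0 (English convention).\<close>

definition young_diagram :: "nat list \<Rightarrow> (nat \<times> nat) set" where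
  "young_diagram \<mu> = {(i, j). i < length \<mu> \<and> j < \<mu> ! i}"

text \<open>
  Fillings are extensional functions (undefined off the diagram), so that each tableau is
  represented by exactly one function.
\<close>

definition ssyt :: "nat \<Rightarrow> nat list \<Rightarrow> (nat \<times> nat \<Rightarrow> nat) set" where
  "ssyt n \<mu> = {T \<in> young_diagram \<mu> \<rightarrow>\<^sub>E {1..n}.
     (\<forall>i j j'. j < j' \<and> (i, j) \<in> young_diagram \<mu> \<and> (i, j') \<in> young_diagram \<mu>
        \<longrightarrow> T (i, j) \<le> T (i, j')) \<and>
     (\<forall>i i' j. i < i' \<and> (i, j) \<in> young_diagram \<mu> \<and> (i', j) \<in> young_diagram \<mu>
        \<longrightarrow> T (i, j) < T (i', j))}"

lemma finite_young_diagram: "finite (young_diagram \<mu>)"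
proof -
  have "young_diagram \<mu> = Sigma {..<length \<mu>} (\<lambda>i. {..<\<mu> ! i})"
    by (auto simp: young_diagram_def)
  then show ?thesis by simp
qed

lemma finite_ssyt: "finite (ssyt n \<mu>)"
  by (rule finite_subset[OF _ finite_PiE[OF finite_young_diagram[of \<mu>], of "\<lambda>_. {1..n}"]])
    (auto simp: ssyt_def)

definition schur_poly :: "nat \<Rightarrow> nat list \<Rightarrow> mpolynomial" where
  "schur_poly n \<mu> = (\<Sum>T\<in>ssyt n \<mu>. \<Prod>c\<in>young_diagram \<mu>. X (T c))"

text \<open>
  The expansion ranges over all partitions and is finite because the coefficient family has
  finite support.
\<close>

definition schur_positive :: "nat \<Rightarrow> mpolynomial \<Rightarrow> bool" where
  "schur_positive n f \<longleftrightarrow>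
     (\<exists>\<kappa> :: nat list \<Rightarrow> nat.
        finite {\<mu>. is_partition \<mu> \<and> \<kappa> \<mu> \<noteq> 0} \<and>
        f = (\<Sum>\<mu> | is_partition \<mu> \<and> \<kappa> \<mu> \<noteq> 0. of_nat (\<kappa> \<mu>) * schur_poly n \<mu>))"

definition boolean_product :: "nat \<Rightarrow> nat \<Rightarrow> mpolynomial" where
  "boolean_product n k = (\<Prod>S | S \<subseteq> {1..n} \<and> card S = k. \<Sum>i\<in>S. X i)"

definition total_boolean_product :: "nat \<Rightarrow> mpolynomial" where
  "total_boolean_product n = (\<Prod>k=1..n. boolean_product n k)"

end

(*
  Write f for the product. It suffices to find, for every partition t, a linear functional L_t on
  symmetric functions with L_t(s_u) = 0 for u \<noteq> t, L_t(s_t) > 0 and L_t(f) \<ge> 0.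
  A symmetric polynomial is viewed as the function M \<mapsto> f(eigenvalues of M) on n x n matrices, and L_t
  pairs it with a highest weight vector of weight t, i.e. applies a product of leading principal
  minors of the matrix of partial derivatives, one for each column of t.

  If f is a signed sum, over a finite group permuting tensor positions, of invariants
  sum_j prod_k M(j k)(j (g k)), then L_t(f) is a sum of squares, by averaging over the group and over
  the column group of t. The Boolean product has this form for a wreath-product group: a word on the
  slots of all subsets survives the signed average exactly if it is injective on every subset and
  sends different subsets to different sets. (Geometrically: the product is the top Chern class of a
  sum of exterior powers of the tautological quotient bundle, and its Chern form is positive.)

  Orthogonality of L_t to s_u, u \<noteq> t: the same formula for products of complete homogeneous
  polynomials vanishes unless u is dominated by t (Jacobi-Trudi), and for products of elementary ones
  it vanishes unless t is dominated by u.
*)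
theory Submission
  imports Defs "Jordan_Normal_Form.Schur_Decomposition"
    "HOL-Computational_Algebra.Formal_Power_Series"
begin

section \<open>Alternants and Schur expansions of symmetric word sums\<close>

text \<open>Expanding a Boolean product gives words whose positions are the subsets, and no signed
  group sum is visible on them. The remedy is to enlarge the words: every subset \<open>S\<close>
  contributes all its elements as slots, one slot per subset carries the matrix \<open>M\<close>,
  and the others carry the identity. Summing over the marked slots restores the linear factor of
  each subset, but every surviving word then yields the whole product again. What is represented is
  therefore the product times \<open>card (separating_words n Z)\<close>, which does not affect
  signs. The pairing lives over the complex numbers, because eigenvalues are needed, whereas the
  claim concerns integer polynomials in formal variables. The link is \<open>schur_coeff\<close>, an
  integer read off from the words alone. It gives the Schur expansion in every integral domain with
  distinct values of the variables, so a sign found over the complex numbers holds for the formal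
  variables. Both claims are instances of one statement about all subsets whose size lies in a set
  \<open>Z\<close> that does not contain 0.\<close>

definition alternant :: "nat \<Rightarrow> (nat \<Rightarrow> nat) \<Rightarrow> (nat \<Rightarrow> 'a::comm_ring_1) \<Rightarrow> 'a" where
  "alternant n a x = det (mat n n (\<lambda>(i, j). x j ^ a i))"

lemma alternant_leibniz:
  "alternant n a x = (\<Sum>p | p permutes {..<n}. of_int (sign p) * (\<Prod>i<n. x (p i) ^ a i))"
proof -
  have "alternant n a x = (\<Sum>p | p permutes {0..<n}. of_int (sign p) *
      (\<Prod>i=0..<n. mat n n (\<lambda>(i, j). x j ^ a i) $$ (i, p i)))"
    unfolding alternant_def by (rule det_def'[of "mat n n (\<lambda>(i, j). x j ^ a i)" n, OF mat_carrier])
  also have "\<dots> = (\<Sum>p | p permutes {0..<n}. of_int (sign p) * (\<Prod>i=0..<n. x (p i) ^ a i))"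
  proof (rule sum.cong[OF refl])
    fix p assume "p \<in> {p. p permutes {0..<n}}"
    then have "\<And>i. i < n \<Longrightarrow> p i < n" using permutes_in_image[of p "{0..<n}"] by auto
    then show "of_int (sign p) * (\<Prod>i=0..<n. mat n n (\<lambda>(i, j). x j ^ a i) $$ (i, p i))
      = of_int (sign p) * (\<Prod>i=0..<n. x (p i) ^ a i)"
      by (intro arg_cong2[of _ _ _ _ "(*)"] prod.cong) auto
  qed
  finally show ?thesis by (simp add: atLeast0LessThan)
qed

lemma alternant_cong: "(\<And>i. i < n \<Longrightarrow> a i = b i) \<Longrightarrow> alternant n a x = alternant n b x"
  unfolding alternant_def by (intro arg_cong[of _ _ det] eq_matI) auto

lemma alternant_permute:
  assumes "w permutes {..<n}"
  shows "alternant n (\<lambda>i. a (w i)) x = of_int (sign w) * alternant n a x"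
proof -
  let ?A = "mat n n (\<lambda>(i, j). x j ^ a i)"
  have w: "w permutes {0..<n}" using assms by (simp add: atLeast0LessThan)
  have "mat n n (\<lambda>(i, j). x j ^ a (w i)) = mat n n (\<lambda>(i, j). ?A $$ (w i, j))"
    using permutes_in_image[OF w] by (intro eq_matI) auto
  then show ?thesis unfolding alternant_def using det_permute_rows[of ?A n w, OF _ w] by simp
qed

lemma alternant_eq_0:
  assumes "\<not> inj_on a {..<n}"
  shows "alternant n a x = 0"
proof -
  obtain i k where ik: "i < n" "k < n" "i \<noteq> k" "a i = a k" using assms by (auto simp: inj_on_def)
  show ?thesis unfolding alternant_def
  proof (rule det_identical_rows[OF _ ik(3) ik(1) ik(2)])
    show "row (mat n n (\<lambda>(i, j). x j ^ a i)) i = row (mat n n (\<lambda>(i, j). x j ^ a i)) k"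
      using ik by (intro eq_vecI) auto
  qed simp
qed

definition wt :: "'k set \<Rightarrow> ('k \<Rightarrow> nat) \<Rightarrow> nat \<Rightarrow> nat" where
  "wt A j i = card {k \<in> A. j k = i}"

lemma prod_word_eq_wt:
  fixes x :: "nat \<Rightarrow> 'a::comm_monoid_mult"
  assumes "finite A" "\<And>k. k \<in> A \<Longrightarrow> j k < n"
  shows "(\<Prod>k\<in>A. x (j k)) = (\<Prod>i<n. x i ^ wt A j i)"
proof -
  have "(\<Prod>k\<in>A. x (j k)) = (\<Prod>i<n. \<Prod>k\<in>{k \<in> A. j k = i}. x (j k))"
    using assms by (subst prod.group) auto
  then show ?thesis by (simp add: wt_def)
qed

lemma sum_wt:
  assumes "finite A" "\<And>k. k \<in> A \<Longrightarrow> j k < n"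
  shows "(\<Sum>i<n. wt A j i) = card A"
proof -
  have "card A = (\<Sum>k\<in>A. 1)" by simp
  also have "\<dots> = (\<Sum>i<n. \<Sum>k\<in>{k \<in> A. j k = i}. 1)"
    using assms by (subst sum.group) auto
  finally show ?thesis by (simp add: wt_def)
qed

text \<open>Symmetry of the monomial sum is stated through a bijection of \<open>J\<close> that
  permutes contents, rather than as closure of \<open>J\<close> under relabelling letters. The words
  of \<open>choices\<close> need this freedom: relabelling their letters must be accompanied by
  moving the positions, which are themselves sets of letters.\<close>

definition symmetric_words :: "nat \<Rightarrow> 'k set \<Rightarrow> ('k \<Rightarrow> nat) set \<Rightarrow> bool" where
  "symmetric_words n A J \<longleftrightarrow> finite A \<and> J \<subseteq> A \<rightarrow>\<^sub>E {..<n} \<and>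
     (\<forall>w. w permutes {..<n} \<longrightarrow>
        (\<exists>\<phi>. bij_betw \<phi> J J \<and> (\<forall>j\<in>J. \<forall>i<n. wt A (\<phi> j) (w i) = wt A j i)))"

lemma symmetric_words_finite: "symmetric_words n A J \<Longrightarrow> finite J"
  unfolding symmetric_words_def by (meson finite_PiE finite_lessThan finite_subset)

lemma symmetric_wordsI:
  assumes A: "finite A" and sub: "J \<subseteq> A \<rightarrow>\<^sub>E {..<n}"
    and cl: "\<And>w j. w permutes {..<n} \<Longrightarrow> j \<in> J \<Longrightarrow> (\<lambda>k\<in>A. w (j k)) \<in> J"
  shows "symmetric_words n A J"
  unfolding symmetric_words_def
proof (intro conjI allI impI A sub)
  fix w assume w: "w permutes {..<n}"
  let ?\<phi> = "\<lambda>j. \<lambda>k\<in>A. w (j k)"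
  have "bij_betw ?\<phi> J J"
  proof (rule bij_betwI[where g = "\<lambda>j. \<lambda>k\<in>A. inv_into UNIV w (j k)"])
    fix j assume "j \<in> J"
    then have j: "j \<in> A \<rightarrow>\<^sub>E {..<n}" using sub by auto
    show "(\<lambda>k\<in>A. inv_into UNIV w ((\<lambda>k\<in>A. w (j k)) k)) = j"
      using j permutes_inverses[OF w] by (auto simp: fun_eq_iff PiE_def extensional_def)
    show "(\<lambda>k\<in>A. w ((\<lambda>k\<in>A. inv_into UNIV w (j k)) k)) = j"
      using j permutes_inverses[OF w] by (auto simp: fun_eq_iff PiE_def extensional_def)
  qed (use cl w permutes_inv[OF w] in auto)
  moreover have "wt A (?\<phi> j) (w i) = wt A j i" for j i
    unfolding wt_def using inj_eq[OF permutes_inj[OF w]] by (intro arg_cong[of _ _ card]) auto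
  ultimately show "\<exists>\<phi>. bij_betw \<phi> J J \<and> (\<forall>j\<in>J. \<forall>i<n. wt A (\<phi> j) (w i) = wt A j i)" by blast
qed

lemma sum_symmetric_words:
  fixes x :: "nat \<Rightarrow> 'a::comm_ring_1"
  assumes J: "symmetric_words n A J" and w: "w permutes {..<n}"
  shows "(\<Sum>j\<in>J. \<Prod>k\<in>A. x (j k)) = (\<Sum>j\<in>J. \<Prod>i<n. x (w i) ^ wt A j i)"
proof -
  obtain \<phi> where \<phi>: "bij_betw \<phi> J J" "\<And>j i. j \<in> J \<Longrightarrow> i < n \<Longrightarrow> wt A (\<phi> j) (w i) = wt A j i"
    using J w unfolding symmetric_words_def by blast
  have "(\<Sum>j\<in>J. \<Prod>k\<in>A. x (j k)) = (\<Sum>j\<in>J. \<Prod>i<n. x i ^ wt A j i)"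
    using J by (intro sum.cong refl prod_word_eq_wt) (auto simp: symmetric_words_def dest!: subsetD PiE_mem)
  also have "\<dots> = (\<Sum>j\<in>J. \<Prod>i<n. x i ^ wt A (\<phi> j) i)"
    by (rule sum.reindex_bij_betw[OF \<phi>(1), symmetric])
  also have "\<dots> = (\<Sum>j\<in>J. \<Prod>i<n. x (w i) ^ wt A j i)"
  proof (rule sum.cong[OF refl])
    fix j assume j: "j \<in> J"
    have "(\<Prod>i<n. x i ^ wt A (\<phi> j) i) = (\<Prod>i<n. x (w i) ^ wt A (\<phi> j) (w i))"
      using prod.permute[OF w, of "\<lambda>i. x i ^ wt A (\<phi> j) i"] by (simp add: o_def)
    then show "(\<Prod>i<n. x i ^ wt A (\<phi> j) i) = (\<Prod>i<n. x (w i) ^ wt A j i)" by (simp add: \<phi>(2)[OF j])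
  qed
  finally show ?thesis .
qed

text \<open>In the Leibniz term of a permutation \<open>p\<close> the symmetric sum may be evaluated
  at the variables permuted by \<open>p\<close>; its exponents then add to those of the alternant,
  term by term.\<close>

lemma symmetric_words_times_alternant:
  fixes x :: "nat \<Rightarrow> 'a::comm_ring_1"
  assumes J: "symmetric_words n A J"
  shows "(\<Sum>j\<in>J. \<Prod>k\<in>A. x (j k)) * alternant n d x = (\<Sum>j\<in>J. alternant n (\<lambda>i. d i + wt A j i) x)"
proof -
  have "(\<Sum>j\<in>J. \<Prod>k\<in>A. x (j k)) * alternant n d x
    = (\<Sum>p | p permutes {..<n}. \<Sum>j\<in>J. of_int (sign p) * (\<Prod>i<n. x (p i) ^ (d i + wt A j i)))"
    unfolding alternant_leibniz sum_distrib_left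
    by (intro sum.cong refl)
       (simp add: sum_symmetric_words[OF J] sum_distrib_left sum_distrib_right power_add prod.distrib mult_ac)
  also have "\<dots> = (\<Sum>j\<in>J. alternant n (\<lambda>i. d i + wt A j i) x)"
    unfolding alternant_leibniz by (rule sum.swap)
  finally show ?thesis .
qed

section \<open>Partitions and the straightening of alternants\<close>

definition delta :: "nat \<Rightarrow> nat \<Rightarrow> nat" where
  "delta n i = n - 1 - i"

definition parts :: "nat \<Rightarrow> nat \<Rightarrow> (nat \<Rightarrow> nat) set" where
  "parts n d = {t. (\<forall>i. t (Suc i) \<le> t i) \<and> (\<forall>i\<ge>n. t i = 0) \<and> (\<Sum>i<n. t i) = d}"

lemma parts_antimono: "t \<in> parts n d \<Longrightarrow> i \<le> k \<Longrightarrow> t k \<le> t i"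
  unfolding parts_def by (rule lift_Suc_antimono_le[of t]) auto

lemma parts_zero: "t \<in> parts n d \<Longrightarrow> n \<le> i \<Longrightarrow> t i = 0"
  by (simp add: parts_def)

lemma finite_parts: "finite (parts n d)"
proof (rule finite_subset)
  let ?E = "(\<lambda>f i. if i < n then f i else 0) ` ({..<n} \<rightarrow>\<^sub>E {..d})"
  show "finite ?E" by (intro finite_imageI finite_PiE) auto
  show "parts n d \<subseteq> ?E"
  proof
    fix t assume t: "t \<in> parts n d"
    have "t i \<le> d" if "i < n" for i
      using t that member_le_sum[of i "{..<n}" t] by (auto simp: parts_def)
    then have "restrict t {..<n} \<in> {..<n} \<rightarrow>\<^sub>E {..d}" by auto
    moreover have "t = (\<lambda>i. if i < n then restrict t {..<n} i else 0)"
      using parts_zero[OF t] by (auto simp: fun_eq_iff)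
    ultimately show "t \<in> ?E" by blast
  qed
qed

lemma parts_delta_strict:
  assumes "t \<in> parts n d" "i < k" "k < n"
  shows "t k + delta n k < t i + delta n i"
  using parts_antimono[OF assms(1), of i k] assms(2,3) by (auto simp: delta_def)

text \<open>The straightening datum of an exponent vector: \<open>t\<close> is what remains when the
  exponents are sorted decreasingly and \<open>delta\<close> is subtracted. There is at most one
  such partition and permutation, and none if an exponent is repeated, so the sum of
  \<open>sign w\<close> over the sorting \<open>w\<close> is 0, 1 or -1.\<close>

definition sorts :: "nat \<Rightarrow> (nat \<Rightarrow> nat) \<Rightarrow> (nat \<Rightarrow> nat) \<Rightarrow> (nat \<Rightarrow> nat) \<Rightarrow> bool" where
  "sorts n b t w \<longleftrightarrow> w permutes {..<n} \<and> (\<forall>i<n. b i = t (w i) + delta n (w i))"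

lemma permutes_strict_mono_id:
  assumes p: "p permutes {..<n::nat}" and mono: "\<And>i k. i < k \<Longrightarrow> k < n \<Longrightarrow> p i < p k"
  shows "p = id"
proof -
  have "i \<le> p i" if "i < n" for i
    using that
  proof (induction i)
    case (Suc i)
    then show ?case using mono[of i "Suc i"] by auto
  qed simp
  then show ?thesis using permutes_natset_ge[OF p] by auto
qed

text \<open>The permutation \<open>w' \<circ> inv_into UNIV w\<close> matches two strictly
  decreasing sequences, hence is strictly increasing, hence is the identity.\<close>

lemma sorts_unique:
  assumes t: "t \<in> parts n d" "sorts n b t w" and t': "t' \<in> parts n d'" "sorts n b t' w'"
  shows "t = t' \<and> w = w'"
proof -
  have w: "w permutes {..<n}" and w': "w' permutes {..<n}"
    and b: "\<And>i. i < n \<Longrightarrow> b i = t (w i) + delta n (w i)"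
    and b': "\<And>i. i < n \<Longrightarrow> b i = t' (w' i) + delta n (w' i)"
    using t t' by (auto simp: sorts_def)
  let ?p = "w' \<circ> inv_into UNIV w"
  have p: "?p permutes {..<n}" by (rule permutes_compose[OF permutes_inv[OF w] w'])
  have eq: "t i + delta n i = t' (?p i) + delta n (?p i)" if "i < n" for i
  proof -
    have "inv_into UNIV w i < n" using permutes_in_image[OF permutes_inv[OF w], of i] that by auto
    then show ?thesis using b[of "inv_into UNIV w i"] b'[of "inv_into UNIV w i"] permutes_inverses[OF w] by auto
  qed
  have "?p = id"
  proof (rule permutes_strict_mono_id[OF p])
    fix i k :: nat assume ik: "i < k" "k < n"
    have pn: "?p i < n" "?p k < n" using permutes_in_image[OF p] ik by (auto simp del: o_apply)
    have "t k + delta n k < t i + delta n i" by (rule parts_delta_strict[OF t(1) ik])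
    then have lt: "t' (?p k) + delta n (?p k) < t' (?p i) + delta n (?p i)" using eq ik by auto
    show "?p i < ?p k"
    proof (rule ccontr)
      assume "\<not> ?p i < ?p k"
      then have "?p k \<le> ?p i" by simp
      then have "t' (?p i) + delta n (?p i) \<le> t' (?p k) + delta n (?p k)"
        using parts_antimono[OF t'(1)] by (intro add_mono) (auto simp: delta_def)
      then show False using lt by simp
    qed
  qed
  then have "w' \<circ> inv_into UNIV w = id" .
  then have "w = w'" using permutes_inverses(2)[OF w] by (metis comp_apply eq_id_iff ext)
  moreover have "t = t'"
  proof
    fix i show "t i = t' i"
      using eq[of i] \<open>?p = id\<close> parts_zero[OF t(1)] parts_zero[OF t'(1)]
      by (cases "i < n") (auto dest: fun_cong)
  qed
  ultimately show ?thesis by simp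
qed

lemma sorts_exists:
  assumes inj: "inj_on b {..<n}" and s: "(\<Sum>i<n. b i) = d + (\<Sum>i<n. delta n i)"
  shows "\<exists>t\<in>parts n d. \<exists>w. sorts n b t w"
proof -
  let ?xs = "map b [0..<n]"
  let ?ys = "rev (sort ?xs)"
  have "mset ?xs = mset ?ys" by simp
  then obtain w where w0: "w permutes {..<length ?ys}" "permute_list w ?ys = ?xs"
    by (rule mset_eq_permutation)
  have w: "w permutes {..<n}" using w0 by simp
  have bw: "b i = ?ys ! w i" if "i < n" for i
  proof -
    have "b i = ?xs ! i" using that by simp
    also have "\<dots> = ?ys ! w i" using permute_list_nth[OF w0(1), of i] w0(2) that by simp
    finally show ?thesis .
  qed
  have "distinct ?xs" using inj by (simp add: distinct_map atLeast0LessThan)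
  then have "sorted_wrt (<) (sort ?xs)" by (simp add: strict_sorted_iff)
  then have "sorted_wrt (>) ?ys" by (simp add: sorted_wrt_rev)
  then have dec: "?ys ! k < ?ys ! i" if "i < k" "k < n" for i k
    using that sorted_wrt_nth_less[of "(>)" ?ys i k] by simp
  \<comment> \<open>In a strictly decreasing sequence of naturals an entry followed by
    \<open>m\<close> others is at least \<open>m\<close>; the induction starts at the last
    entry.\<close>
  have ge: "delta n i \<le> ?ys ! i" if "i < n" for i
  proof -
    have "\<forall>m<n. m \<le> ?ys ! (n - 1 - m)"
    proof (intro allI impI)
      fix m assume "m < n" then show "m \<le> ?ys ! (n - 1 - m)"
      proof (induction m)
        case (Suc m)
        then have "n - 1 - Suc m < n - 1 - m" "n - 1 - m < n" by auto
        from dec[OF this] Suc show ?case by linarith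
      qed simp
    qed
    moreover have "n - 1 - (n - 1 - i) = i" "n - 1 - i < n" using that by auto
    ultimately show ?thesis unfolding delta_def by metis
  qed
  define t where "t i = (if i < n then ?ys ! i - delta n i else 0)" for i
  have yt: "?ys ! i = t i + delta n i" if "i < n" for i
    using ge[OF that] that by (simp add: t_def)
  have sw: "sorts n b t w"
    unfolding sorts_def using w bw yt permutes_in_image[OF w] by auto
  have "t \<in> parts n d"
    unfolding parts_def
  proof (intro CollectI conjI allI impI)
    fix i show "t (Suc i) \<le> t i"
    proof (cases "Suc i < n")
      case True
      then show ?thesis using dec[of i "Suc i"] yt[of i] yt[of "Suc i"] by (auto simp: delta_def)
    qed (simp add: t_def)
  next
    fix i assume "n \<le> i" then show "t i = 0" by (simp add: t_def)
  next
    have "(\<Sum>i<n. b i) = (\<Sum>i<n. t (w i) + delta n (w i))"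
      using sw by (intro sum.cong) (auto simp: sorts_def)
    also have "\<dots> = (\<Sum>i<n. t i + delta n i)"
      using sum.permute[OF w, of "\<lambda>i. t i + delta n i"] by (simp add: o_def)
    finally show "(\<Sum>i<n. t i) = d" using s by (simp add: sum.distrib)
  qed
  then show ?thesis using sw by blast
qed

text \<open>Distinct exponents are sorted by exactly one permutation, which contributes its sign.
  With a repeated exponent the determinant has two equal rows, and every sum over sorting
  permutations is empty.\<close>

lemma alternant_expand_parts:
  fixes x :: "nat \<Rightarrow> 'a::comm_ring_1"
  assumes s: "(\<Sum>i<n. b i) = d + (\<Sum>i<n. delta n i)"
  shows "alternant n b x = (\<Sum>t\<in>parts n d. of_int (\<Sum>w | sorts n b t w. sign w) * alternant n (\<lambda>i. t i + delta n i) x)"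
proof (cases "inj_on b {..<n}")
  case True
  then obtain t w where tw: "t \<in> parts n d" "sorts n b t w" using sorts_exists[OF _ s] by blast
  have w: "w permutes {..<n}" using tw by (simp add: sorts_def)
  have eq: "{v. sorts n b t' v} = (if t' = t then {w} else {})" if t': "t' \<in> parts n d" for t'
  proof (cases "t' = t")
    case True
    have "v = w" if "sorts n b t v" for v
      by (rule sorts_unique[OF tw(1) that tw, THEN conjunct2])
    then have "{v. sorts n b t v} = {w}" using tw(2) by blast
    then show ?thesis by (simp only: True simp_thms if_True)
  next
    case False
    have "\<not> sorts n b t' v" for v
      using sorts_unique[OF t' _ tw] False by blast
    then show ?thesis by (simp add: False)
  qed
  have "(\<Sum>t\<in>parts n d. of_int (\<Sum>w | sorts n b t w. sign w) * alternant n (\<lambda>i. t i + delta n i) x)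
    = (\<Sum>t'\<in>parts n d. if t' = t then of_int (sign w) * alternant n (\<lambda>i. t i + delta n i) x else 0)"
  proof (intro sum.cong[OF refl])
    fix t' assume "t' \<in> parts n d"
    from eq[OF this] show "of_int (\<Sum>w | sorts n b t' w. sign w) * alternant n (\<lambda>i. t' i + delta n i) x
      = (if t' = t then of_int (sign w) * alternant n (\<lambda>i. t i + delta n i) x else 0)"
      by (cases "t' = t") simp_all
  qed
  also have "\<dots> = of_int (sign w) * alternant n (\<lambda>i. t i + delta n i) x"
    using tw(1) finite_parts by (simp add: sum.delta)
  also have "\<dots> = alternant n (\<lambda>i. t (w i) + delta n (w i)) x"
    using alternant_permute[OF w, of "\<lambda>i. t i + delta n i" x] by simp
  also have "\<dots> = alternant n b x" using tw(2) by (intro alternant_cong) (auto simp: sorts_def)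
  finally show ?thesis ..
next
  case False
  have "{w. sorts n b t w} = {}" if t: "t \<in> parts n d" for t
  proof -
    have "inj_on b {..<n}" if "sorts n b t w" for w
    proof (rule inj_onI)
      fix i k assume ik: "i \<in> {..<n}" "k \<in> {..<n}" "b i = b k"
      have w: "w permutes {..<n}" using that by (simp add: sorts_def)
      have "w i < n" "w k < n" using permutes_in_image[OF w] ik by auto
      moreover have "t (w i) + delta n (w i) = t (w k) + delta n (w k)"
        using that ik by (auto simp: sorts_def)
      ultimately have "w i = w k"
        using parts_delta_strict[OF t, of "w i" "w k"] parts_delta_strict[OF t, of "w k" "w i"]
        by (metis less_irrefl linorder_neqE_nat)
      then show "i = k" using permutes_inj[OF w] by (auto dest: injD)
    qed
    then show ?thesis using False by blast
  qed
  then show ?thesis using alternant_eq_0[OF False] by simp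
qed

definition schur_coeff :: "nat \<Rightarrow> 'k set \<Rightarrow> ('k \<Rightarrow> nat) set \<Rightarrow> (nat \<Rightarrow> nat) \<Rightarrow> int" where
  "schur_coeff n A J t = (\<Sum>j\<in>J. \<Sum>w | sorts n (\<lambda>i. delta n i + wt A j i) t w. sign w)"

lemma symmetric_words_alternant_expansion:
  fixes x :: "nat \<Rightarrow> 'a::comm_ring_1"
  assumes J: "symmetric_words n A J"
  shows "(\<Sum>j\<in>J. \<Prod>k\<in>A. x (j k)) * alternant n (delta n) x
    = (\<Sum>t\<in>parts n (card A). of_int (schur_coeff n A J t) * alternant n (\<lambda>i. t i + delta n i) x)"
proof -
  have "alternant n (\<lambda>i. delta n i + wt A j i) x
    = (\<Sum>t\<in>parts n (card A). of_int (\<Sum>w | sorts n (\<lambda>i. delta n i + wt A j i) t w. sign w)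
         * alternant n (\<lambda>i. t i + delta n i) x)" if "j \<in> J" for j
  proof (rule alternant_expand_parts)
    have "finite A" "j \<in> A \<rightarrow>\<^sub>E {..<n}" using J that by (auto simp: symmetric_words_def)
    then have "(\<Sum>i<n. wt A j i) = card A" by (intro sum_wt) (auto dest: PiE_mem)
    then show "(\<Sum>i<n. delta n i + wt A j i) = card A + (\<Sum>i<n. delta n i)"
      by (simp add: sum.distrib)
  qed
  then have "(\<Sum>j\<in>J. alternant n (\<lambda>i. delta n i + wt A j i) x)
    = (\<Sum>t\<in>parts n (card A). \<Sum>j\<in>J. of_int (\<Sum>w | sorts n (\<lambda>i. delta n i + wt A j i) t w. sign w)
         * alternant n (\<lambda>i. t i + delta n i) x)"
    by (subst sum.swap) (rule sum.cong[OF refl], blast)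
  then show ?thesis
    unfolding symmetric_words_times_alternant[OF J] schur_coeff_def
    by (simp add: sum_distrib_right)
qed

section \<open>Bialternants, branching and the Jacobi--Trudi identity\<close>

text \<open>Subtracting \<open>x n ^ (a i - a (Suc i))\<close> times row \<open>i + 1\<close> from
  row \<open>i\<close> clears the last column except for its bottom entry. Every other entry of the
  rows above acquires the factor \<open>x j - x n\<close>, multiplied by a geometric sum
  \<open>g i j\<close>; expanding the remaining minor over the exponents \<open>m i\<close> in these
  sums yields smaller alternants.\<close>

lemma alternant_branch:
  fixes x :: "nat \<Rightarrow> 'a::comm_ring_1"
  assumes mono: "\<And>i. i < n \<Longrightarrow> a (Suc i) \<le> a i"
  shows "alternant (Suc n) a x = x n ^ a n * (\<Prod>j<n. x j - x n) *
    (\<Sum>m\<in>PiE {..<n} (\<lambda>i. {a (Suc i)..<a i}). alternant n m x * (\<Prod>i<n. x n ^ (a i - 1 - m i)))"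
proof -
  let ?A = "mat (Suc n) (Suc n) (\<lambda>(i, j). x j ^ a i)"
  define c where "c i = x n ^ (a i - a (Suc i))" for i
  define U where "U = mat (Suc n) (Suc n) (\<lambda>(i, k). if k = i then 1 else if k = Suc i then - c i else 0)"
  define g where "g i j = (\<Sum>m=a (Suc i)..<a i. x j ^ m * x n ^ (a i - 1 - m))" for i j
  let ?B = "mat (Suc n) (Suc n) (\<lambda>(i, j). if i < n then (x j - x n) * g i j else x j ^ a i)"
  have U: "U \<in> carrier_mat (Suc n) (Suc n)" by (simp add: U_def)
  have "diag_mat U = replicate (Suc n) 1"
    by (intro nth_equalityI) (auto simp: diag_mat_def U_def simp del: replicate_Suc upt_Suc)
  then have "prod_list (diag_mat U) = 1" by simp
  moreover have "upper_triangular U" by (auto simp: upper_triangular_def U_def)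
  ultimately have detU: "det U = 1" using det_upper_triangular[OF _ U] by simp
  have "U * ?A = ?B"
  proof (intro eq_matI)
    fix i j assume "i < dim_row ?B" "j < dim_col ?B"
    then have i: "i < Suc n" and j: "j < Suc n" by auto
    have "(U * ?A) $$ (i, j) = (\<Sum>k<Suc n. (if k = i then 1 else if k = Suc i then - c i else 0) * x j ^ a k)"
      using i j by (simp add: U_def scalar_prod_def atLeast0LessThan)
    also have "\<dots> = (\<Sum>k<Suc n. (if k = i then x j ^ a i else 0) + (if k = Suc i then - c i * x j ^ a (Suc i) else 0))"
      by (intro sum.cong) auto
    also have "\<dots> = x j ^ a i + (if i < n then - c i * x j ^ a (Suc i) else 0)"
      using i by (simp add: sum.distrib del: sum.lessThan_Suc)
    also have "\<dots> = ?B $$ (i, j)"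
    proof (cases "i < n")
      case True
      let ?d = "a i - a (Suc i)"
      have ai: "a i = a (Suc i) + ?d" using mono[OF True] by simp
      have "g i j = (\<Sum>k<?d. x j ^ (a (Suc i) + k) * x n ^ (a i - 1 - (a (Suc i) + k)))"
        unfolding g_def
        by (rule sum.reindex_bij_witness[where i = "\<lambda>k. a (Suc i) + k" and j = "\<lambda>m. m - a (Suc i)"]) auto
      also have "\<dots> = x j ^ a (Suc i) * (\<Sum>k<?d. x n ^ (?d - Suc k) * x j ^ k)"
        unfolding sum_distrib_left by (intro sum.cong) (auto simp: power_add mult_ac)
      finally have "(x j - x n) * g i j = x j ^ a (Suc i) * ((x j - x n) * (\<Sum>k<?d. x n ^ (?d - Suc k) * x j ^ k))"
        by (simp add: mult_ac)
      also have "\<dots> = x j ^ a (Suc i) * (x j ^ ?d - x n ^ ?d)"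
        by (simp only: power_diff_sumr2)
      also have "\<dots> = x j ^ a i - c i * x j ^ a (Suc i)"
        by (subst (2) ai) (simp add: c_def power_add algebra_simps)
      finally show ?thesis using True i j by simp
    qed (use i j in auto)
    finally show "(U * ?A) $$ (i, j) = ?B $$ (i, j)" .
  qed (auto simp: U_def)
  then have "det ?B = alternant (Suc n) a x"
    using det_mult[OF U, of ?A] detU by (simp add: alternant_def)
  moreover have "det ?B = (\<Sum>i<Suc n. ?B $$ (i, n) * cofactor ?B i n)"
    by (rule laplace_expansion_column) auto
  moreover have "\<dots> = x n ^ a n * cofactor ?B n n"
    by simp
  moreover have "cofactor ?B n n = det (mat n n (\<lambda>(i, j). (x j - x n) * g i j))"
  proof -
    have "mat_delete ?B n n = mat n n (\<lambda>(i, j). (x j - x n) * g i j)"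
      by (intro eq_matI) (auto simp: mat_delete_def)
    then show ?thesis by (simp add: cofactor_def)
  qed
  moreover have "det (mat n n (\<lambda>(i, j). (x j - x n) * g i j)) = (\<Prod>j<n. x j - x n) *
    (\<Sum>m\<in>PiE {..<n} (\<lambda>i. {a (Suc i)..<a i}). alternant n m x * (\<Prod>i<n. x n ^ (a i - 1 - m i)))"
  proof -
    let ?M = "mat n n (\<lambda>(i, j). (x j - x n) * g i j)"
    have "det ?M = (\<Sum>p | p permutes {0..<n}. of_int (sign p) * (\<Prod>i=0..<n. ?M $$ (i, p i)))"
      by (subst det_def'[of _ n]) auto
    also have "\<dots> = (\<Sum>p | p permutes {..<n}. of_int (sign p) * ((\<Prod>j<n. x j - x n) * (\<Prod>i<n. g i (p i))))"
      unfolding atLeast0LessThan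
    proof (rule sum.cong[OF refl])
      fix p assume "p \<in> {p. p permutes {..<n}}"
      then have p: "p permutes {..<n}" by simp
      have "(\<Prod>i<n. ?M $$ (i, p i)) = (\<Prod>i<n. x (p i) - x n) * (\<Prod>i<n. g i (p i))"
        unfolding prod.distrib[symmetric] using permutes_in_image[OF p] by (intro prod.cong) auto
      also have "(\<Prod>i<n. x (p i) - x n) = (\<Prod>j<n. x j - x n)"
        using prod.permute[OF p, of "\<lambda>j. x j - x n"] by (simp add: o_def)
      finally show "of_int (sign p) * (\<Prod>i<n. ?M $$ (i, p i))
        = of_int (sign p) * ((\<Prod>j<n. x j - x n) * (\<Prod>i<n. g i (p i)))" by simp
    qed
    also have "\<dots> = (\<Prod>j<n. x j - x n) * (\<Sum>p | p permutes {..<n}. \<Sum>m\<in>PiE {..<n} (\<lambda>i. {a (Suc i)..<a i}).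
        of_int (sign p) * (\<Prod>i<n. x (p i) ^ m i) * (\<Prod>i<n. x n ^ (a i - 1 - m i)))"
      unfolding g_def
      by (subst prod_sum_PiE) (auto simp: sum_distrib_left prod.distrib mult_ac)
    also have "\<dots> = (\<Prod>j<n. x j - x n) *
      (\<Sum>m\<in>PiE {..<n} (\<lambda>i. {a (Suc i)..<a i}). alternant n m x * (\<Prod>i<n. x n ^ (a i - 1 - m i)))"
      unfolding alternant_leibniz sum_distrib_right by (subst sum.swap) simp
    finally show ?thesis .
  qed
  ultimately show ?thesis by (simp add: mult.assoc)
qed

text \<open>Interlacing appears here: once \<open>delta\<close> is removed, the half-open ranges
  between consecutive exponents become the closed ranges between consecutive parts. The degree in
  the last variable is the number of cells removed.\<close>

lemma alternant_branch_delta: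
  fixes x :: "nat \<Rightarrow> 'a::comm_ring_1"
  assumes mono: "\<And>i. i < n \<Longrightarrow> t (Suc i) \<le> t i"
  shows "alternant (Suc n) (\<lambda>i. t i + delta (Suc n) i) x = (\<Prod>j<n. x j - x n) *
    (\<Sum>m\<in>PiE {..<n} (\<lambda>i. {t (Suc i)..t i}). alternant n (\<lambda>i. m i + delta n i) x *
       x n ^ ((\<Sum>i<Suc n. t i) - (\<Sum>i<n. m i)))"
proof -
  let ?a = "\<lambda>i. t i + delta (Suc n) i"
  let ?I = "\<lambda>i. {?a (Suc i)..<?a i}"
  have d: "delta (Suc n) i = Suc (delta n i)" "delta (Suc n) (Suc i) = delta n i" if "i < n" for i
    using that by (auto simp: delta_def)
  have *: "(\<Sum>m\<in>PiE {..<n} ?I. alternant n m x * (x n ^ t n * (\<Prod>i<n. x n ^ (?a i - 1 - m i))))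
    = (\<Sum>m\<in>PiE {..<n} (\<lambda>i. {t (Suc i)..t i}). alternant n (\<lambda>i. m i + delta n i) x *
       x n ^ ((\<Sum>i<Suc n. t i) - (\<Sum>i<n. m i)))"
  proof (rule sum.reindex_bij_witness[where i = "\<lambda>m. \<lambda>i\<in>{..<n}. m i + delta n i"
        and j = "\<lambda>m. \<lambda>i\<in>{..<n}. m i - delta n i"])
    fix m assume m: "m \<in> PiE {..<n} ?I"
    have mi: "t (Suc i) + delta n i \<le> m i" "m i \<le> t i + delta n i" if "i < n" for i
      using PiE_mem[OF m, of i] that d[OF that] by auto
    have mi': "t (Suc i) \<le> m i - delta n i" "m i - delta n i \<le> t i" "delta n i \<le> m i" if "i < n" for i
      using mi[OF that] by linarith+
    show "(\<lambda>i\<in>{..<n}. (\<lambda>i\<in>{..<n}. m i - delta n i) i + delta n i) = m"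
      using m mi' by (auto simp: fun_eq_iff PiE_def extensional_def)
    show "(\<lambda>i\<in>{..<n}. m i - delta n i) \<in> PiE {..<n} (\<lambda>i. {t (Suc i)..t i})"
      using mi' by auto
    have "alternant n (\<lambda>i. (\<lambda>i\<in>{..<n}. m i - delta n i) i + delta n i) x = alternant n m x"
      using mi' by (intro alternant_cong) auto
    moreover have "(\<Sum>i<Suc n. t i) - (\<Sum>i<n. (\<lambda>i\<in>{..<n}. m i - delta n i) i)
      = t n + (\<Sum>i<n. ?a i - 1 - m i)"
    proof -
      have "(\<Sum>i<n. t i) = (\<Sum>i<n. (m i - delta n i) + (?a i - 1 - m i))"
      proof (intro sum.cong refl)
        fix i assume "i \<in> {..<n}"
        then show "t i = (m i - delta n i) + (?a i - 1 - m i)"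
          using mi[of i] d[of i] by simp
      qed
      then show ?thesis by (simp add: sum.distrib)
    qed
    ultimately show "alternant n (\<lambda>i. (\<lambda>i\<in>{..<n}. m i - delta n i) i + delta n i) x *
       x n ^ ((\<Sum>i<Suc n. t i) - (\<Sum>i<n. (\<lambda>i\<in>{..<n}. m i - delta n i) i))
      = alternant n m x * (x n ^ t n * (\<Prod>i<n. x n ^ (?a i - 1 - m i)))"
      by (simp only: power_add power_sum)
  next
    fix m assume m: "m \<in> PiE {..<n} (\<lambda>i. {t (Suc i)..t i})"
    show "(\<lambda>i\<in>{..<n}. (\<lambda>i\<in>{..<n}. m i + delta n i) i - delta n i) = m"
      using m by (auto simp: fun_eq_iff PiE_def extensional_def)
    show "(\<lambda>i\<in>{..<n}. m i + delta n i) \<in> PiE {..<n} ?I"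
      using PiE_mem[OF m] d by (auto simp: less_Suc_eq_le)
  qed
  have "alternant (Suc n) ?a x = x n ^ t n * (\<Prod>j<n. x j - x n) *
      (\<Sum>m\<in>PiE {..<n} ?I. alternant n m x * (\<Prod>i<n. x n ^ (?a i - 1 - m i)))"
  proof -
    have "?a (Suc i) \<le> ?a i" if "i < n" for i using mono[OF that] d[OF that] by simp
    from alternant_branch[of n ?a x, OF this] show ?thesis by (simp add: delta_def)
  qed
  also have "\<dots> = (\<Prod>j<n. x j - x n) *
      (\<Sum>m\<in>PiE {..<n} ?I. alternant n m x * (x n ^ t n * (\<Prod>i<n. x n ^ (?a i - 1 - m i))))"
    by (simp add: sum_distrib_left mult_ac)
  finally show ?thesis unfolding * .
qed

text \<open>The branching rule as a recursion: \<open>m\<close> interlaces with \<open>t\<close>,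
  and the last variable records the size of the horizontal strip between them. This form involves no
  division, so it makes sense at equal values of the variables, where the bialternant quotient does
  not.\<close>

primrec schur_fn :: "nat \<Rightarrow> (nat \<Rightarrow> nat) \<Rightarrow> (nat \<Rightarrow> 'a::comm_ring_1) \<Rightarrow> 'a" where
  "schur_fn 0 t x = 1"
| "schur_fn (Suc n) t x = (\<Sum>m\<in>PiE {..<n} (\<lambda>i. {t (Suc i)..t i}).
     schur_fn n m x * x n ^ ((\<Sum>i<Suc n. t i) - (\<Sum>i<n. m i)))"

lemma alternant_delta_Suc:
  fixes x :: "nat \<Rightarrow> 'a::comm_ring_1"
  shows "alternant (Suc n) (delta (Suc n)) x = (\<Prod>j<n. x j - x n) * alternant n (delta n) x"
proof -
  have "PiE {..<n} (\<lambda>i. {0..0::nat}) = PiE {..<n} (\<lambda>i. {(\<lambda>i\<in>{..<n}. 0) i})"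
    by (rule PiE_cong) simp
  then have "PiE {..<n} (\<lambda>i. {0..0::nat}) = {\<lambda>i\<in>{..<n}. 0}"
    by (simp only: PiE_singleton[OF restrict_extensional])
  moreover have "alternant n (\<lambda>i. (\<lambda>i\<in>{..<n}. 0) i + delta n i) x = alternant n (delta n) x"
    by (rule alternant_cong) auto
  moreover have "alternant (Suc n) (\<lambda>i. 0 + delta (Suc n) i) x = (\<Prod>j<n. x j - x n) *
    (\<Sum>m\<in>PiE {..<n} (\<lambda>i. {0..0}). alternant n (\<lambda>i. m i + delta n i) x *
       x n ^ ((\<Sum>i<Suc n. 0) - (\<Sum>i<n. m i)))"
    by (rule alternant_branch_delta) simp
  ultimately show ?thesis by simp
qed

text \<open>The bialternant formula with its denominator multiplied out. Branching produces the
  factor \<open>\<Prod>j<n. x j - x n\<close> for \<open>t\<close> and, by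
  \<open>alternant_delta_Suc\<close>, also for the Vandermonde determinant, so the induction only
  compares the remaining sums.\<close>

lemma alternant_eq_schur_fn:
  fixes x :: "nat \<Rightarrow> 'a::comm_ring_1"
  assumes "\<And>i. Suc i < n \<Longrightarrow> t (Suc i) \<le> t i"
  shows "alternant n (\<lambda>i. t i + delta n i) x = schur_fn n t x * alternant n (delta n) x"
  using assms
proof (induction n arbitrary: t)
  case 0
  show ?case by (simp add: alternant_def)
next
  case (Suc n)
  have IH: "alternant n (\<lambda>i. m i + delta n i) x = schur_fn n m x * alternant n (delta n) x"
    if m: "m \<in> PiE {..<n} (\<lambda>i. {t (Suc i)..t i})" for m
  proof (rule Suc.IH)
    fix i assume i: "Suc i < n"
    then show "m (Suc i) \<le> m i" using PiE_mem[OF m, of i] PiE_mem[OF m, of "Suc i"] by auto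
  qed
  have "alternant (Suc n) (\<lambda>i. t i + delta (Suc n) i) x = (\<Prod>j<n. x j - x n) *
    (\<Sum>m\<in>PiE {..<n} (\<lambda>i. {t (Suc i)..t i}). alternant n (\<lambda>i. m i + delta n i) x *
       x n ^ ((\<Sum>i<Suc n. t i) - (\<Sum>i<n. m i)))"
    using Suc.prems by (intro alternant_branch_delta) auto
  also have "\<dots> = schur_fn (Suc n) t x * alternant (Suc n) (delta (Suc n)) x"
    by (simp add: IH alternant_delta_Suc sum_distrib_left sum_distrib_right mult_ac)
  finally show ?case .
qed

lemma alternant_delta_nonzero:
  fixes x :: "nat \<Rightarrow> 'a::idom"
  assumes "inj_on x {..<n}"
  shows "alternant n (delta n) x \<noteq> 0"
  using assms
proof (induction n)
  case (Suc n)
  then show ?case by (auto simp: alternant_delta_Suc inj_on_def)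
qed (simp add: alternant_def)

section \<open>Complete homogeneous polynomials and the Jacobi-Trudi determinant\<close>

primrec hsym :: "nat \<Rightarrow> nat \<Rightarrow> (nat \<Rightarrow> 'a::comm_ring_1) \<Rightarrow> 'a" where
  "hsym 0 m x = (if m = 0 then 1 else 0)"
| "hsym (Suc n) m x = (\<Sum>b\<le>m. hsym n (m - b) x * x n ^ b)"

lemma fps_hsym:
  fixes x :: "nat \<Rightarrow> 'a::comm_ring_1"
  shows "Abs_fps (\<lambda>m. hsym n m x) = (\<Prod>i<n. Abs_fps (\<lambda>m. x i ^ m))"
proof (induction n)
  case 0
  show ?case by (rule fps_ext) simp
next
  case (Suc n)
  have "Abs_fps (\<lambda>m. hsym (Suc n) m x) = Abs_fps (\<lambda>m. hsym n m x) * Abs_fps (\<lambda>m. x n ^ m)"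
  proof (rule fps_ext)
    fix m
    have "fps_nth (Abs_fps (\<lambda>m. hsym n m x) * Abs_fps (\<lambda>m. x n ^ m)) m = (\<Sum>i=0..m. hsym n i x * x n ^ (m - i))"
      by (simp add: fps_mult_nth)
    also have "\<dots> = (\<Sum>b\<le>m. hsym n (m - b) x * x n ^ b)"
      by (rule sum.reindex_bij_witness[where i = "\<lambda>b. m - b" and j = "\<lambda>b. m - b"]) auto
    finally show "fps_nth (Abs_fps (\<lambda>m. hsym (Suc n) m x)) m = fps_nth (Abs_fps (\<lambda>m. hsym n m x) * Abs_fps (\<lambda>m. x n ^ m)) m"
      by simp
  qed
  then show ?case using Suc by simp
qed

lemma fps_geometric:
  fixes c :: "'a::comm_ring_1"
  shows "Abs_fps (\<lambda>m. c ^ m) * (1 - fps_const c * fps_X) = 1"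
proof (rule fps_ext)
  fix m
  let ?G = "Abs_fps (\<lambda>m. c ^ m)"
  have "?G * (1 - fps_const c * fps_X) = ?G - fps_const c * (fps_X * ?G)"
    by (simp add: algebra_simps)
  then show "fps_nth (?G * (1 - fps_const c * fps_X)) m = fps_nth (1 :: 'a fps) m"
    by (cases m) simp_all
qed

text \<open>Jacobi-Trudi determinants contain entries of negative index, where the complete
  homogeneous polynomial is 0 by convention.\<close>

definition hsymz :: "nat \<Rightarrow> int \<Rightarrow> (nat \<Rightarrow> 'a::comm_ring_1) \<Rightarrow> 'a" where
  "hsymz n k x = (if k < 0 then 0 else hsym n (nat k) x)"

text \<open>The generating series of the signed elementary symmetric polynomials in all variables
  but \<open>x i\<close>.\<close>

definition elem_del :: "nat \<Rightarrow> (nat \<Rightarrow> 'a::comm_ring_1) \<Rightarrow> nat \<Rightarrow> 'a fps" where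
  "elem_del n x i = (\<Prod>j\<in>{..<n} - {i}. 1 - fps_const (x j) * fps_X)"

lemma prod_linear_fps_nth_eq_0:
  fixes x :: "nat \<Rightarrow> 'a::comm_ring_1"
  assumes "finite I" "card I < r"
  shows "fps_nth (\<Prod>j\<in>I. 1 - fps_const (x j) * fps_X) r = 0"
  using assms
proof (induction I arbitrary: r rule: finite_induct)
  case (insert i I)
  let ?P = "\<Prod>j\<in>I. 1 - fps_const (x j) * fps_X"
  from insert.prems insert.hyps obtain r' where r: "r = Suc r'" "card I < r'" by (cases r) auto
  have "(\<Prod>j\<in>insert i I. 1 - fps_const (x j) * fps_X) = ?P - fps_const (x i) * (fps_X * ?P)"
    using insert.hyps by (simp add: algebra_simps)
  then have "fps_nth (\<Prod>j\<in>insert i I. 1 - fps_const (x j) * fps_X) r = fps_nth ?P r - x i * fps_nth ?P r'"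
    using r by simp
  then show ?case using insert.IH[of r] insert.IH[of r'] r by simp
qed simp

text \<open>The series of the complete homogeneous polynomials is the product of all 1/(1 - x_j z);
  multiplying it by \<open>elem_del\<close> leaves only 1/(1 - x_i z), whose coefficients are the
  powers of \<open>x i\<close>. Since \<open>elem_del\<close> has degree below \<open>n\<close>, a
  sum over \<open>r < n\<close> suffices.\<close>

lemma power_eq_sum_hsymz:
  fixes x :: "nat \<Rightarrow> 'a::comm_ring_1"
  assumes i: "i < n"
  shows "x i ^ m = (\<Sum>r<n. hsymz n (int m - int r) x * fps_nth (elem_del n x i) r)"
proof -
  let ?g = "\<lambda>j. Abs_fps (\<lambda>m. x j ^ m)"
  have "(\<Prod>j\<in>{..<n} - {i}. ?g j) * elem_del n x i = 1"
    unfolding elem_del_def prod.distrib[symmetric] by (simp only: fps_geometric prod.neutral_const)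
  moreover have "(\<Prod>j<n. ?g j) = ?g i * (\<Prod>j\<in>{..<n} - {i}. ?g j)"
    using i by (subst prod.remove[of _ i]) auto
  ultimately have "?g i = Abs_fps (\<lambda>m. hsym n m x) * elem_del n x i"
    by (simp add: fps_hsym mult.assoc)
  then have "x i ^ m = fps_nth (Abs_fps (\<lambda>m. hsym n m x) * elem_del n x i) m" by (metis fps_nth_Abs_fps)
  also have "\<dots> = (\<Sum>r=0..m. fps_nth (elem_del n x i) r * hsym n (m - r) x)"
    by (subst mult.commute) (simp add: fps_mult_nth)
  also have "\<dots> = (\<Sum>r\<in>{0..m} \<union> {..<n}. hsymz n (int m - int r) x * fps_nth (elem_del n x i) r)"
    by (rule sum.mono_neutral_cong_left) (auto simp: hsymz_def nat_diff_distrib mult.commute)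
  also have "\<dots> = (\<Sum>r<n. hsymz n (int m - int r) x * fps_nth (elem_del n x i) r)"
  proof (rule sum.mono_neutral_right)
    show "\<forall>r\<in>({0..m} \<union> {..<n}) - {..<n}. hsymz n (int m - int r) x * fps_nth (elem_del n x i) r = 0"
    proof
      fix r assume "r \<in> ({0..m} \<union> {..<n}) - {..<n}"
      then have "fps_nth (elem_del n x i) r = 0"
        unfolding elem_del_def using i by (intro prod_linear_fps_nth_eq_0) auto
      then show "hsymz n (int m - int r) x * fps_nth (elem_del n x i) r = 0" by simp
    qed
  qed auto
  finally show ?thesis .
qed

lemma hsymz_self: "hsymz n 0 x = 1"
proof -
  have "hsym n 0 x = 1" by (induction n) auto
  then show ?thesis by (simp add: hsymz_def)
qed

lemma sum_delta_reindex:
  "(\<Sum>r<n. f (delta n r)) = (\<Sum>r<n. (f r :: 'a::comm_monoid_add))"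
  by (rule sum.reindex_bij_witness[where i = "\<lambda>r. n - 1 - r" and j = "\<lambda>r. n - 1 - r"]) (auto simp: delta_def)

text \<open>The matrix of powers factors as \<open>H a * M\<close> with \<open>M\<close> independent
  of the exponents. At \<open>a = delta n\<close> the factor \<open>H a\<close> is unitriangular, so
  \<open>det M\<close> is identified as the Vandermonde determinant without being computed.\<close>

theorem jacobi_trudi_alternant:
  fixes x :: "nat \<Rightarrow> 'a::comm_ring_1"
  shows "alternant n a x = (\<Sum>p | p permutes {..<n}. of_int (sign p) *
      (\<Prod>i<n. hsymz n (int (a i) - int (delta n (p i))) x)) * alternant n (delta n) x"
proof -
  define H where "H a = mat n n (\<lambda>(i, r). hsymz n (int (a i) - int (delta n r)) x)" for a
  define M where "M = mat n n (\<lambda>(r, j). fps_nth (elem_del n x j) (delta n r))"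
  have HM: "alternant n a x = det (H a) * det M" for a
  proof -
    have "mat n n (\<lambda>(i, j). x j ^ a i) = H a * M"
    proof (rule eq_matI)
      fix i j assume "i < dim_row (H a * M)" "j < dim_col (H a * M)"
      then have ij: "i < n" "j < n" by (auto simp: H_def M_def)
      have "(H a * M) $$ (i, j) = (\<Sum>r<n. hsymz n (int (a i) - int (delta n r)) x * fps_nth (elem_del n x j) (delta n r))"
        using ij by (simp add: H_def M_def scalar_prod_def atLeast0LessThan)
      also have "\<dots> = x j ^ a i"
        by (subst sum_delta_reindex[where f = "\<lambda>r. hsymz n (int (a i) - int r) x * fps_nth (elem_del n x j) r"])
          (simp add: power_eq_sum_hsymz[OF ij(2), of x "a i"])
      finally show "mat n n (\<lambda>(i, j). x j ^ a i) $$ (i, j) = (H a * M) $$ (i, j)" using ij by simp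
    qed (auto simp: H_def M_def)
    then show ?thesis
      unfolding alternant_def using det_mult[of "H a" n M] by (simp add: H_def M_def)
  qed
  have "diag_mat (H (delta n)) = replicate n 1"
    by (intro nth_equalityI) (auto simp: diag_mat_def H_def hsymz_self)
  then have "prod_list (diag_mat (H (delta n))) = 1" by simp
  moreover have "upper_triangular (H (delta n))"
    by (auto simp: upper_triangular_def H_def hsymz_def delta_def)
  ultimately have "det (H (delta n)) = 1"
    using det_upper_triangular[of "H (delta n)" n] by (simp add: H_def)
  then have "alternant n a x = det (H a) * alternant n (delta n) x" using HM[of a] HM[of "delta n"] by simp
  moreover have "det (H a) = (\<Sum>p | p permutes {..<n}. of_int (sign p) *
      (\<Prod>i<n. hsymz n (int (a i) - int (delta n (p i))) x))"
  proof -
    have "det (H a) = (\<Sum>p | p permutes {0..<n}. of_int (sign p) * (\<Prod>i=0..<n. H a $$ (i, p i)))"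
      by (subst det_def'[of _ n]) (auto simp: H_def)
    also have "\<dots> = (\<Sum>p | p permutes {..<n}. of_int (sign p) *
      (\<Prod>i<n. hsymz n (int (a i) - int (delta n (p i))) x))"
      unfolding atLeast0LessThan
    proof (rule sum.cong[OF refl])
      fix p assume "p \<in> {p. p permutes {..<n}}"
      then have "p i < n" if "i < n" for i using permutes_in_image[of p "{..<n}" i] that by auto
      then show "of_int (sign p) * (\<Prod>i<n. H a $$ (i, p i)) = of_int (sign p) *
        (\<Prod>i<n. hsymz n (int (a i) - int (delta n (p i))) x)"
        by (intro arg_cong2[of _ _ _ _ "(*)"] prod.cong) (auto simp: H_def)
    qed
    finally show ?thesis .
  qed
  ultimately show ?thesis by simp
qed

section \<open>Trace functions of matrices and the polarized functional\<close>

text \<open>The trace of the tensor product of the matrices \<open>N k\<close> composed with the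
  permutation \<open>g\<close> of the tensor factors. It is a product of traces of matrix products
  along the cycles of \<open>g\<close>.\<close>

definition cycle_trace :: "nat \<Rightarrow> 'k set \<Rightarrow> ('k \<Rightarrow> 'k) \<Rightarrow> ('k \<Rightarrow> nat \<Rightarrow> nat \<Rightarrow> 'a::comm_ring_1) \<Rightarrow> 'a" where
  "cycle_trace n K g N = (\<Sum>j\<in>K \<rightarrow>\<^sub>E {..<n}. \<Prod>k\<in>K. N k (j k) (j (g k)))"

lemma prod_of_bool: "finite K \<Longrightarrow> (\<Prod>k\<in>K. of_bool (P k)) = (of_bool (\<forall>k\<in>K. P k) :: 'a::comm_semiring_1)"
  by (induction K rule: finite_induct) auto

text \<open>Permuting tensor factors commutes with applying one matrix to all of them. Concretely,
  the \<open>Q\<close> at position \<open>k\<close> and the \<open>P\<close> at position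
  \<open>g k\<close> share the letter \<open>j (g k)\<close>, and summing over this letter contracts
  them to the identity.\<close>

lemma cycle_trace_conj:
  fixes N N' :: "'k \<Rightarrow> nat \<Rightarrow> nat \<Rightarrow> 'a::comm_ring_1"
  assumes K: "finite K" and g: "g permutes K"
    and N: "\<And>k i l. k \<in> K \<Longrightarrow> i < n \<Longrightarrow> l < n \<Longrightarrow> N k i l = (\<Sum>p<n. \<Sum>q<n. P i p * N' k p q * Q q l)"
    and QP: "\<And>p q. p < n \<Longrightarrow> q < n \<Longrightarrow> (\<Sum>i<n. Q q i * P i p) = of_bool (q = p)"
  shows "cycle_trace n K g N = cycle_trace n K g N'"
proof -
  let ?W = "K \<rightarrow>\<^sub>E {..<n}"
  have gK: "g k \<in> K" if "k \<in> K" for k using permutes_in_image[OF g] that by simp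
  have "cycle_trace n K g N = (\<Sum>j\<in>?W. \<Prod>k\<in>K. \<Sum>p<n. \<Sum>q<n. P (j k) p * N' k p q * Q q (j (g k)))"
    unfolding cycle_trace_def
  proof (intro sum.cong prod.cong refl)
    fix j k assume j: "j \<in> ?W" and k: "k \<in> K"
    have "j k < n" "j (g k) < n" using PiE_mem[OF j k] PiE_mem[OF j gK[OF k]] by auto
    then show "N k (j k) (j (g k)) = (\<Sum>p<n. \<Sum>q<n. P (j k) p * N' k p q * Q q (j (g k)))"
      by (rule N[OF k])
  qed
  also have "\<dots> = (\<Sum>j\<in>?W. \<Sum>u\<in>?W. \<Sum>v\<in>?W. \<Prod>k\<in>K. P (j k) (u k) * N' k (u k) (v k) * Q (v k) (j (g k)))"
    using K by (simp add: prod_sum_PiE)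
  also have "\<dots> = (\<Sum>u\<in>?W. \<Sum>j\<in>?W. \<Sum>v\<in>?W. \<Prod>k\<in>K. P (j k) (u k) * N' k (u k) (v k) * Q (v k) (j (g k)))"
    by (rule sum.swap)
  also have "\<dots> = (\<Sum>u\<in>?W. \<Sum>v\<in>?W. \<Sum>j\<in>?W. \<Prod>k\<in>K. P (j k) (u k) * N' k (u k) (v k) * Q (v k) (j (g k)))"
    by (rule sum.cong[OF refl], rule sum.swap)
  also have "\<dots> = (\<Sum>u\<in>?W. \<Prod>k\<in>K. N' k (u k) (u (g k)))"
  proof (rule sum.cong[OF refl])
    fix u assume u: "u \<in> ?W"
    let ?ug = "\<lambda>k\<in>K. u (g k)"
    have "(\<Sum>j\<in>?W. \<Prod>k\<in>K. P (j k) (u k) * N' k (u k) (v k) * Q (v k) (j (g k)))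
      = (if v = ?ug then \<Prod>k\<in>K. N' k (u k) (v k) else 0)" if v: "v \<in> ?W" for v
    proof -
      let ?h = "inv_into UNIV g"
      have h: "?h permutes K" by (rule permutes_inv[OF g])
      have hK: "?h k \<in> K" if "k \<in> K" for k using permutes_in_image[OF h] that by simp
      have "(\<Sum>j\<in>?W. \<Prod>k\<in>K. P (j k) (u k) * N' k (u k) (v k) * Q (v k) (j (g k)))
        = (\<Sum>j\<in>?W. (\<Prod>k\<in>K. N' k (u k) (v k)) * (\<Prod>k\<in>K. Q (v (?h k)) (j k) * P (j k) (u k)))"
      proof (rule sum.cong[OF refl])
        fix j
        have "(\<Prod>k\<in>K. Q (v k) (j (g k))) = (\<Prod>k\<in>K. Q (v (?h k)) (j k))"
          using prod.permute[OF g, of "\<lambda>k. Q (v (?h k)) (j k)"] permutes_inverses(2)[OF g] by (simp add: o_def)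
        then show "(\<Prod>k\<in>K. P (j k) (u k) * N' k (u k) (v k) * Q (v k) (j (g k)))
          = (\<Prod>k\<in>K. N' k (u k) (v k)) * (\<Prod>k\<in>K. Q (v (?h k)) (j k) * P (j k) (u k))"
          by (simp add: prod.distrib mult_ac)
      qed
      also have "\<dots> = (\<Prod>k\<in>K. N' k (u k) (v k)) * (\<Prod>k\<in>K. \<Sum>i<n. Q (v (?h k)) i * P i (u k))"
        using K by (simp add: prod_sum_PiE sum_distrib_left)
      also have "(\<Prod>k\<in>K. \<Sum>i<n. Q (v (?h k)) i * P i (u k)) = (\<Prod>k\<in>K. of_bool (v (?h k) = u k))"
        using PiE_mem[OF u] PiE_mem[OF v] hK by (intro prod.cong refl QP) auto
      also have "\<dots> = of_bool (\<forall>k\<in>K. v (?h k) = u k)" by (rule prod_of_bool[OF K])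
      also have "(\<forall>k\<in>K. v (?h k) = u k) \<longleftrightarrow> v = ?ug"
      proof
        assume a: "\<forall>k\<in>K. v (?h k) = u k"
        show "v = ?ug"
        proof (rule PiE_ext[OF v])
          show "?ug \<in> ?W" using PiE_mem[OF u] gK by auto
          show "v k = ?ug k" if "k \<in> K" for k
            using a gK[OF that] that permutes_inverses(2)[OF g] by fastforce
        qed
      next
        assume "v = ?ug"
        then show "\<forall>k\<in>K. v (?h k) = u k" using hK permutes_inverses(1)[OF g] by simp
      qed
      finally show ?thesis by simp
    qed
    then have "(\<Sum>v\<in>?W. \<Sum>j\<in>?W. \<Prod>k\<in>K. P (j k) (u k) * N' k (u k) (v k) * Q (v k) (j (g k)))
      = (\<Sum>v\<in>?W. if v = ?ug then \<Prod>k\<in>K. N' k (u k) (v k) else 0)"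
      by (rule sum.cong[OF refl])
    also have "\<dots> = (\<Prod>k\<in>K. N' k (u k) (?ug k))"
    proof -
      have "?ug \<in> ?W" using PiE_mem[OF u] gK by auto
      then show ?thesis using K by (simp add: finite_PiE sum.delta)
    qed
    finally show "(\<Sum>v\<in>?W. \<Sum>j\<in>?W. \<Prod>k\<in>K. P (j k) (u k) * N' k (u k) (v k) * Q (v k) (j (g k)))
      = (\<Prod>k\<in>K. N' k (u k) (u (g k)))" by simp
  qed
  finally show ?thesis by (simp add: cycle_trace_def)
qed

definition fixwords :: "nat \<Rightarrow> 'k set \<Rightarrow> ('k \<Rightarrow> 'k) \<Rightarrow> ('k \<Rightarrow> nat) set" where
  "fixwords n K g = {j \<in> K \<rightarrow>\<^sub>E {..<n}. \<forall>k\<in>K. j (g k) = j k}"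

text \<open>A word that weakly increases along every cycle of a permutation is constant on the cycles.\<close>

lemma cycle_trace_triangular:
  fixes N :: "'k \<Rightarrow> nat \<Rightarrow> nat \<Rightarrow> 'a::comm_ring_1"
  assumes K: "finite K" and g: "g permutes K"
    and N: "\<And>k i l. k \<in> K \<Longrightarrow> i < n \<Longrightarrow> l < i \<Longrightarrow> N k i l = 0"
  shows "cycle_trace n K g N = (\<Sum>j\<in>fixwords n K g. \<Prod>k\<in>K. N k (j k) (j k))"
  unfolding cycle_trace_def
proof (rule sum.mono_neutral_cong_right)
  show "finite (K \<rightarrow>\<^sub>E {..<n})" using K by (simp add: finite_PiE)
  show "fixwords n K g \<subseteq> K \<rightarrow>\<^sub>E {..<n}" by (auto simp: fixwords_def)
  show "\<forall>j\<in>(K \<rightarrow>\<^sub>E {..<n}) - fixwords n K g. (\<Prod>k\<in>K. N k (j k) (j (g k))) = 0"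
  proof
    fix j assume j: "j \<in> (K \<rightarrow>\<^sub>E {..<n}) - fixwords n K g"
    have "\<exists>k\<in>K. j (g k) < j k"
    proof (rule ccontr)
      assume "\<not> (\<exists>k\<in>K. j (g k) < j k)"
      then have le: "j k \<le> j (g k)" if "k \<in> K" for k using that by force
      have "(\<Sum>k\<in>K. j k) = (\<Sum>k\<in>K. j (g k))"
        using sum.permute[OF g, of j] by (simp add: o_def)
      then have "j k = j (g k)" if "k \<in> K" for k
        using sum_mono_inv[of j K "\<lambda>k. j (g k)" k] le that K by blast
      then have "j \<in> fixwords n K g" using j by (auto simp: fixwords_def)
      then show False using j by simp
    qed
    then obtain k where k: "k \<in> K" "j (g k) < j k" by blast
    have "j k < n" using j k by (auto simp: PiE_def Pi_def)
    then have "N k (j k) (j (g k)) = 0" using N[OF k(1)] k(2) by blast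
    then show "(\<Prod>k\<in>K. N k (j k) (j (g k))) = 0" using K k(1) by (meson prod_zero)
  qed
  show "(\<Prod>k\<in>K. N k (j k) (j (g k))) = (\<Prod>k\<in>K. N k (j k) (j k))" if "j \<in> fixwords n K g" for j
    using that by (intro prod.cong) (auto simp: fixwords_def)
qed

text \<open>Both products of \<open>P\<close> and \<open>Q\<close> are recorded as the identity: Q P
  = 1 contracts neighbouring factors in \<open>cycle_trace_conj\<close>, and P Q = 1 exhibits the
  identity at unmarked positions as a conjugate of itself.\<close>

definition triangularized :: "nat \<Rightarrow> (nat \<Rightarrow> nat \<Rightarrow> complex) \<Rightarrow> (nat \<Rightarrow> complex) \<Rightarrow> bool" where
  "triangularized n M x \<longleftrightarrow> (\<exists>P Q T.
     (\<forall>i<n. \<forall>l<n. M i l = (\<Sum>p<n. \<Sum>q<n. P i p * T p q * Q q l)) \<and>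
     (\<forall>p<n. \<forall>q<n. (\<Sum>i<n. Q q i * P i p) = of_bool (q = p)) \<and>
     (\<forall>p<n. \<forall>q<n. (\<Sum>i<n. P p i * Q i q) = of_bool (p = q)) \<and>
     (\<forall>p<n. \<forall>q<p. T p q = 0) \<and> (\<forall>p<n. x p = T p p))"

lemma triangularized_exists: "\<exists>x. triangularized n M x"
proof -
  define A where "A = mat n n (\<lambda>(i, j). M i j)"
  have A: "A \<in> carrier_mat n n" by (simp add: A_def)
  obtain es where es: "char_poly A = (\<Prod>a\<leftarrow>es. [:- a, 1:])"
    using char_poly_factorized[OF A] by blast
  obtain B P Q where BPQ: "schur_decomposition A es = (B, P, Q)"
    by (cases "schur_decomposition A es")
  have wit: "similar_mat_wit A B P Q" and up: "upper_triangular B"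
    using schur_decomposition[OF A es BPQ] by auto
  note w = similar_mat_witD[OF _ wit, of n, simplified carrier_matD[OF A], OF refl]
  have c: "B \<in> carrier_mat n n" "P \<in> carrier_mat n n" "Q \<in> carrier_mat n n"
    and pq: "P * Q = 1\<^sub>m n" "Q * P = 1\<^sub>m n" and APBQ: "A = P * B * Q"
    using w by auto
  have entry: "(R * S) $$ (i, l) = (\<Sum>q<n. R $$ (i, q) * S $$ (q, l))"
    if "R \<in> carrier_mat n n" "S \<in> carrier_mat n n" "i < n" "l < n" for R S :: "complex mat" and i l
    using that by (simp add: scalar_prod_def atLeast0LessThan)
  have "triangularized n M (\<lambda>i. B $$ (i, i))"
    unfolding triangularized_def
  proof (intro exI conjI allI impI)
    fix i l assume il: "i < n" "l < n"
    have "M i l = A $$ (i, l)" using il by (simp add: A_def)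
    also have "\<dots> = (P * B * Q) $$ (i, l)" by (simp only: APBQ)
    also have "(P * B * Q) $$ (i, l) = (\<Sum>q<n. (\<Sum>p<n. P $$ (i, p) * B $$ (p, q)) * Q $$ (q, l))"
    proof -
      have PB: "P * B \<in> carrier_mat n n" using c by (rule_tac mult_carrier_mat) auto
      have "(P * B) $$ (i, q) = (\<Sum>p<n. P $$ (i, p) * B $$ (p, q))" if "q < n" for q
        by (rule entry[OF c(2,1) il(1) that])
      then show ?thesis unfolding entry[OF PB c(3) il] by (intro sum.cong refl) simp
    qed
    also have "\<dots> = (\<Sum>p<n. \<Sum>q<n. P $$ (i, p) * B $$ (p, q) * Q $$ (q, l))"
      by (subst sum.swap) (simp add: sum_distrib_right)
    finally show "M i l = (\<Sum>p<n. \<Sum>q<n. P $$ (i, p) * B $$ (p, q) * Q $$ (q, l))" .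
  next
    fix p q assume pq': "p < n" "q < n"
    show "(\<Sum>i<n. Q $$ (q, i) * P $$ (i, p)) = of_bool (q = p)"
      unfolding entry[OF c(3,2) pq'(2,1), symmetric] pq(2) using pq' by simp
    show "(\<Sum>i<n. P $$ (p, i) * Q $$ (i, q)) = of_bool (p = q)"
      unfolding entry[OF c(2,3) pq', symmetric] pq(1) using pq' by simp
  next
    fix p q assume "p < n" "q < p"
    then show "B $$ (p, q) = 0" using up c by (auto simp: upper_triangular_def)
  qed simp
  then show ?thesis by blast
qed

text \<open>The eigenvalues with multiplicity, in the order of some arbitrary triangularization;
  \<open>marked_trace_eigs\<close> holds for whichever one is chosen.\<close>

definition eigs :: "nat \<Rightarrow> (nat \<Rightarrow> nat \<Rightarrow> complex) \<Rightarrow> nat \<Rightarrow> complex" where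
  "eigs n M = (SOME x. triangularized n M x)"

text \<open>Positions in \<open>K - A\<close> carry the identity matrix. They take part in the
  permutation, hence in signs and in the conditions on words, but add no degree in
  \<open>M\<close>.\<close>

definition marked_trace :: "nat \<Rightarrow> 'k set \<Rightarrow> 'k set \<Rightarrow> ('k \<Rightarrow> 'k) \<Rightarrow> (nat \<Rightarrow> nat \<Rightarrow> complex) \<Rightarrow> complex" where
  "marked_trace n K A g M = cycle_trace n K g (\<lambda>k i l. if k \<in> A then M i l else of_bool (i = l))"

text \<open>After triangularization only the words constant on the cycles of \<open>g\<close>
  survive, and for them the diagonal entries are eigenvalues. A sum over eigenvalues, awkward to
  differentiate, thus becomes a polynomial in the entries of \<open>M\<close>.\<close>

lemma marked_trace_eigs:
  assumes K: "finite K" "A \<subseteq> K" and g: "g permutes K"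
  shows "marked_trace n K A g M = (\<Sum>j\<in>fixwords n K g. \<Prod>k\<in>A. eigs n M (j k))"
proof -
  have "triangularized n M (eigs n M)"
    unfolding eigs_def by (rule someI_ex[OF triangularized_exists])
  then obtain P Q T where *: "(\<forall>i<n. \<forall>l<n. M i l = (\<Sum>p<n. \<Sum>q<n. P i p * T p q * Q q l)) \<and>
     (\<forall>p<n. \<forall>q<n. (\<Sum>i<n. Q q i * P i p) = of_bool (q = p)) \<and>
     (\<forall>p<n. \<forall>q<n. (\<Sum>i<n. P p i * Q i q) = of_bool (p = q)) \<and>
     (\<forall>p<n. \<forall>q<p. T p q = 0) \<and> (\<forall>p<n. eigs n M p = T p p)"
    unfolding triangularized_def by (elim exE)
  have M: "\<And>i l. i < n \<Longrightarrow> l < n \<Longrightarrow> M i l = (\<Sum>p<n. \<Sum>q<n. P i p * T p q * Q q l)"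
    and QP: "\<And>p q. p < n \<Longrightarrow> q < n \<Longrightarrow> (\<Sum>i<n. Q q i * P i p) = of_bool (q = p)"
    and PQ: "\<And>p q. p < n \<Longrightarrow> q < n \<Longrightarrow> (\<Sum>i<n. P p i * Q i q) = of_bool (p = q)"
    and T: "\<And>p q. p < n \<Longrightarrow> q < p \<Longrightarrow> T p q = 0"
    and x: "\<And>p. p < n \<Longrightarrow> eigs n M p = T p p"
    using * by (simp_all only: simp_thms)
  let ?N' = "\<lambda>k i l. if k \<in> A then T i l else of_bool (i = l)"
  have "marked_trace n K A g M = cycle_trace n K g ?N'"
    unfolding marked_trace_def
  proof (rule cycle_trace_conj[OF K(1) g _ QP])
    fix k i l assume il: "i < n" "l < n"
    have "(\<Sum>p<n. \<Sum>q<n. P i p * of_bool (p = q) * Q q l) = (\<Sum>p<n. P i p * Q p l)"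
    proof (rule sum.cong[OF refl])
      fix p assume "p \<in> {..<n}"
      have "(\<Sum>q<n. P i p * of_bool (p = q) * Q q l) = (\<Sum>q<n. if q = p then P i p * Q q l else 0)"
        by (rule sum.cong) auto
      then show "(\<Sum>q<n. P i p * of_bool (p = q) * Q q l) = P i p * Q p l" using \<open>p \<in> {..<n}\<close> by simp
    qed
    then show "(if k \<in> A then M i l else of_bool (i = l)) = (\<Sum>p<n. \<Sum>q<n. P i p * ?N' k p q * Q q l)"
      using M[OF il] PQ[OF il] by simp
  qed
  also have "\<dots> = (\<Sum>j\<in>fixwords n K g. \<Prod>k\<in>K. ?N' k (j k) (j k))"
    by (rule cycle_trace_triangular[OF K(1) g]) (use T in auto)
  also have "\<dots> = (\<Sum>j\<in>fixwords n K g. \<Prod>k\<in>A. eigs n M (j k))"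
  proof (rule sum.cong[OF refl])
    fix j assume j: "j \<in> fixwords n K g"
    have "(\<Prod>k\<in>K. ?N' k (j k) (j k)) = (\<Prod>k\<in>A. ?N' k (j k) (j k))"
      using K by (intro prod.mono_neutral_right) auto
    also have "\<dots> = (\<Prod>k\<in>A. eigs n M (j k))"
      using j K(2) by (intro prod.cong) (auto simp: fixwords_def x PiE_def Pi_def subset_iff)
    finally show "(\<Prod>k\<in>K. ?N' k (j k) (j k)) = (\<Prod>k\<in>A. eigs n M (j k))" .
  qed
  finally show ?thesis .
qed

section \<open>Polarization at matrix units\<close>

lemma sum_signed_supersets:
  assumes "finite D" "B \<subseteq> D"
  shows "(\<Sum>T\<in>Pow D. (- 1) ^ (card D - card T) * of_bool (B \<subseteq> T)) = (of_bool (B = D) :: 'a::comm_ring_1)"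
proof (cases "B = D")
  case True
  have "(\<Sum>T\<in>Pow D. (- 1) ^ (card D - card T) * of_bool (B \<subseteq> T)) = (\<Sum>T\<in>Pow D. if T = D then 1 else (0::'a))"
    using True by (intro sum.cong) auto
  then show ?thesis using True assms by (simp add: sum.delta)
next
  case False
  then obtain d where d: "d \<in> D" "d \<notin> B" using assms by auto
  define D' where "D' = D - {d}"
  have D: "D = insert d D'" "d \<notin> D'" "finite D'" using d assms by (auto simp: D'_def)
  let ?F = "\<lambda>T. (- 1) ^ (card D - card T) * of_bool (B \<subseteq> T) :: 'a"
  have "(\<Sum>T\<in>Pow D. ?F T) = (\<Sum>T\<in>Pow D'. ?F T) + (\<Sum>T\<in>insert d ` Pow D'. ?F T)"
    unfolding D(1) Pow_insert using D by (intro sum.union_disjoint) auto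
  also have "(\<Sum>T\<in>insert d ` Pow D'. ?F T) = (\<Sum>T\<in>Pow D'. ?F (insert d T))"
    using D(2) by (subst sum.reindex) (auto simp: inj_on_def)
  also have "\<dots> = (\<Sum>T\<in>Pow D'. - ?F T)"
  proof (rule sum.cong[OF refl])
    fix T assume "T \<in> Pow D'"
    then have T: "T \<subseteq> D'" "finite T" "d \<notin> T" using D finite_subset by auto
    have "card T \<le> card D'" using T D by (simp add: card_mono)
    then have "card D - card T = Suc (card D - card (insert d T))" using D T by simp
    moreover have "B \<subseteq> insert d T \<longleftrightarrow> B \<subseteq> T" using d by auto
    ultimately show "?F (insert d T) = - ?F T" by simp
  qed
  finally show ?thesis using False by (simp add: sum_negf)
qed

definition surjs :: "'k set \<Rightarrow> 'd set \<Rightarrow> ('k \<Rightarrow> 'd) set" where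
  "surjs A D = {b \<in> A \<rightarrow>\<^sub>E D. b ` A = D}"

text \<open>Inclusion and exclusion over the sets \<open>T\<close> keeps exactly the maps
  \<open>b\<close> that use every element of \<open>D\<close>. If \<open>A\<close> and
  \<open>D\<close> have the same size these are the bijections, so the multilinear part of a product
  of linear forms is extracted.\<close>

lemma polarization:
  fixes \<phi> :: "'k \<Rightarrow> 'd \<Rightarrow> 'a::comm_ring_1"
  assumes A: "finite A" and D: "finite D"
  shows "(\<Sum>T\<in>Pow D. (- 1) ^ (card D - card T) * (\<Prod>k\<in>A. \<Sum>u\<in>T. \<phi> k u))
    = (\<Sum>b\<in>surjs A D. \<Prod>k\<in>A. \<phi> k (b k))"
proof -
  have fin: "finite (A \<rightarrow>\<^sub>E D)" using A D by (simp add: finite_PiE)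
  have "(\<Sum>T\<in>Pow D. (- 1) ^ (card D - card T) * (\<Prod>k\<in>A. \<Sum>u\<in>T. \<phi> k u))
    = (\<Sum>T\<in>Pow D. \<Sum>b\<in>A \<rightarrow>\<^sub>E D. ((- 1) ^ (card D - card T) * of_bool (b ` A \<subseteq> T)) * (\<Prod>k\<in>A. \<phi> k (b k)))"
  proof (rule sum.cong[OF refl])
    fix T assume "T \<in> Pow D"
    then have T: "T \<subseteq> D" "finite T" using D finite_subset by auto
    have "(\<Prod>k\<in>A. \<Sum>u\<in>T. \<phi> k u) = (\<Sum>b\<in>A \<rightarrow>\<^sub>E T. \<Prod>k\<in>A. \<phi> k (b k))"
      using A T by (subst prod_sum_PiE) auto
    also have "\<dots> = (\<Sum>b\<in>A \<rightarrow>\<^sub>E D. of_bool (b ` A \<subseteq> T) * (\<Prod>k\<in>A. \<phi> k (b k)))"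
      using T by (intro sum.mono_neutral_cong_left fin) (auto simp: PiE_def Pi_def)
    finally show "(- 1) ^ (card D - card T) * (\<Prod>k\<in>A. \<Sum>u\<in>T. \<phi> k u)
      = (\<Sum>b\<in>A \<rightarrow>\<^sub>E D. ((- 1) ^ (card D - card T) * of_bool (b ` A \<subseteq> T)) * (\<Prod>k\<in>A. \<phi> k (b k)))"
      by (simp add: sum_distrib_left mult.assoc)
  qed
  also have "\<dots> = (\<Sum>b\<in>A \<rightarrow>\<^sub>E D. (\<Sum>T\<in>Pow D. (- 1) ^ (card D - card T) * of_bool (b ` A \<subseteq> T)) * (\<Prod>k\<in>A. \<phi> k (b k)))"
    by (subst sum.swap) (simp add: sum_distrib_right)
  also have "\<dots> = (\<Sum>b\<in>A \<rightarrow>\<^sub>E D. of_bool (b ` A = D) * (\<Prod>k\<in>A. \<phi> k (b k)))"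
    by (intro sum.cong refl, subst sum_signed_supersets[OF D]) auto
  also have "\<dots> = (\<Sum>b\<in>surjs A D. \<Prod>k\<in>A. \<phi> k (b k))"
    by (intro sum.mono_neutral_cong_right fin) (auto simp: surjs_def)
  finally show ?thesis .
qed

text \<open>A Young subgroup. With \<open>fst\<close> or \<open>snd\<close> as labels it is the row
  or column group of a diagram; with the row paired with the letter of a word it is the stabilizer
  of that word in the row group.\<close>

definition labperms :: "('k \<Rightarrow> 'l) \<Rightarrow> 'k set \<Rightarrow> ('k \<Rightarrow> 'k) set" where
  "labperms lab K = {g. g permutes K \<and> (\<forall>k\<in>K. lab (g k) = lab k)}"

abbreviation colperms :: "(nat \<times> nat) set \<Rightarrow> (nat \<times> nat \<Rightarrow> nat \<times> nat) set" where
  "colperms \<equiv> labperms snd"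

text \<open>The alternating sum over \<open>T\<close> polarizes the homogeneous function \<open>f \<circ> eigs n\<close> of degree
  \<open>card D\<close> at the matrix units indexed by the cells. Summing over the column group with signs amounts
  to applying, for every column of length \<open>r\<close>, the leading principal \<open>r\<close>-minor of the matrix of
  partial derivatives; equivalently, to pairing with a highest weight vector of weight \<open>t\<close> when \<open>D\<close>
  is the diagram of \<open>t\<close>.\<close>

definition hw_functional :: "nat \<Rightarrow> (nat \<times> nat) set \<Rightarrow> ((nat \<Rightarrow> complex) \<Rightarrow> complex) \<Rightarrow> complex" where
  "hw_functional n D f = (\<Sum>c\<in>colperms D. \<Sum>T\<in>Pow D. of_int (sign c) * ((- 1) ^ (card D - card T) *
     f (eigs n (\<lambda>r s. \<Sum>u\<in>T. of_bool (r = fst u \<and> s = fst (c u))))))"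

text \<open>These are the words with nonzero contribution when position \<open>k\<close> in
  \<open>A\<close> carries the matrix unit with row index \<open>fst (b k)\<close> and column index
  \<open>fst (c (b k))\<close>, and all other positions carry the identity.\<close>

definition matchings :: "nat \<Rightarrow> 'k set \<Rightarrow> 'k set \<Rightarrow> ('k \<Rightarrow> 'k) \<Rightarrow> (nat \<times> nat \<Rightarrow> nat \<times> nat) \<Rightarrow> ('k \<Rightarrow> nat \<times> nat) \<Rightarrow> ('k \<Rightarrow> nat) set" where
  "matchings n K A g c b = {j \<in> K \<rightarrow>\<^sub>E {..<n}. \<forall>k\<in>K.
     if k \<in> A then j k = fst (b k) \<and> j (g k) = fst (c (b k)) else j (g k) = j k}"

text \<open>Polarization is applied to each word \<open>j\<close> separately; the product of
  indicators that is left over says that \<open>j\<close> is a matching.\<close>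

lemma signed_marked_trace:
  assumes K: "finite K" "A \<subseteq> K" and D: "finite D"
  shows "(\<Sum>T\<in>Pow D. (- 1) ^ (card D - card T) * marked_trace n K A g (\<lambda>r s. \<Sum>u\<in>T. of_bool (r = fst u \<and> s = fst (c u))))
    = (\<Sum>b\<in>surjs A D. of_nat (card (matchings n K A g c b)))"
proof -
  let ?W = "K \<rightarrow>\<^sub>E {..<n}"
  have A: "finite A" using K finite_subset by blast
  have W: "finite ?W" using K by (simp add: finite_PiE)
  let ?R = "\<lambda>j. \<Prod>k\<in>K - A. of_bool (j k = j (g k)) :: complex"
  let ?\<phi> = "\<lambda>j k u. of_bool (j k = fst u \<and> j (g k) = fst (c u)) :: complex"
  have "marked_trace n K A g (\<lambda>r s. \<Sum>u\<in>T. of_bool (r = fst u \<and> s = fst (c u)))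
    = (\<Sum>j\<in>?W. (\<Prod>k\<in>A. \<Sum>u\<in>T. ?\<phi> j k u) * ?R j)" for T
    unfolding marked_trace_def cycle_trace_def
  proof (rule sum.cong[OF refl])
    fix j
    show "(\<Prod>k\<in>K. if k \<in> A then \<Sum>u\<in>T. ?\<phi> j k u else of_bool (j k = j (g k)))
      = (\<Prod>k\<in>A. \<Sum>u\<in>T. ?\<phi> j k u) * ?R j"
      using K by (subst prod.subset_diff[OF K(2) K(1)]) (auto simp: mult.commute intro!: arg_cong2[of _ _ _ _ "(*)"] prod.cong)
  qed
  then have "(\<Sum>T\<in>Pow D. (- 1) ^ (card D - card T) * marked_trace n K A g (\<lambda>r s. \<Sum>u\<in>T. of_bool (r = fst u \<and> s = fst (c u))))
    = (\<Sum>T\<in>Pow D. \<Sum>j\<in>?W. (- 1) ^ (card D - card T) * (\<Prod>k\<in>A. \<Sum>u\<in>T. ?\<phi> j k u) * ?R j)"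
    by (simp add: sum_distrib_left mult.assoc)
  also have "\<dots> = (\<Sum>j\<in>?W. \<Sum>T\<in>Pow D. (- 1) ^ (card D - card T) * (\<Prod>k\<in>A. \<Sum>u\<in>T. ?\<phi> j k u) * ?R j)"
    by (rule sum.swap)
  also have "\<dots> = (\<Sum>j\<in>?W. (\<Sum>b\<in>surjs A D. \<Prod>k\<in>A. ?\<phi> j k (b k)) * ?R j)"
    by (simp only: sum_distrib_right[symmetric] polarization[OF A D])
  also have "\<dots> = (\<Sum>b\<in>surjs A D. \<Sum>j\<in>?W. (\<Prod>k\<in>A. ?\<phi> j k (b k)) * ?R j)"
    by (simp only: sum_distrib_right) (rule sum.swap)
  also have "\<dots> = (\<Sum>b\<in>surjs A D. of_nat (card (matchings n K A g c b)))"
  proof (rule sum.cong[OF refl])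
    fix b
    have "(\<Sum>j\<in>?W. (\<Prod>k\<in>A. ?\<phi> j k (b k)) * ?R j) = (\<Sum>j\<in>?W. of_bool (j \<in> matchings n K A g c b))"
    proof (rule sum.cong[OF refl])
      fix j assume "j \<in> ?W"
      then have "j \<in> matchings n K A g c b \<longleftrightarrow> (\<forall>k\<in>A. j k = fst (b k) \<and> j (g k) = fst (c (b k))) \<and> (\<forall>k\<in>K - A. j k = j (g k))"
        using K(2) by (auto simp: matchings_def)
      moreover have "(\<Prod>k\<in>A. ?\<phi> j k (b k)) * ?R j = of_bool ((\<forall>k\<in>A. j k = fst (b k) \<and> j (g k) = fst (c (b k)))) * of_bool (\<forall>k\<in>K - A. j k = j (g k))"
        using A K by (simp only: prod_of_bool finite_Diff)
      ultimately show "(\<Prod>k\<in>A. ?\<phi> j k (b k)) * ?R j = of_bool (j \<in> matchings n K A g c b)" by simp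
    qed
    also have "\<dots> = of_nat (card (?W \<inter> {j. j \<in> matchings n K A g c b}))"
      using W by (simp add: sum.If_cases of_bool_def)
    also have "?W \<inter> {j. j \<in> matchings n K A g c b} = matchings n K A g c b" by (auto simp: matchings_def)
    finally show "(\<Sum>j\<in>?W. (\<Prod>k\<in>A. ?\<phi> j k (b k)) * ?R j) = of_nat (card (matchings n K A g c b))" .
  qed
  finally show ?thesis .
qed

definition hw_form :: "nat \<Rightarrow> (nat \<times> nat) set \<Rightarrow> 'k set \<Rightarrow> 'k set \<Rightarrow> 'g set \<Rightarrow> ('g \<Rightarrow> 'k \<Rightarrow> 'k) \<Rightarrow> ('g \<Rightarrow> int) \<Rightarrow> int" where
  "hw_form n D K A G \<gamma> \<chi> = (\<Sum>c\<in>colperms D. \<Sum>g\<in>G. \<Sum>b\<in>surjs A D.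
     sign c * \<chi> g * int (card (matchings n K A (\<gamma> g) c b)))"

definition signed_word_poly :: "nat \<Rightarrow> 'k set \<Rightarrow> 'k set \<Rightarrow> 'g set \<Rightarrow> ('g \<Rightarrow> 'k \<Rightarrow> 'k) \<Rightarrow> ('g \<Rightarrow> int) \<Rightarrow> (nat \<Rightarrow> 'a::comm_ring_1) \<Rightarrow> 'a" where
  "signed_word_poly n K A G \<gamma> \<chi> x = (\<Sum>g\<in>G. of_int (\<chi> g) * (\<Sum>j\<in>fixwords n K (\<gamma> g). \<Prod>k\<in>A. x (j k)))"

theorem hw_functional_signed_word_poly:
  assumes K: "finite K" "A \<subseteq> K" and D: "finite D" and g: "\<And>g. g \<in> G \<Longrightarrow> \<gamma> g permutes K"
  shows "hw_functional n D (signed_word_poly n K A G \<gamma> \<chi>) = of_int (hw_form n D K A G \<gamma> \<chi>)"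
proof -
  let ?M = "\<lambda>c T r s. \<Sum>u\<in>T. of_bool (r = fst u \<and> s = fst (c u))"
  have f: "signed_word_poly n K A G \<gamma> \<chi> (eigs n M) = (\<Sum>g\<in>G. of_int (\<chi> g) * marked_trace n K A (\<gamma> g) M)" for M
    unfolding signed_word_poly_def using g by (intro sum.cong refl) (simp add: marked_trace_eigs[OF K])
  have "hw_functional n D (signed_word_poly n K A G \<gamma> \<chi>) = (\<Sum>c\<in>colperms D. \<Sum>T\<in>Pow D. \<Sum>g\<in>G. of_int (sign c * \<chi> g) *
      ((- 1) ^ (card D - card T) * marked_trace n K A (\<gamma> g) (?M c T)))"
    unfolding hw_functional_def f by (simp add: sum_distrib_left mult_ac)
  also have "\<dots> = (\<Sum>c\<in>colperms D. \<Sum>g\<in>G. of_int (sign c * \<chi> g) *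
      (\<Sum>T\<in>Pow D. (- 1) ^ (card D - card T) * marked_trace n K A (\<gamma> g) (?M c T)))"
    by (simp only: sum_distrib_left sum.swap[of _ "Pow D" G])
  also have "\<dots> = of_int (hw_form n D K A G \<gamma> \<chi>)"
    unfolding hw_form_def signed_marked_trace[OF K D] by (simp add: sum_distrib_left)
  finally show ?thesis .
qed

section \<open>Positivity and vanishing of the pairing\<close>

definition signed_action :: "'k set \<Rightarrow> 'g set \<Rightarrow> ('g \<Rightarrow> 'k \<Rightarrow> 'k) \<Rightarrow> ('g \<Rightarrow> int) \<Rightarrow> bool" where
  "signed_action K G \<gamma> \<chi> \<longleftrightarrow> finite G \<and> G \<noteq> {} \<and> (\<forall>g\<in>G. \<gamma> g permutes K \<and> \<chi> g * \<chi> g = 1) \<and>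
     (\<forall>h\<in>G. \<exists>\<pi>. inj_on \<pi> G \<and> \<pi> ` G \<subseteq> G \<and> (\<forall>g\<in>G. \<gamma> (\<pi> g) = \<gamma> g \<circ> \<gamma> h \<and> \<chi> (\<pi> g) = \<chi> g * \<chi> h))"

lemma signed_action_reindex:
  fixes F :: "('k \<Rightarrow> 'k) \<Rightarrow> int \<Rightarrow> 'b::comm_monoid_add"
  assumes S: "signed_action K G \<gamma> \<chi>" and h: "h \<in> G"
  shows "(\<Sum>g\<in>G. F (\<gamma> g) (\<chi> g)) = (\<Sum>g\<in>G. F (\<gamma> g \<circ> \<gamma> h) (\<chi> g * \<chi> h))"
proof -
  obtain \<pi> where p: "inj_on \<pi> G" "\<pi> ` G \<subseteq> G"
    and eq: "\<And>g. g \<in> G \<Longrightarrow> \<gamma> (\<pi> g) = \<gamma> g \<circ> \<gamma> h \<and> \<chi> (\<pi> g) = \<chi> g * \<chi> h"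
    using S h unfolding signed_action_def by meson
  have "finite G" using S by (simp add: signed_action_def)
  then have im: "\<pi> ` G = G" using p endo_inj_surj by blast
  have "(\<Sum>g\<in>G. F (\<gamma> g) (\<chi> g)) = (\<Sum>g\<in>\<pi> ` G. F (\<gamma> g) (\<chi> g))" by (simp only: im)
  also have "\<dots> = (\<Sum>g\<in>G. F (\<gamma> (\<pi> g)) (\<chi> (\<pi> g)))" by (simp add: sum.reindex[OF p(1)])
  also have "\<dots> = (\<Sum>g\<in>G. F (\<gamma> g \<circ> \<gamma> h) (\<chi> g * \<chi> h))"
    by (rule sum.cong[OF refl]) (simp only: eq)
  finally show ?thesis .
qed

lemma sign_mult_self: "sign p * sign p = 1"
  by (simp add: sign_def)

lemma finite_labperms: "finite K \<Longrightarrow> finite (labperms lab K)"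
  by (rule finite_subset[OF _ finite_permutations[of K]]) (auto simp: labperms_def)

lemma labperms_permutes: "g \<in> labperms lab K \<Longrightarrow> g permutes K"
  by (simp add: labperms_def)

lemma id_labperms: "id \<in> labperms lab K"
  by (simp add: labperms_def permutes_id)

lemma labperms_nonempty: "labperms lab K \<noteq> {}"
  using id_labperms by blast

lemma compose_labperms: "g \<in> labperms lab K \<Longrightarrow> h \<in> labperms lab K \<Longrightarrow> g \<circ> h \<in> labperms lab K"
  unfolding labperms_def by (auto intro: permutes_compose simp: permutes_in_image)

lemma inv_labperms:
  assumes "g \<in> labperms lab K"
  shows "inv_into UNIV g \<in> labperms lab K"
proof -
  have g: "g permutes K" and l: "\<And>k. k \<in> K \<Longrightarrow> lab (g k) = lab k" using assms by (auto simp: labperms_def)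
  have "lab (inv_into UNIV g k) = lab k" if k: "k \<in> K" for k
  proof -
    have "inv_into UNIV g k \<in> K" using permutes_in_image[OF permutes_inv[OF g]] k by simp
    then show ?thesis using l[of "inv_into UNIV g k"] permutes_inverses(1)[OF g] by simp
  qed
  then show ?thesis using permutes_inv[OF g] by (simp add: labperms_def)
qed

lemma sign_compose_permutes:
  assumes "finite K" "g permutes K" "h permutes K"
  shows "sign (g \<circ> h) = sign g * sign h"
proof -
  have "permutation g" "permutation h" using assms by (auto simp: permutation_permutes)
  then show ?thesis by (rule sign_compose)
qed

lemma inj_compose_right:
  assumes "surj h"
  shows "inj_on (\<lambda>g. g \<circ> h) S"
proof (rule inj_onI)
  fix g g' assume "g \<circ> h = g' \<circ> h"
  then show "g = g'" using assms by (metis comp_apply ext surjD)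
qed

lemma signed_action_labperms:
  assumes K: "finite K"
  shows "signed_action K (labperms lab K) (\<lambda>g. g) sign" "signed_action K (labperms lab K) (\<lambda>g. g) (\<lambda>_. 1)"
proof -
  have 1: "inj_on (\<lambda>g. g \<circ> h) (labperms lab K)" "(\<lambda>g. g \<circ> h) ` labperms lab K \<subseteq> labperms lab K"
    "g \<in> labperms lab K \<Longrightarrow> sign (g \<circ> h) = sign g * sign h"
    if h: "h \<in> labperms lab K" for g h
    using inj_compose_right[OF permutes_surj[OF labperms_permutes[OF h]]] compose_labperms[OF _ h]
      sign_compose_permutes[OF K labperms_permutes labperms_permutes[OF h]] by blast+
  show "signed_action K (labperms lab K) (\<lambda>g. g) sign"
    unfolding signed_action_def
  proof (intro conjI ballI)
    fix h assume "h \<in> labperms lab K"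
    note 1[OF this]
    then show "\<exists>\<pi>. inj_on \<pi> (labperms lab K) \<and> \<pi> ` labperms lab K \<subseteq> labperms lab K \<and>
        (\<forall>g\<in>labperms lab K. \<pi> g = g \<circ> h \<and> sign (\<pi> g) = sign g * sign h)"
      by (intro exI[of _ "\<lambda>g. g \<circ> h"]) simp
  qed (use K finite_labperms labperms_nonempty sign_mult_self in \<open>auto dest: labperms_permutes\<close>)
  show "signed_action K (labperms lab K) (\<lambda>g. g) (\<lambda>_. 1)"
    unfolding signed_action_def
  proof (intro conjI ballI)
    fix h assume "h \<in> labperms lab K"
    note 1[OF this]
    then show "\<exists>\<pi>. inj_on \<pi> (labperms lab K) \<and> \<pi> ` labperms lab K \<subseteq> labperms lab K \<and>
        (\<forall>g\<in>labperms lab K. \<pi> g = g \<circ> h \<and> (1::int) = 1 * 1)"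
      by (intro exI[of _ "\<lambda>g. g \<circ> h"]) simp
  qed (use K finite_labperms labperms_nonempty in \<open>auto dest: labperms_permutes\<close>)
qed

definition fill :: "'k set \<Rightarrow> ('k \<Rightarrow> nat \<times> nat) \<Rightarrow> ('k \<Rightarrow> nat) \<Rightarrow> 'k \<Rightarrow> nat" where
  "fill A b u k = (if k \<in> A then fst (b k) else u k)"

text \<open>On \<open>A\<close> a matching is forced to be the row of the cell \<open>b k\<close>,
  so only its values \<open>u\<close> at the unmarked positions are free. What remains is one
  equation between two words: that of \<open>b\<close>, moved by \<open>g\<close>, equals that of
  \<open>c \<circ> b\<close>.\<close>

lemma card_matchings:
  assumes K: "finite K" "A \<subseteq> K" and g: "g permutes K" and D: "D \<subseteq> {..<n} \<times> UNIV" and b: "b \<in> surjs A D"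
  shows "card (matchings n K A g c b) =
    (\<Sum>u\<in>(K - A) \<rightarrow>\<^sub>E {..<n}. of_bool (\<forall>k\<in>K. fill A b u (g k) = fill A (\<lambda>k\<in>A. c (b k)) u k))"
proof -
  let ?U = "(K - A) \<rightarrow>\<^sub>E {..<n}"
  let ?P = "\<lambda>u. \<forall>k\<in>K. fill A b u (g k) = fill A (\<lambda>k\<in>A. c (b k)) u k"
  have gK: "g k \<in> K" if "k \<in> K" for k using permutes_in_image[OF g] that by simp
  have bn: "fst (b k) < n" if "k \<in> A" for k
    using b D that by (auto simp: surjs_def)
  have fillj: "fill A b (restrict j (K - A)) k = j k" if "j \<in> matchings n K A g c b" "k \<in> K" for j k
    using that by (auto simp: matchings_def fill_def)
  have "bij_betw (\<lambda>j. restrict j (K - A)) (matchings n K A g c b) {u \<in> ?U. ?P u}"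
  proof (rule bij_betwI[where g = "\<lambda>u. restrict (fill A b u) K"])
    show "(\<lambda>j. restrict j (K - A)) \<in> matchings n K A g c b \<rightarrow> {u \<in> ?U. ?P u}"
    proof
      fix j assume j: "j \<in> matchings n K A g c b"
      have "?P (restrict j (K - A))"
      proof
        fix k assume k: "k \<in> K"
        show "fill A b (restrict j (K - A)) (g k) = fill A (\<lambda>k\<in>A. c (b k)) (restrict j (K - A)) k"
          unfolding fillj[OF j gK[OF k]] using j k by (auto simp: matchings_def fill_def)
      qed
      moreover have "restrict j (K - A) \<in> ?U" using j by (auto simp: matchings_def)
      ultimately show "restrict j (K - A) \<in> {u \<in> ?U. ?P u}" by simp
    qed
    show "(\<lambda>u. restrict (fill A b u) K) \<in> {u \<in> ?U. ?P u} \<rightarrow> matchings n K A g c b"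
    proof
      fix u assume u: "u \<in> {u \<in> ?U. ?P u}"
      have "restrict (fill A b u) K \<in> K \<rightarrow>\<^sub>E {..<n}" using u bn by (auto simp: fill_def PiE_def Pi_def)
      moreover have "if k \<in> A then restrict (fill A b u) K k = fst (b k) \<and> restrict (fill A b u) K (g k) = fst (c (b k))
          else restrict (fill A b u) K (g k) = restrict (fill A b u) K k" if k: "k \<in> K" for k
      proof -
        have "fill A b u (g k) = fill A (\<lambda>k\<in>A. c (b k)) u k" using u k by simp
        then show ?thesis using k gK[OF k] by (auto simp: fill_def)
      qed
      ultimately show "restrict (fill A b u) K \<in> matchings n K A g c b"
        unfolding matchings_def by (intro CollectI conjI ballI)
    qed
    show "restrict (fill A b (restrict j (K - A))) K = j" if j: "j \<in> matchings n K A g c b" for j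
    proof (rule PiE_ext)
      show "restrict (fill A b (restrict j (K - A))) K \<in> K \<rightarrow>\<^sub>E j ` K" using fillj[OF j] by auto
      show "j \<in> K \<rightarrow>\<^sub>E j ` K" using j by (auto simp: matchings_def PiE_def)
    qed (use fillj[OF j] in auto)
    show "restrict (restrict (fill A b u) K) (K - A) = u" if "u \<in> {u \<in> ?U. ?P u}" for u
      using that by (auto simp: fill_def fun_eq_iff PiE_def extensional_def)
  qed
  then have "card (matchings n K A g c b) = card {u \<in> ?U. ?P u}" by (rule bij_betw_same_card)
  also have "{u \<in> ?U. ?P u} = ?U \<inter> {u. ?P u}" by auto
  also have "card \<dots> = (\<Sum>u\<in>?U. of_bool (?P u))" using K by (simp add: sum.If_cases of_bool_def finite_PiE)
  finally show ?thesis .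
qed

text \<open>The coefficient at the word \<open>w\<close> of the antisymmetrization, with respect to
  \<open>\<chi>\<close>, of the basis tensor with letters \<open>fill A b u\<close>.\<close>

definition antisym_sum :: "'k set \<Rightarrow> 'k set \<Rightarrow> 'g set \<Rightarrow> ('g \<Rightarrow> 'k \<Rightarrow> 'k) \<Rightarrow> ('g \<Rightarrow> int) \<Rightarrow> ('k \<Rightarrow> nat) \<Rightarrow> ('k \<Rightarrow> nat) \<Rightarrow> ('k \<Rightarrow> nat \<times> nat) \<Rightarrow> int" where
  "antisym_sum K A G \<gamma> \<chi> u w b = (\<Sum>g\<in>G. \<chi> g * of_bool (\<forall>k\<in>K. fill A b u (\<gamma> g k) = w k))"

text \<open>The antisymmetrizer e satisfies <e v, e v'> = |G| <e v, v'>: translating the first group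
  element by the second turns the double sum into \<open>card G\<close> copies of a single
  one.\<close>

lemma antisym_sum_product:
  assumes K: "finite K" and S: "signed_action K G \<gamma> \<chi>"
    and bn: "\<And>k. k \<in> K \<Longrightarrow> fill A b u k < n" and bn': "\<And>k. k \<in> K \<Longrightarrow> fill A b' u k < n"
  shows "(\<Sum>w\<in>K \<rightarrow>\<^sub>E {..<n}. antisym_sum K A G \<gamma> \<chi> u w b * antisym_sum K A G \<gamma> \<chi> u w b')
    = int (card G) * (\<Sum>g\<in>G. \<chi> g * of_bool (\<forall>k\<in>K. fill A b u (\<gamma> g k) = fill A b' u k))"
proof -
  let ?W = "K \<rightarrow>\<^sub>E {..<n}"
  let ?m = "\<lambda>b g w. of_bool (\<forall>k\<in>K. fill A b u (\<gamma> g k) = w k) :: int"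
  have per: "\<gamma> g permutes K" and sq: "\<chi> g * \<chi> g = 1" if "g \<in> G" for g
    using S that by (auto simp: signed_action_def)
  have gK: "\<gamma> g k \<in> K" if "g \<in> G" "k \<in> K" for g k using permutes_in_image[OF per] that by simp
  have W: "finite ?W" using K by (simp add: finite_PiE)
  have wsum: "(\<Sum>w\<in>?W. ?m b g w * ?m b' h w) = of_bool (\<forall>k\<in>K. fill A b u (\<gamma> g k) = fill A b' u (\<gamma> h k))"
    if gh: "g \<in> G" "h \<in> G" for g h
  proof -
    let ?w = "\<lambda>k\<in>K. fill A b u (\<gamma> g k)"
    have w: "?w \<in> ?W" using bn gK[OF gh(1)] by auto
    have "(\<Sum>w\<in>?W. ?m b g w * ?m b' h w) = (\<Sum>w\<in>?W. if w = ?w then ?m b' h ?w else 0)"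
    proof (rule sum.cong[OF refl])
      fix w assume w': "w \<in> ?W"
      have "(\<forall>k\<in>K. fill A b u (\<gamma> g k) = w k) \<longleftrightarrow> w = ?w"
        using PiE_ext[OF w' w] by auto
      then show "?m b g w * ?m b' h w = (if w = ?w then ?m b' h ?w else 0)" by auto
    qed
    also have "\<dots> = ?m b' h ?w" using W w by (simp add: sum.delta)
    also have "\<dots> = of_bool (\<forall>k\<in>K. fill A b u (\<gamma> g k) = fill A b' u (\<gamma> h k))"
      by (intro arg_cong[of _ _ of_bool] ball_cong) auto
    finally show ?thesis .
  qed
  have inner: "(\<Sum>g\<in>G. \<chi> g * \<chi> h * of_bool (\<forall>k\<in>K. fill A b u (\<gamma> g k) = fill A b' u (\<gamma> h k)))
    = (\<Sum>g\<in>G. \<chi> g * of_bool (\<forall>k\<in>K. fill A b u (\<gamma> g k) = fill A b' u k))" if h: "h \<in> G" for h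
  proof -
    have "(\<Sum>g\<in>G. \<chi> g * \<chi> h * of_bool (\<forall>k\<in>K. fill A b u (\<gamma> g k) = fill A b' u (\<gamma> h k)))
      = (\<Sum>g\<in>G. \<chi> g * \<chi> h * \<chi> h * of_bool (\<forall>k\<in>K. fill A b u ((\<gamma> g \<circ> \<gamma> h) k) = fill A b' u (\<gamma> h k)))"
      by (rule signed_action_reindex[OF S h, where F = "\<lambda>p s. s * \<chi> h * of_bool (\<forall>k\<in>K. fill A b u (p k) = fill A b' u (\<gamma> h k))"])
    also have "\<dots> = (\<Sum>g\<in>G. \<chi> g * of_bool (\<forall>k\<in>K. fill A b u (\<gamma> g k) = fill A b' u k))"
    proof (rule sum.cong[OF refl])
      fix g
      have "(\<forall>k\<in>K. fill A b u ((\<gamma> g \<circ> \<gamma> h) k) = fill A b' u (\<gamma> h k)) \<longleftrightarrow> (\<forall>k\<in>\<gamma> h ` K. fill A b u (\<gamma> g k) = fill A b' u k)"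
        by auto
      also have "\<gamma> h ` K = K" by (rule permutes_image[OF per[OF h]])
      finally show "\<chi> g * \<chi> h * \<chi> h * of_bool (\<forall>k\<in>K. fill A b u ((\<gamma> g \<circ> \<gamma> h) k) = fill A b' u (\<gamma> h k))
        = \<chi> g * of_bool (\<forall>k\<in>K. fill A b u (\<gamma> g k) = fill A b' u k)"
        using sq[OF h] by (simp add: mult.assoc)
    qed
    finally show ?thesis .
  qed
  have "(\<Sum>w\<in>?W. antisym_sum K A G \<gamma> \<chi> u w b * antisym_sum K A G \<gamma> \<chi> u w b')
    = (\<Sum>w\<in>?W. \<Sum>h\<in>G. \<Sum>g\<in>G. \<chi> g * \<chi> h * (?m b g w * ?m b' h w))"
    unfolding antisym_sum_def sum_product by (subst (2) sum.swap) (simp add: mult_ac)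
  also have "\<dots> = (\<Sum>h\<in>G. \<Sum>g\<in>G. \<Sum>w\<in>?W. \<chi> g * \<chi> h * (?m b g w * ?m b' h w))"
    by (subst sum.swap) (rule sum.cong[OF refl], rule sum.swap)
  also have "\<dots> = (\<Sum>h\<in>G. \<Sum>g\<in>G. \<chi> g * \<chi> h * of_bool (\<forall>k\<in>K. fill A b u (\<gamma> g k) = fill A b' u (\<gamma> h k)))"
    unfolding sum_distrib_left[symmetric] by (intro sum.cong refl) (simp only: wsum)
  also have "\<dots> = (\<Sum>h\<in>G. \<Sum>g\<in>G. \<chi> g * of_bool (\<forall>k\<in>K. fill A b u (\<gamma> g k) = fill A b' u k))"
    by (rule sum.cong[OF refl inner])
  finally show ?thesis by simp
qed

lemma cact_bij:
  assumes c: "c permutes D"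
  shows "bij_betw (\<lambda>b. \<lambda>k\<in>A. c (b k)) (surjs A D) (surjs A D)"
proof -
  have aux: "(\<lambda>k\<in>A. p (b k)) \<in> surjs A D" if p: "p permutes D" and b: "b \<in> surjs A D" for p b
  proof -
    have "(\<lambda>k\<in>A. p (b k)) ` A = p ` (b ` A)" by auto
    then have "(\<lambda>k\<in>A. p (b k)) ` A = D" using b permutes_image[OF p] by (simp add: surjs_def)
    then show ?thesis by (auto simp: surjs_def)
  qed
  have ext: "(\<lambda>k\<in>A. b k) = b" if "b \<in> surjs A D" for b
    using that by (auto simp: surjs_def PiE_def extensional_restrict)
  show ?thesis
  proof (rule bij_betwI[where g = "\<lambda>b. \<lambda>k\<in>A. inv_into UNIV c (b k)"])
    show "(\<lambda>k\<in>A. inv_into UNIV c ((\<lambda>k\<in>A. c (b k)) k)) = b" if "b \<in> surjs A D" for b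
      using ext[OF that] permutes_inverses(2)[OF c] by (simp cong: restrict_cong)
    show "(\<lambda>k\<in>A. c ((\<lambda>k\<in>A. inv_into UNIV c (b k)) k)) = b" if "b \<in> surjs A D" for b
      using ext[OF that] permutes_inverses(1)[OF c] by (simp cong: restrict_cong)
  qed (use aux c permutes_inv[OF c] in auto)
qed

text \<open>The same averaging in the column group, which acts on \<open>surjs A D\<close> by
  composition. In the expanded square, substituting \<open>d \<circ> c\<close> for \<open>d\<close>
  and absorbing \<open>c\<close> into \<open>b\<close> shows that all \<open>c\<close> contribute
  equally.\<close>

lemma column_average_square:
  fixes \<psi> :: "('k \<Rightarrow> nat \<times> nat) \<Rightarrow> int"
  assumes D: "finite D"
  shows "int (card (colperms D)) * (\<Sum>c\<in>colperms D. \<Sum>b\<in>surjs A D. sign c * (\<psi> b * \<psi> (\<lambda>k\<in>A. c (b k))))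
    = (\<Sum>b\<in>surjs A D. (\<Sum>c\<in>colperms D. sign c * \<psi> (\<lambda>k\<in>A. c (b k)))\<^sup>2)"
proof -
  let ?C = "colperms D" and ?B = "surjs A D"
  let ?a = "\<lambda>(c :: nat \<times> nat \<Rightarrow> nat \<times> nat) b. \<lambda>k\<in>A. c (b k)"
  note S = signed_action_labperms(1)[OF D, of snd]
  have "(\<Sum>b\<in>?B. (\<Sum>c\<in>?C. sign c * \<psi> (?a c b))\<^sup>2)
    = (\<Sum>b\<in>?B. \<Sum>c\<in>?C. \<Sum>d\<in>?C. sign c * sign d * (\<psi> (?a c b) * \<psi> (?a d b)))"
    by (simp add: power2_eq_square sum_product mult_ac)
  also have "\<dots> = (\<Sum>c\<in>?C. \<Sum>b\<in>?B. \<Sum>d\<in>?C. sign c * sign d * (\<psi> (?a c b) * \<psi> (?a d b)))"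
    by (rule sum.swap)
  also have "\<dots> = (\<Sum>c\<in>?C. \<Sum>b\<in>?B. \<Sum>d\<in>?C. sign d * (\<psi> b * \<psi> (?a d b)))"
  proof (rule sum.cong[OF refl])
    fix c assume c: "c \<in> ?C"
    have "(\<Sum>d\<in>?C. sign c * sign d * (\<psi> (?a c b) * \<psi> (?a d b)))
      = (\<Sum>d\<in>?C. sign d * (\<psi> (?a c b) * \<psi> (?a d (?a c b))))" for b
    proof -
      have "(\<Sum>d\<in>?C. sign c * sign d * (\<psi> (?a c b) * \<psi> (?a d b)))
        = (\<Sum>d\<in>?C. sign c * (sign d * sign c) * (\<psi> (?a c b) * \<psi> (?a (d \<circ> c) b)))"
        by (rule signed_action_reindex[OF S c, where F = "\<lambda>p s. sign c * s * (\<psi> (?a c b) * \<psi> (?a p b))"])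
      also have "\<dots> = (\<Sum>d\<in>?C. sign d * (\<psi> (?a c b) * \<psi> (?a d (?a c b))))"
      proof (rule sum.cong[OF refl])
        fix d
        have "?a (d \<circ> c) b = ?a d (?a c b)" by (auto simp: fun_eq_iff)
        moreover have "sign c * (sign d * sign c) = sign d" using sign_mult_self[of c] by (simp add: mult.commute)
        ultimately show "sign c * (sign d * sign c) * (\<psi> (?a c b) * \<psi> (?a (d \<circ> c) b))
          = sign d * (\<psi> (?a c b) * \<psi> (?a d (?a c b)))" by simp
      qed
      finally show ?thesis .
    qed
    then have "(\<Sum>b\<in>?B. \<Sum>d\<in>?C. sign c * sign d * (\<psi> (?a c b) * \<psi> (?a d b)))
      = (\<Sum>b\<in>?B. \<Sum>d\<in>?C. sign d * (\<psi> (?a c b) * \<psi> (?a d (?a c b))))" by simp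
    also have "\<dots> = (\<Sum>b\<in>?B. \<Sum>d\<in>?C. sign d * (\<psi> b * \<psi> (?a d b)))"
      by (rule sum.reindex_bij_betw[OF cact_bij[OF labperms_permutes[OF c]], where g = "\<lambda>b. \<Sum>d\<in>?C. sign d * (\<psi> b * \<psi> (?a d b))"])
    finally show "(\<Sum>b\<in>?B. \<Sum>d\<in>?C. sign c * sign d * (\<psi> (?a c b) * \<psi> (?a d b)))
      = (\<Sum>b\<in>?B. \<Sum>d\<in>?C. sign d * (\<psi> b * \<psi> (?a d b)))" .
  qed
  also have "\<dots> = int (card ?C) * (\<Sum>c\<in>?C. \<Sum>b\<in>?B. sign c * (\<psi> b * \<psi> (?a c b)))"
    by (subst (2) sum.swap) simp
  finally show ?thesis ..
qed

text \<open>By \<open>antisym_sum_product\<close> the signed count of matchings becomes a product of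
  two antisymmetrized coefficients, at \<open>b\<close> and at \<open>c \<circ> b\<close>, and
  averaging over \<open>c\<close> makes it a square. The unmarked letters \<open>u\<close> are
  common to both coefficients, so they only index further squares.\<close>

theorem hw_form_sum_of_squares:
  assumes K: "finite K" "A \<subseteq> K" and D: "finite D" "D \<subseteq> {..<n} \<times> UNIV" and S: "signed_action K G \<gamma> \<chi>"
  shows "int (card (colperms D)) * int (card G) * hw_form n D K A G \<gamma> \<chi>
    = (\<Sum>u\<in>(K - A) \<rightarrow>\<^sub>E {..<n}. \<Sum>w\<in>K \<rightarrow>\<^sub>E {..<n}. \<Sum>b\<in>surjs A D.
        (\<Sum>c\<in>colperms D. sign c * antisym_sum K A G \<gamma> \<chi> u w (\<lambda>k\<in>A. c (b k)))\<^sup>2)"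
proof -
  let ?U = "(K - A) \<rightarrow>\<^sub>E {..<n}" and ?W = "K \<rightarrow>\<^sub>E {..<n}" and ?C = "colperms D" and ?B = "surjs A D"
  let ?a = "\<lambda>(c :: nat \<times> nat \<Rightarrow> nat \<times> nat) b. \<lambda>k\<in>A. c (b k)"
  let ?\<psi> = "antisym_sum K A G \<gamma> \<chi>"
  let ?o = "\<lambda>u b b'. \<Sum>g\<in>G. \<chi> g * of_bool (\<forall>k\<in>K. fill A b u (\<gamma> g k) = fill A b' u k)"
  have per: "\<gamma> g permutes K" if "g \<in> G" for g using S that by (simp add: signed_action_def)
  have less: "fill A b u k < n" if "b \<in> ?B" "u \<in> ?U" "k \<in> K" for b u k
    using that D(2) by (auto simp: fill_def surjs_def PiE_def Pi_def)
  have "hw_form n D K A G \<gamma> \<chi> = (\<Sum>c\<in>?C. \<Sum>g\<in>G. \<Sum>b\<in>?B. \<Sum>u\<in>?U.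
      sign c * (\<chi> g * of_bool (\<forall>k\<in>K. fill A b u (\<gamma> g k) = fill A (?a c b) u k)))"
    unfolding hw_form_def
    by (intro sum.cong refl) (simp add: card_matchings[OF K per D(2)] sum_distrib_left mult.assoc)
  also have "\<dots> = (\<Sum>c\<in>?C. \<Sum>b\<in>?B. \<Sum>u\<in>?U. sign c * ?o u b (?a c b))"
    unfolding sum_distrib_left by (intro sum.cong[OF refl]) (simp only: sum.swap[of _ G])
  also have "\<dots> = (\<Sum>u\<in>?U. \<Sum>c\<in>?C. \<Sum>b\<in>?B. sign c * ?o u b (?a c b))"
    by (simp only: sum.swap[of _ _ ?U])
  finally have "int (card ?C) * int (card G) * hw_form n D K A G \<gamma> \<chi>
    = (\<Sum>u\<in>?U. int (card ?C) * (\<Sum>c\<in>?C. \<Sum>b\<in>?B. sign c * (int (card G) * ?o u b (?a c b))))"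
    by (simp only: sum_distrib_left mult_ac)
  also have "\<dots> = (\<Sum>u\<in>?U. int (card ?C) * (\<Sum>c\<in>?C. \<Sum>b\<in>?B. \<Sum>w\<in>?W. sign c * (?\<psi> u w b * ?\<psi> u w (?a c b))))"
  proof (intro sum.cong refl arg_cong2[of _ _ _ _ "(*)"])
    fix u c b assume u: "u \<in> ?U" and c: "c \<in> ?C" and b: "b \<in> ?B"
    have b': "?a c b \<in> ?B" by (rule bij_betwE[OF cact_bij[OF labperms_permutes[OF c]], rule_format, OF b])
    show "sign c * (int (card G) * ?o u b (?a c b)) = (\<Sum>w\<in>?W. sign c * (?\<psi> u w b * ?\<psi> u w (?a c b)))"
      unfolding sum_distrib_left[symmetric]
      by (subst antisym_sum_product[OF K(1) S less[OF b u] less[OF b' u]]) auto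
  qed
  also have "\<dots> = (\<Sum>u\<in>?U. \<Sum>w\<in>?W. int (card ?C) * (\<Sum>c\<in>?C. \<Sum>b\<in>?B. sign c * (?\<psi> u w b * ?\<psi> u w (?a c b))))"
    by (simp only: sum.swap[of _ _ ?W] sum_distrib_left)
  also have "\<dots> = (\<Sum>u\<in>?U. \<Sum>w\<in>?W. \<Sum>b\<in>?B. (\<Sum>c\<in>?C. sign c * ?\<psi> u w (?a c b))\<^sup>2)"
    by (simp only: column_average_square[OF D(1)])
  finally show ?thesis .
qed

lemma card_pos_signed_action: "signed_action K G \<gamma> \<chi> \<Longrightarrow> card G > 0"
  by (simp add: signed_action_def card_gt_0_iff)

corollary hw_form_nonneg:
  assumes K: "finite K" "A \<subseteq> K" and D: "finite D" "D \<subseteq> {..<n} \<times> UNIV" and S: "signed_action K G \<gamma> \<chi>"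
  shows "0 \<le> hw_form n D K A G \<gamma> \<chi>"
proof -
  have "0 \<le> int (card (colperms D)) * int (card G) * hw_form n D K A G \<gamma> \<chi>"
    unfolding hw_form_sum_of_squares[OF assms] by (intro sum_nonneg) simp
  moreover have "0 < int (card (colperms D)) * int (card G)"
    using card_pos_signed_action[OF S] card_pos_signed_action[OF signed_action_labperms(1)[OF D(1), of snd]] by simp
  ultimately show ?thesis by (simp add: zero_le_mult_iff)
qed

text \<open>The square at the identity map and the word of row indices is nonzero. A column
  permutation that also preserves rows is the identity, so for every \<open>c\<close> only its
  inverse contributes to the coefficient, with sign \<open>sign c\<close>, and the number squared is
  \<open>card (colperms D)\<close>.\<close>

lemma hw_form_self_pos:
  assumes D: "finite D" "D \<subseteq> {..<n} \<times> UNIV"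
  shows "0 < hw_form n D D D (colperms D) (\<lambda>g. g) sign"
proof -
  let ?C = "colperms D"
  note S = signed_action_labperms(1)[OF D(1), of snd]
  let ?\<psi> = "antisym_sum D D ?C (\<lambda>g. g) sign"
  let ?F = "\<lambda>u w b. (\<Sum>c\<in>?C. sign c * ?\<psi> u w (\<lambda>k\<in>D. c (b k)))\<^sup>2"
  \<comment> \<open>There are no unmarked positions, since \<open>D - D\<close> is empty; this is
    the only function on them.\<close>
  define u :: "nat \<times> nat \<Rightarrow> nat" where "u = (\<lambda>_. undefined)"
  define w where "w = restrict fst D"
  define b where "b = restrict id D"
  have "?\<psi> u w (\<lambda>k\<in>D. c (b k)) = sign c" if c: "c \<in> ?C" for c
  proof -
    have cp: "c permutes D" by (rule labperms_permutes[OF c])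
    let ?h = "inv_into UNIV c"
    have h: "?h \<in> ?C" by (rule inv_labperms[OF c])
    have "(\<forall>k\<in>D. fill D (\<lambda>k\<in>D. c (b k)) u (g k) = w k) \<longleftrightarrow> g = ?h" if g: "g \<in> ?C" for g
    proof -
      have gp: "g permutes D" by (rule labperms_permutes[OF g])
      have gD: "g k \<in> D" if "k \<in> D" for k using permutes_in_image[OF gp] that by simp
      have "(\<forall>k\<in>D. fill D (\<lambda>k\<in>D. c (b k)) u (g k) = w k) \<longleftrightarrow> (\<forall>k\<in>D. fst (c (g k)) = fst k)"
        using gD by (intro ball_cong) (auto simp: fill_def b_def w_def)
      also have "\<dots> \<longleftrightarrow> (\<forall>k\<in>D. c (g k) = k)"
        using compose_labperms[OF c g] by (auto simp: labperms_def prod_eq_iff)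
      also have "\<dots> \<longleftrightarrow> (\<forall>k. c (g k) = k)"
        using gp cp by (metis permutes_not_in)
      also have "\<dots> \<longleftrightarrow> g = ?h"
        using permutes_inverses[OF cp] by (metis ext)
      finally show ?thesis .
    qed
    then have "?\<psi> u w (\<lambda>k\<in>D. c (b k)) = (\<Sum>g\<in>?C. sign g * of_bool (g = ?h))"
      unfolding antisym_sum_def by (intro sum.cong refl) simp
    also have "\<dots> = (\<Sum>g\<in>?C. if g = ?h then sign ?h else 0)" by (rule sum.cong) auto
    also have "\<dots> = sign ?h" using h finite_labperms[OF D(1), of snd] by (simp add: sum.delta)
    also have "\<dots> = sign c" using sign_inverse[of c] cp D(1) permutation_permutes by blast
    finally show ?thesis .
  qed
  then have "(\<Sum>c\<in>?C. sign c * ?\<psi> u w (\<lambda>k\<in>D. c (b k))) = int (card ?C)"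
    by (simp add: sign_mult_self)
  then have pos: "0 < ?F u w b" using card_pos_signed_action[OF S] by simp
  have bB: "b \<in> surjs D D" by (auto simp: b_def surjs_def)
  have wW: "w \<in> D \<rightarrow>\<^sub>E {..<n}" using D(2) by (auto simp: w_def)
  have fB: "finite (surjs D D)"
    by (rule finite_subset[of _ "D \<rightarrow>\<^sub>E D"]) (use D in \<open>auto simp: surjs_def finite_PiE\<close>)
  have "?F u w b \<le> (\<Sum>b\<in>surjs D D. ?F u w b)" by (rule member_le_sum[OF bB _ fB]) simp
  also have "\<dots> \<le> (\<Sum>w\<in>D \<rightarrow>\<^sub>E {..<n}. \<Sum>b\<in>surjs D D. ?F u w b)"
    by (rule member_le_sum[OF wW]) (use D in \<open>auto intro!: sum_nonneg finite_PiE\<close>)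
  also have "\<dots> = (\<Sum>u\<in>(D - D) \<rightarrow>\<^sub>E {..<n}. \<Sum>w\<in>D \<rightarrow>\<^sub>E {..<n}. \<Sum>b\<in>surjs D D. ?F u w b)"
    by (simp add: u_def)
  also have "\<dots> = int (card ?C) * int (card ?C) * hw_form n D D D ?C (\<lambda>g. g) sign"
    by (rule hw_form_sum_of_squares[OF D(1) subset_refl D S, symmetric])
  finally have "0 < int (card ?C) * int (card ?C) * hw_form n D D D ?C (\<lambda>g. g) sign" using pos by linarith
  then show ?thesis by (simp add: zero_less_mult_iff)
qed

section \<open>Vanishing of the pairing for Young subgroups\<close>

lemma card_matchings_full:
  assumes K: "finite K" and g: "g permutes K" and D: "D \<subseteq> {..<n} \<times> UNIV" and b: "b \<in> surjs K D"
  shows "card (matchings n K K g c b) = of_bool (\<forall>k\<in>K. fst (b (g k)) = fst (c (b k)))"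
  using permutes_in_image[OF g]
  by (simp add: card_matchings[OF K subset_refl g D b] fill_def)

lemma transpose_labperms:
  assumes "k \<in> K" "k' \<in> K" "lab k = lab k'"
  shows "transpose k k' \<in> labperms lab K"
  using assms by (auto simp: labperms_def permutes_swap_id transpose_def)

text \<open>If \<open>b\<close> sends two positions with equal labels to the same row, composing
  \<open>g\<close> on the left with their transposition reverses its sign but keeps the matching
  condition, which sees only rows. Such a \<open>b\<close> contributes 0.\<close>

lemma hw_form_column_nonzero:
  assumes K: "finite K" and D: "finite D" "D \<subseteq> {..<n} \<times> UNIV"
    and nz: "hw_form n D K K (labperms lab K) (\<lambda>g. g) sign \<noteq> 0"
  shows "\<exists>b\<in>surjs K D. \<forall>k\<in>K. \<forall>k'\<in>K. k \<noteq> k' \<longrightarrow> lab k = lab k' \<longrightarrow> fst (b k) \<noteq> fst (b k')"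
proof (rule ccontr)
  assume neg: "\<not> ?thesis"
  let ?G = "labperms lab K"
  have z: "(\<Sum>g\<in>?G. sign c * sign g * int (card (matchings n K K g c b))) = 0"
    if c: "c \<in> colperms D" and b: "b \<in> surjs K D" for c b
  proof -
    obtain k k' where k: "k \<in> K" "k' \<in> K" "k \<noteq> k'" "lab k = lab k'" "fst (b k) = fst (b k')"
      using neg b by blast
    define t where "t = transpose k k'"
    have t: "t \<in> ?G" unfolding t_def by (rule transpose_labperms[OF k(1,2,4)])
    have st: "sign t = -1" using k(3) by (simp add: t_def sign_swap_id)
    have tt: "t \<circ> t = id" by (simp add: t_def)
    have bt: "fst (b (t x)) = fst (b x)" for x using k(5) by (simp add: t_def transpose_def)
    let ?f = "\<lambda>g. sign c * sign g * of_bool (\<forall>k\<in>K. fst (b (g k)) = fst (c (b k)))"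
    have "(\<Sum>g\<in>?G. ?f g) = (\<Sum>g\<in>?G. - ?f g)"
    proof (rule sum.reindex_bij_witness[where i = "\<lambda>g. t \<circ> g" and j = "\<lambda>g. t \<circ> g"])
      fix g assume g: "g \<in> ?G"
      show "t \<circ> (t \<circ> g) = g" "t \<circ> (t \<circ> g) = g" using tt by (auto simp: comp_assoc[symmetric])
      show "t \<circ> g \<in> ?G" "t \<circ> g \<in> ?G" using compose_labperms[OF t g] by auto
      have "sign (t \<circ> g) = - sign g"
        using sign_compose_permutes[OF K labperms_permutes[OF t] labperms_permutes[OF g]] st by simp
      then show "- ?f (t \<circ> g) = ?f g" by (simp add: bt)
    qed
    then have "(\<Sum>g\<in>?G. ?f g) = 0" by (simp add: sum_negf)
    moreover have "(\<Sum>g\<in>?G. sign c * sign g * int (card (matchings n K K g c b))) = (\<Sum>g\<in>?G. ?f g)"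
      by (intro sum.cong refl) (simp add: card_matchings_full[OF K labperms_permutes D(2) b])
    ultimately show ?thesis by simp
  qed
  have "hw_form n D K K ?G (\<lambda>g. g) sign = (\<Sum>c\<in>colperms D. \<Sum>b\<in>surjs K D. \<Sum>g\<in>?G. sign c * sign g * int (card (matchings n K K g c b)))"
    unfolding hw_form_def by (rule sum.cong[OF refl], rule sum.swap)
  also have "\<dots> = 0" using z by (intro sum.neutral) auto
  finally show False using nz by simp
qed

text \<open>If \<open>b\<close> sends two positions with equal labels to one column, exchanging the
  positions inside \<open>g\<close> and the cells inside \<open>c\<close> simultaneously keeps the
  matching condition and reverses \<open>sign c\<close>. Equality of the sizes of \<open>K\<close>
  and \<open>D\<close> makes \<open>b\<close> injective, so that the two cells are distinct and the
  exchange is odd.\<close>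

lemma hw_form_row_nonzero:
  assumes K: "finite K" and D: "finite D" "D \<subseteq> {..<n} \<times> UNIV" and card: "card K = card D"
    and nz: "hw_form n D K K (labperms lab K) (\<lambda>g. g) (\<lambda>_. 1) \<noteq> 0"
  shows "\<exists>b\<in>surjs K D. \<forall>k\<in>K. \<forall>k'\<in>K. k \<noteq> k' \<longrightarrow> lab k = lab k' \<longrightarrow> snd (b k) \<noteq> snd (b k')"
proof (rule ccontr)
  assume neg: "\<not> ?thesis"
  let ?G = "labperms lab K" and ?C = "colperms D"
  have z: "(\<Sum>c\<in>?C. \<Sum>g\<in>?G. sign c * 1 * int (card (matchings n K K g c b))) = 0" if b: "b \<in> surjs K D" for b
  proof -
    obtain k k' where k: "k \<in> K" "k' \<in> K" "k \<noteq> k'" "lab k = lab k'" "snd (b k) = snd (b k')"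
      using neg b by blast
    have bD: "b ` K = D" using b by (simp add: surjs_def)
    then have "inj_on b K" using K card by (simp add: eq_card_imp_inj_on)
    then have ne: "b k \<noteq> b k'" using k by (auto dest: inj_onD)
    have bin: "b k \<in> D" "b k' \<in> D" using bD k by auto
    define s where "s = transpose k k'"
    define t where "t = transpose (b k) (b k')"
    have s: "s \<in> ?G" unfolding s_def by (rule transpose_labperms[OF k(1,2,4)])
    have t: "t \<in> ?C" unfolding t_def by (rule transpose_labperms[OF bin k(5)])
    have st: "sign t = -1" using ne by (simp add: t_def sign_swap_id)
    have ss: "s \<circ> s = id" and tt: "t \<circ> t = id" by (auto simp: s_def t_def)
    have tb: "t (b x) = b (s x)" if "x \<in> K" for x
      using that k \<open>inj_on b K\<close> by (auto simp: s_def t_def transpose_def dest: inj_onD)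
    let ?f = "\<lambda>c g. sign c * of_bool (\<forall>k\<in>K. fst (b (g k)) = fst (c (b k))) :: int"
    have "(\<Sum>c\<in>?C. \<Sum>g\<in>?G. ?f c g) = (\<Sum>c\<in>?C. \<Sum>g\<in>?G. - ?f c g)"
    proof (rule sum.reindex_bij_witness[where i = "\<lambda>c. c \<circ> t" and j = "\<lambda>c. c \<circ> t"])
      fix c assume c: "c \<in> ?C"
      show "c \<circ> t \<circ> t = c" "c \<circ> t \<circ> t = c" using tt by (auto simp: comp_assoc)
      show "c \<circ> t \<in> ?C" "c \<circ> t \<in> ?C" using compose_labperms[OF c t] by auto
      have sc: "sign (c \<circ> t) = - sign c"
        using sign_compose_permutes[OF D(1) labperms_permutes[OF c] labperms_permutes[OF t]] st by simp
      show "(\<Sum>g\<in>?G. - ?f (c \<circ> t) g) = (\<Sum>g\<in>?G. ?f c g)"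
      proof (rule sum.reindex_bij_witness[where i = "\<lambda>g. g \<circ> s" and j = "\<lambda>g. g \<circ> s"])
        fix g assume g: "g \<in> ?G"
        show "g \<circ> s \<circ> s = g" "g \<circ> s \<circ> s = g" using ss by (auto simp: comp_assoc)
        show "g \<circ> s \<in> ?G" "g \<circ> s \<in> ?G" using compose_labperms[OF g s] by auto
        have "(\<forall>k\<in>K. fst (b (g k)) = fst ((c \<circ> t) (b k))) \<longleftrightarrow> (\<forall>k\<in>K. fst (b (g k)) = fst (c (b (s k))))"
          by (intro ball_cong) (simp_all add: tb)
        also have "\<dots> \<longleftrightarrow> (\<forall>k\<in>K. fst (b ((g \<circ> s) (s k))) = fst (c (b (s k))))"
        proof -
          have "(g \<circ> s) (s k) = g k" for k using fun_cong[OF ss, of k] by simp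
          then show ?thesis by simp
        qed
        also have "\<dots> \<longleftrightarrow> (\<forall>k\<in>s ` K. fst (b ((g \<circ> s) k)) = fst (c (b k)))" by auto
        also have "s ` K = K" by (rule permutes_image[OF labperms_permutes[OF s]])
        finally show "?f c (g \<circ> s) = - ?f (c \<circ> t) g" unfolding sc by simp
      qed
    qed
    then have "(\<Sum>c\<in>?C. \<Sum>g\<in>?G. ?f c g) = 0" by (simp add: sum_negf)
    moreover have "(\<Sum>c\<in>?C. \<Sum>g\<in>?G. sign c * 1 * int (card (matchings n K K g c b))) = (\<Sum>c\<in>?C. \<Sum>g\<in>?G. ?f c g)"
      by (intro sum.cong refl) (simp add: card_matchings_full[OF K labperms_permutes D(2) b])
    ultimately show ?thesis by simp
  qed
  have "hw_form n D K K ?G (\<lambda>g. g) (\<lambda>_. 1) = (\<Sum>b\<in>surjs K D. \<Sum>c\<in>?C. \<Sum>g\<in>?G. sign c * 1 * int (card (matchings n K K g c b)))"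
    unfolding hw_form_def by (simp only: sum.swap[of _ _ "surjs K D"])
  also have "\<dots> = 0" using z by (intro sum.neutral) auto
  finally show False using nz by simp
qed

section \<open>Row groups and complete homogeneous polynomials\<close>

text \<open>Splitting off the permutations of one label class at a time gives the order of a Young
  subgroup.\<close>

lemma bij_betw_labperms_split:
  fixes lab :: "'k \<Rightarrow> 'l"
  defines "F v K \<equiv> {k \<in> K. lab k = v}"
  shows "bij_betw (\<lambda>(p, q). p \<circ> q) ({p. p permutes F v K} \<times> labperms lab (K - F v K)) (labperms lab K)"
proof -
  let ?F = "F v K" and ?R = "K - F v K"
  have dis: "k \<in> ?F \<Longrightarrow> k \<notin> ?R" for k by auto
  show ?thesis
  proof (rule bij_betwI[where g = "\<lambda>g. (\<lambda>k. if k \<in> ?F then g k else k, \<lambda>k. if k \<in> ?R then g k else k)"])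
    show "(\<lambda>(p, q). p \<circ> q) \<in> {p. p permutes ?F} \<times> labperms lab ?R \<rightarrow> labperms lab K"
    proof clarify
      fix p q assume p: "p permutes ?F" and q: "q \<in> labperms lab ?R"
      have "p permutes K" by (rule permutes_subset[OF p]) (auto simp: F_def)
      moreover have "q permutes K" by (rule permutes_subset[OF labperms_permutes[OF q]]) auto
      ultimately have pq: "p \<circ> q permutes K" by (rule permutes_compose[rotated])
      have "lab ((p \<circ> q) k) = lab k" if k: "k \<in> K" for k
      proof (cases "k \<in> ?F")
        case True
        then have "q k = k" using permutes_not_in[OF labperms_permutes[OF q]] by auto
        then show ?thesis using True permutes_in_image[OF p, of k] by (auto simp: F_def)
      next
        case False
        then have kR: "k \<in> ?R" using k by simp
        then have "q k \<in> ?R" using permutes_in_image[OF labperms_permutes[OF q], of k] by simp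
        then have "p (q k) = q k" using permutes_not_in[OF p] by auto
        then show ?thesis using q kR by (simp add: labperms_def)
      qed
      then show "p \<circ> q \<in> labperms lab K" using pq by (simp add: labperms_def)
    qed
    show "(\<lambda>g. (\<lambda>k. if k \<in> ?F then g k else k, \<lambda>k. if k \<in> ?R then g k else k)) \<in>
        labperms lab K \<rightarrow> {p. p permutes ?F} \<times> labperms lab ?R"
    proof
      fix g assume g: "g \<in> labperms lab K"
      have gp: "g permutes K" by (rule labperms_permutes[OF g])
      have gK: "g k \<in> K \<longleftrightarrow> k \<in> K" for k by (rule permutes_in_image[OF gp])
      have gl: "lab (g k) = lab k" if "k \<in> K" for k using g that by (simp add: labperms_def)
      have restr: "(\<lambda>k. if k \<in> S then g k else k) permutes S" if S: "\<And>k. k \<in> K \<Longrightarrow> g k \<in> S \<longleftrightarrow> k \<in> S" "S \<subseteq> K" for S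
        unfolding permutes_def
      proof (intro conjI allI impI)
        fix y
        show "\<exists>!x. (if x \<in> S then g x else x) = y"
        proof (cases "y \<in> S")
          case True
          obtain x where x: "g x = y" using permutes_surj[OF gp] by (metis surjD)
          then have "x \<in> K" using gK True S(2) by auto
          then have xS: "x \<in> S" using S(1) x True by auto
          show ?thesis
          proof (rule ex1I[of _ x])
            fix z assume z: "(if z \<in> S then g z else z) = y"
            then have "z \<in> S" using True by (auto split: if_splits)
            then show "z = x" using z x permutes_inj[OF gp] by (auto dest: injD)
          qed (use x xS in simp)
        next
          case False
          show ?thesis
          proof (rule ex1I[of _ y])
            fix z assume z: "(if z \<in> S then g z else z) = y"
            show "z = y"
            proof (cases "z \<in> S")
              case True
              then have "g z \<in> S" using S by auto
              then show ?thesis using z True False by simp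
            qed (use z in simp)
          qed (use False in simp)
        qed
      qed simp
      have "(\<lambda>k. if k \<in> ?F then g k else k) permutes ?F"
        by (rule restr) (auto simp: F_def gK gl)
      moreover have "(\<lambda>k. if k \<in> ?R then g k else k) permutes ?R"
        by (rule restr) (auto simp: F_def gK gl)
      ultimately show "(\<lambda>k. if k \<in> ?F then g k else k, \<lambda>k. if k \<in> ?R then g k else k)
        \<in> {p. p permutes ?F} \<times> labperms lab ?R"
        using gl by (auto simp: labperms_def)
    qed
    fix pq assume "pq \<in> {p. p permutes ?F} \<times> labperms lab ?R"
    then obtain p q where pq: "pq = (p, q)" and p: "p permutes ?F" and q: "q permutes ?R"
      by (auto simp: labperms_def)
    have "(\<lambda>k. if k \<in> ?F then (p \<circ> q) k else k) = p"
      using permutes_not_in[OF q] permutes_not_in[OF p] by (auto simp: fun_eq_iff)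
    moreover have "(\<lambda>k. if k \<in> ?R then (p \<circ> q) k else k) = q"
    proof
      fix k show "(if k \<in> ?R then (p \<circ> q) k else k) = q k"
      proof (cases "k \<in> ?R")
        case True
        then have "q k \<in> ?R" using permutes_in_image[OF q] by simp
        then show ?thesis using True permutes_not_in[OF p] by auto
      qed (use permutes_not_in[OF q] in auto)
    qed
    ultimately show "(\<lambda>k. if k \<in> ?F then ((\<lambda>(p, q). p \<circ> q) pq) k else k, \<lambda>k. if k \<in> ?R then ((\<lambda>(p, q). p \<circ> q) pq) k else k) = pq"
      by (simp only: pq prod.case)
  next
    fix g assume g: "g \<in> labperms lab K"
    have gp: "g permutes K" by (rule labperms_permutes[OF g])
    show "(\<lambda>(p, q). p \<circ> q) (\<lambda>k. if k \<in> ?F then g k else k, \<lambda>k. if k \<in> ?R then g k else k) = g"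
    proof
      fix k
      have "g k \<notin> ?F" if "k \<in> ?R" using g that by (auto simp: labperms_def F_def)
      then show "(\<lambda>(p, q). p \<circ> q) (\<lambda>k. if k \<in> ?F then g k else k, \<lambda>k. if k \<in> ?R then g k else k) k = g k"
        using permutes_not_in[OF gp, of k] by auto
    qed
  qed
qed

lemma card_labperms:
  assumes "finite V" "finite K" "lab ` K \<subseteq> V"
  shows "card (labperms lab K) = (\<Prod>v\<in>V. fact (card {k \<in> K. lab k = v}))"
  using assms
proof (induction V arbitrary: K rule: finite_induct)
  case empty
  then show ?case by (simp add: labperms_def)
next
  case (insert v V)
  let ?F = "{k \<in> K. lab k = v}"
  have "card (labperms lab K) = card ({p. p permutes ?F} \<times> labperms lab (K - ?F))"
    by (rule bij_betw_same_card[OF bij_betw_labperms_split, symmetric])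
  also have "\<dots> = fact (card ?F) * card (labperms lab (K - ?F))"
    using insert.prems by (simp add: card_cartesian_product card_permutations)
  also have "card (labperms lab (K - ?F)) = (\<Prod>w\<in>V. fact (card {k \<in> K - ?F. lab k = w}))"
    using insert.prems by (intro insert.IH) auto
  also have "\<dots> = (\<Prod>w\<in>V. fact (card {k \<in> K. lab k = w}))"
    using insert.hyps by (intro prod.cong refl arg_cong[of _ _ fact] arg_cong[of _ _ card]) auto
  finally show ?case using insert.hyps by simp
qed

lemma sum_Pow_card:
  fixes G :: "nat \<Rightarrow> 'a::comm_semiring_1"
  assumes "finite A"
  shows "(\<Sum>B\<in>Pow A. G (card B)) = (\<Sum>b\<le>card A. of_nat (card A choose b) * G b)"
proof -
  have "(\<Sum>B\<in>Pow A. G (card B)) = (\<Sum>b\<le>card A. \<Sum>B\<in>{B \<in> Pow A. card B = b}. G (card B))"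
    using assms by (intro sum.group[symmetric]) (auto intro: card_mono)
  also have "\<dots> = (\<Sum>b\<le>card A. of_nat (card A choose b) * G b)"
  proof (rule sum.cong[OF refl])
    fix b
    have "card {B \<in> Pow A. card B = b} = card A choose b" using n_subsets[OF assms, of b] by simp
    then show "(\<Sum>B\<in>{B \<in> Pow A. card B = b}. G (card B)) = of_nat (card A choose b) * G b" by simp
  qed
  finally show ?thesis .
qed

text \<open>A monomial of degree d with exponents m_i comes from d! / (\<Prod>i m_i!) words, and the
  weight \<Prod>i m_i! is the order of the stabilizer of each of them, so every monomial gets the
  coefficient d!. The induction removes the set \<open>B\<close> of positions that carry the last
  letter.\<close>

lemma sum_words_fact:
  fixes x :: "nat \<Rightarrow> 'a::{comm_ring_1,ring_char_0}"
  assumes "finite A"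
  shows "(\<Sum>u\<in>A \<rightarrow>\<^sub>E {..<n}. of_nat (\<Prod>v<n. fact (wt A u v)) * (\<Prod>k\<in>A. x (u k))) = fact (card A) * hsym n (card A) x"
  using assms
proof (induction n arbitrary: A)
  case 0
  then show ?case by (cases "A = {}") auto
next
  case (Suc n)
  let ?G = "\<lambda>n A u. of_nat (\<Prod>v<n. fact (wt A u v)) * (\<Prod>k\<in>A. x (u k))"
  have "(\<Sum>u\<in>A \<rightarrow>\<^sub>E {..<Suc n}. ?G (Suc n) A u)
    = (\<Sum>(B, u)\<in>Sigma (Pow A) (\<lambda>B. (A - B) \<rightarrow>\<^sub>E {..<n}). fact (card B) * x n ^ card B * ?G n (A - B) u)"
  proof (rule sum.reindex_bij_witness[where i = "\<lambda>(B, u). \<lambda>k\<in>A. if k \<in> B then n else u k"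
        and j = "\<lambda>u. ({k \<in> A. u k = n}, restrict u (A - {k \<in> A. u k = n}))"])
    fix u assume u: "u \<in> A \<rightarrow>\<^sub>E {..<Suc n}"
    let ?B = "{k \<in> A. u k = n}"
    let ?u = "restrict u (A - ?B)"
    show "(case (?B, ?u) of (B, u) \<Rightarrow> \<lambda>k\<in>A. if k \<in> B then n else u k) = u"
      using u by (auto simp: fun_eq_iff PiE_def extensional_def)
    show "(?B, ?u) \<in> Sigma (Pow A) (\<lambda>B. (A - B) \<rightarrow>\<^sub>E {..<n})"
      using u by (auto simp: PiE_def Pi_def less_Suc_eq)
    have w: "wt A u v = wt (A - ?B) ?u v" if "v < n" for v
      unfolding wt_def using that by (intro arg_cong[of _ _ card]) auto
    have "(\<Prod>k\<in>A. x (u k)) = (\<Prod>k\<in>?B. x (u k)) * (\<Prod>k\<in>A - ?B. x (u k))"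
      using Suc.prems by (subst prod.subset_diff[of ?B A]) (auto simp: mult.commute)
    also have "(\<Prod>k\<in>?B. x (u k)) = x n ^ card ?B" by simp
    also have "(\<Prod>k\<in>A - ?B. x (u k)) = (\<Prod>k\<in>A - ?B. x (?u k))" by (rule prod.cong) auto
    finally have xs: "(\<Prod>k\<in>A. x (u k)) = x n ^ card ?B * (\<Prod>k\<in>A - ?B. x (?u k))" .
    have "(\<Prod>v<Suc n. fact (wt A u v)) = (\<Prod>v<n. fact (wt A u v)) * fact (wt A u n)"
      by simp
    also have "(\<Prod>v<n. fact (wt A u v)) = (\<Prod>v<n. fact (wt (A - ?B) ?u v))"
      by (intro prod.cong refl arg_cong[of _ _ fact] w) simp
    finally have ws: "(\<Prod>v<Suc n. fact (wt A u v)) = (\<Prod>v<n. fact (wt (A - ?B) ?u v)) * fact (card ?B)"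
      by (simp only: wt_def)
    show "(case (?B, ?u) of (B, u) \<Rightarrow> fact (card B) * x n ^ card B * ?G n (A - B) u) = ?G (Suc n) A u"
      unfolding prod.case xs ws of_nat_mult of_nat_fact by (simp only: mult_ac)
  next
    fix Bu assume "Bu \<in> Sigma (Pow A) (\<lambda>B. (A - B) \<rightarrow>\<^sub>E {..<n})"
    then obtain B u where Bu: "Bu = (B, u)" "B \<subseteq> A" "u \<in> (A - B) \<rightarrow>\<^sub>E {..<n}" by auto
    let ?w = "\<lambda>k\<in>A. if k \<in> B then n else u k"
    have B: "{k \<in> A. ?w k = n} = B" using Bu by (force simp: PiE_def Pi_def)
    have "restrict ?w (A - B) = u" using Bu by (auto simp: fun_eq_iff PiE_def extensional_def)
    then show "({k \<in> A. (case Bu of (B, u) \<Rightarrow> \<lambda>k\<in>A. if k \<in> B then n else u k) k = n},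
       restrict (case Bu of (B, u) \<Rightarrow> \<lambda>k\<in>A. if k \<in> B then n else u k)
        (A - {k \<in> A. (case Bu of (B, u) \<Rightarrow> \<lambda>k\<in>A. if k \<in> B then n else u k) k = n})) = Bu"
      using B Bu(1) by simp
    show "(case Bu of (B, u) \<Rightarrow> \<lambda>k\<in>A. if k \<in> B then n else u k) \<in> A \<rightarrow>\<^sub>E {..<Suc n}"
      using Bu by (auto simp: PiE_def Pi_def less_Suc_eq)
  qed
  also have "\<dots> = (\<Sum>B\<in>Pow A. \<Sum>u\<in>(A - B) \<rightarrow>\<^sub>E {..<n}. fact (card B) * x n ^ card B * ?G n (A - B) u)"
    using Suc.prems by (subst sum.Sigma) (auto intro: finite_PiE finite_subset)
  also have "\<dots> = (\<Sum>B\<in>Pow A. (\<lambda>b. fact b * x n ^ b * (fact (card A - b) * hsym n (card A - b) x)) (card B))"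
  proof (rule sum.cong[OF refl])
    fix B assume "B \<in> Pow A"
    then have B: "B \<subseteq> A" "finite B" using Suc.prems finite_subset by auto
    have "card (A - B) = card A - card B" using B by (simp add: card_Diff_subset)
    then show "(\<Sum>u\<in>(A - B) \<rightarrow>\<^sub>E {..<n}. fact (card B) * x n ^ card B * ?G n (A - B) u)
      = (\<lambda>b. fact b * x n ^ b * (fact (card A - b) * hsym n (card A - b) x)) (card B)"
      unfolding sum_distrib_left[symmetric] using Suc.IH[of "A - B"] Suc.prems by simp
  qed
  also have "\<dots> = (\<Sum>b\<le>card A. of_nat (card A choose b) * (fact b * x n ^ b * (fact (card A - b) * hsym n (card A - b) x)))"
    by (rule sum_Pow_card[OF Suc.prems])
  also have "\<dots> = (\<Sum>b\<le>card A. fact (card A) * (hsym n (card A - b) x * x n ^ b))"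
  proof (rule sum.cong[OF refl])
    fix b assume "b \<in> {..card A}"
    then have "fact b * fact (card A - b) * (card A choose b) = (fact (card A) :: nat)"
      by (simp add: binomial_fact_lemma)
    then have "of_nat (fact b * fact (card A - b) * (card A choose b)) = (of_nat (fact (card A)) :: 'a)" by simp
    then have *: "fact b * fact (card A - b) * of_nat (card A choose b) = (fact (card A) :: 'a)" by simp
    have "of_nat (card A choose b) * (fact b * x n ^ b * (fact (card A - b) * hsym n (card A - b) x))
      = (fact b * fact (card A - b) * of_nat (card A choose b)) * (hsym n (card A - b) x * x n ^ b)"
      by (simp only: mult_ac)
    then show "of_nat (card A choose b) * (fact b * x n ^ b * (fact (card A - b) * hsym n (card A - b) x))
      = fact (card A) * (hsym n (card A - b) x * x n ^ b)"
      by (simp only: *)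
  qed
  finally show ?case by (simp add: sum_distrib_left)
qed

text \<open>The row lengths \<open>a\<close> may be any sequence, not only a partition, since
  Jacobi-Trudi terms are products of complete homogeneous polynomials in unsorted degrees.\<close>

definition diag :: "nat \<Rightarrow> (nat \<Rightarrow> nat) \<Rightarrow> (nat \<times> nat) set" where
  "diag n a = Sigma {..<n} (\<lambda>i. {..<a i})"

lemma finite_diag: "finite (diag n a)"
  by (simp add: diag_def)

lemma diag_rows: "diag n a \<subseteq> {..<n} \<times> UNIV"
  by (auto simp: diag_def)

lemma card_diag: "card (diag n a) = (\<Sum>i<n. a i)"
  by (simp add: diag_def)

text \<open>A word on a disjoint union is a family of words on the pieces. The condition on
  \<open>g\<close> is that it ignores values outside \<open>B i\<close>, because restricting a word
  to \<open>B i\<close> makes these \<open>undefined\<close>.\<close>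

lemma prod_sum_words_Sigma:
  fixes g :: "'i \<Rightarrow> ('m \<Rightarrow> nat) \<Rightarrow> 'a::comm_ring_1"
  assumes I: "finite I" "\<And>i. i \<in> I \<Longrightarrow> finite (B i)" and V: "finite V"
    and g: "\<And>i u v. i \<in> I \<Longrightarrow> (\<And>m. m \<in> B i \<Longrightarrow> u m = v m) \<Longrightarrow> g i u = g i v"
  shows "(\<Sum>j\<in>Sigma I B \<rightarrow>\<^sub>E V. \<Prod>i\<in>I. g i (\<lambda>m. j (i, m))) = (\<Prod>i\<in>I. \<Sum>u\<in>B i \<rightarrow>\<^sub>E V. g i u)"
proof -
  have "(\<Prod>i\<in>I. \<Sum>u\<in>B i \<rightarrow>\<^sub>E V. g i u) = (\<Sum>f\<in>PiE I (\<lambda>i. B i \<rightarrow>\<^sub>E V). \<Prod>i\<in>I. g i (f i))"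
    using I V by (intro prod_sum_PiE) (auto intro: finite_PiE)
  also have "\<dots> = (\<Sum>j\<in>Sigma I B \<rightarrow>\<^sub>E V. \<Prod>i\<in>I. g i (\<lambda>m. j (i, m)))"
  proof (rule sum.reindex_bij_witness[where i = "\<lambda>j. \<lambda>i\<in>I. \<lambda>m\<in>B i. j (i, m)"
        and j = "\<lambda>f. \<lambda>(i, m)\<in>Sigma I B. f i m"])
    fix f assume f: "f \<in> PiE I (\<lambda>i. B i \<rightarrow>\<^sub>E V)"
    have fi: "f i \<in> B i \<rightarrow>\<^sub>E V" if "i \<in> I" for i using PiE_mem[OF f that] .
    show "(\<lambda>i\<in>I. \<lambda>m\<in>B i. (\<lambda>(i, m)\<in>Sigma I B. f i m) (i, m)) = f"
    proof (rule PiE_ext[OF _ f])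
      show "(\<lambda>i\<in>I. \<lambda>m\<in>B i. (\<lambda>(i, m)\<in>Sigma I B. f i m) (i, m)) \<in> PiE I (\<lambda>i. B i \<rightarrow>\<^sub>E V)"
        using PiE_mem[OF fi] by auto
      fix i assume i: "i \<in> I"
      then show "(\<lambda>i\<in>I. \<lambda>m\<in>B i. (\<lambda>(i, m)\<in>Sigma I B. f i m) (i, m)) i = f i"
        using fi[OF i] by (auto simp: fun_eq_iff PiE_def extensional_def)
    qed
    show "(\<lambda>(i, m)\<in>Sigma I B. f i m) \<in> Sigma I B \<rightarrow>\<^sub>E V" using PiE_mem[OF fi] by auto
    show "(\<Prod>i\<in>I. g i (\<lambda>m. (\<lambda>(i, m)\<in>Sigma I B. f i m) (i, m))) = (\<Prod>i\<in>I. g i (f i))"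
      by (intro prod.cong refl g) auto
  next
    fix j assume j: "j \<in> Sigma I B \<rightarrow>\<^sub>E V"
    show "(\<lambda>(i, m)\<in>Sigma I B. (\<lambda>i\<in>I. \<lambda>m\<in>B i. j (i, m)) i m) = j"
      using j by (auto simp: fun_eq_iff PiE_def extensional_def)
    show "(\<lambda>i\<in>I. \<lambda>m\<in>B i. j (i, m)) \<in> PiE I (\<lambda>i. B i \<rightarrow>\<^sub>E V)" using PiE_mem[OF j] by auto
  qed
  finally show ?thesis ..
qed

lemma fixwords_swap:
  fixes F :: "('k \<Rightarrow> nat) \<Rightarrow> 'a::comm_ring_1"
  assumes "finite K" "finite G"
  shows "(\<Sum>g\<in>G. of_int (\<chi> g) * (\<Sum>j\<in>fixwords n K (\<gamma> g). F j))
    = (\<Sum>j\<in>K \<rightarrow>\<^sub>E {..<n}. of_int (\<Sum>g | g \<in> G \<and> (\<forall>k\<in>K. j (\<gamma> g k) = j k). \<chi> g) * F j)"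
proof -
  let ?W = "K \<rightarrow>\<^sub>E {..<n}"
  have W: "finite ?W" using assms by (simp add: finite_PiE)
  have "(\<Sum>g\<in>G. of_int (\<chi> g) * (\<Sum>j\<in>fixwords n K (\<gamma> g). F j))
    = (\<Sum>g\<in>G. \<Sum>j\<in>?W. if \<forall>k\<in>K. j (\<gamma> g k) = j k then of_int (\<chi> g) * F j else 0)"
    unfolding fixwords_def sum_distrib_left using W by (simp add: sum.inter_filter)
  also have "\<dots> = (\<Sum>j\<in>?W. \<Sum>g\<in>G. if \<forall>k\<in>K. j (\<gamma> g k) = j k then of_int (\<chi> g) * F j else 0)"
    by (rule sum.swap)
  also have "\<dots> = (\<Sum>j\<in>?W. of_int (\<Sum>g | g \<in> G \<and> (\<forall>k\<in>K. j (\<gamma> g k) = j k). \<chi> g) * F j)"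
    using assms(2) by (simp add: sum.inter_filter sum_distrib_right) (intro sum.cong refl, simp)
  finally show ?thesis .
qed

lemma signed_word_poly_words:
  assumes "finite K" "finite G"
  shows "signed_word_poly n K A G \<gamma> \<chi> x
    = (\<Sum>j\<in>K \<rightarrow>\<^sub>E {..<n}. of_int (\<Sum>g | g \<in> G \<and> (\<forall>k\<in>K. j (\<gamma> g k) = j k). \<chi> g) * (\<Prod>k\<in>A. x (j k)))"
  unfolding signed_word_poly_def by (rule fixwords_swap[OF assms])

text \<open>For the row group with trivial character the weight of a word is the order of its
  stabilizer, a product of factorials over rows and letters. The sum therefore factors over the
  rows, and each factor is an instance of \<open>sum_words_fact\<close>.\<close>

lemma signed_word_poly_rows:
  fixes x :: "nat \<Rightarrow> 'a::{comm_ring_1,ring_char_0}"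
  shows "signed_word_poly n (diag r a) (diag r a) (labperms fst (diag r a)) (\<lambda>g. g) (\<lambda>_. 1) x = (\<Prod>i<r. fact (a i) * hsym n (a i) x)"
proof -
  let ?K = "diag r a"
  let ?g = "\<lambda>i u. of_nat (\<Prod>v<n. fact (wt {..<a i} u v)) * (\<Prod>m<a i. x (u m))"
  have "signed_word_poly n ?K ?K (labperms fst ?K) (\<lambda>g. g) (\<lambda>_. 1) x
    = (\<Sum>j\<in>?K \<rightarrow>\<^sub>E {..<n}. of_nat (card (labperms (\<lambda>k. (fst k, j k)) ?K)) * (\<Prod>k\<in>?K. x (j k)))"
    unfolding signed_word_poly_words[OF finite_diag finite_labperms[OF finite_diag]]
  proof (rule sum.cong[OF refl])
    fix j :: "nat \<times> nat \<Rightarrow> nat"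
    have "{g. g \<in> labperms fst ?K \<and> (\<forall>k\<in>?K. j (g k) = j k)} = labperms (\<lambda>k. (fst k, j k)) ?K"
      by (auto simp: labperms_def)
    then show "of_int (\<Sum>g | g \<in> labperms fst ?K \<and> (\<forall>k\<in>?K. j (g k) = j k). 1) * (\<Prod>k\<in>?K. x (j k))
      = of_nat (card (labperms (\<lambda>k. (fst k, j k)) ?K)) * (\<Prod>k\<in>?K. x (j k))" by simp
  qed
  also have "\<dots> = (\<Sum>j\<in>?K \<rightarrow>\<^sub>E {..<n}. \<Prod>i<r. ?g i (\<lambda>m. j (i, m)))"
  proof (rule sum.cong[OF refl])
    fix j assume j: "j \<in> ?K \<rightarrow>\<^sub>E {..<n}"
    have "card (labperms (\<lambda>k. (fst k, j k)) ?K) = (\<Prod>v\<in>{..<r} \<times> {..<n}. fact (card {k \<in> ?K. (fst k, j k) = v}))"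
      using PiE_mem[OF j] by (intro card_labperms finite_diag) (auto simp: diag_def)
    also have "\<dots> = (\<Prod>i<r. \<Prod>v<n. fact (card {k \<in> ?K. (fst k, j k) = (i, v)}))"
      by (subst prod.cartesian_product) (simp add: case_prod_unfold prod_eq_iff)
    also have "\<dots> = (\<Prod>i<r. \<Prod>v<n. fact (wt {..<a i} (\<lambda>m. j (i, m)) v))"
    proof (intro prod.cong refl arg_cong[of _ _ fact])
      fix i v assume i: "i \<in> {..<r}"
      have "{k \<in> ?K. (fst k, j k) = (i, v)} = Pair i ` {m \<in> {..<a i}. j (i, m) = v}"
        using i by (auto simp: diag_def)
      then show "card {k \<in> ?K. (fst k, j k) = (i, v)} = wt {..<a i} (\<lambda>m. j (i, m)) v"
        by (simp add: wt_def card_image inj_on_def)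
    qed
    finally have c: "card (labperms (\<lambda>k. (fst k, j k)) ?K) = (\<Prod>i<r. \<Prod>v<n. fact (wt {..<a i} (\<lambda>m. j (i, m)) v))" .
    have "(\<Prod>k\<in>?K. x (j k)) = (\<Prod>i<r. \<Prod>m<a i. x (j (i, m)))"
      unfolding diag_def by (subst prod.Sigma) (auto simp: case_prod_unfold)
    then show "of_nat (card (labperms (\<lambda>k. (fst k, j k)) ?K)) * (\<Prod>k\<in>?K. x (j k)) = (\<Prod>i<r. ?g i (\<lambda>m. j (i, m)))"
      unfolding c by (simp add: prod.distrib)
  qed
  also have "\<dots> = (\<Prod>i<r. \<Sum>u\<in>{..<a i} \<rightarrow>\<^sub>E {..<n}. ?g i u)"
    unfolding diag_def
  proof (rule prod_sum_words_Sigma)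
    fix i u v assume uv: "\<And>m. m \<in> {..<a i} \<Longrightarrow> u m = (v m :: nat)"
    have "wt {..<a i} u = wt {..<a i} v"
      unfolding wt_def using uv by (intro ext arg_cong[of _ _ card]) auto
    then show "?g i u = ?g i v" using uv by simp
  qed auto
  also have "\<dots> = (\<Prod>i<r. fact (a i) * hsym n (a i) x)"
  proof (intro prod.cong refl)
    fix i
    show "(\<Sum>u\<in>{..<a i} \<rightarrow>\<^sub>E {..<n}. ?g i u) = fact (a i) * hsym n (a i) x"
      using sum_words_fact[OF finite_lessThan, of "a i" n x] by simp
  qed
  finally show ?thesis .
qed

section \<open>Triangularity of the functional on Schur polynomials\<close>

text \<open>This is applied also to sequences that need not decrease, such as contents of words and
  degrees in Jacobi-Trudi terms.\<close>

definition dominated :: "nat \<Rightarrow> (nat \<Rightarrow> nat) \<Rightarrow> (nat \<Rightarrow> nat) \<Rightarrow> bool" where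
  "dominated n s t \<longleftrightarrow> (\<forall>r\<le>n. (\<Sum>i<r. s i) \<le> (\<Sum>i<r. t i))"

lemma dominated_antisym:
  assumes "dominated n s t" "dominated n t s" "i < n"
  shows "s i = t i"
proof -
  have "(\<Sum>i<r. s i) = (\<Sum>i<r. t i)" if "r \<le> n" for r
    using assms(1,2) that by (auto simp: dominated_def intro: antisym)
  from this[of i] this[of "Suc i"] show ?thesis using assms(3) by simp
qed

lemma dominated_parts_antisym:
  assumes "s \<in> parts n d" "t \<in> parts n d" "dominated n s t" "dominated n t s"
  shows "s = t"
proof
  fix i show "s i = t i"
    using dominated_antisym[OF assms(3,4), of i] parts_zero[OF assms(1)] parts_zero[OF assms(2)]
    by (cases "i < n") auto
qed

text \<open>Column \<open>a\<close> receives at most \<open>r\<close> elements with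
  \<open>\<rho>\<close> below \<open>r\<close>, because \<open>\<rho>\<close> is injective on what
  it receives, and at most as many as it has cells. The minimum of these bounds counts the cells of
  column \<open>a\<close> in the first \<open>r\<close> rows; summing over the columns gives the sum
  of the first \<open>r\<close> parts.\<close>

lemma card_low_rows_le:
  assumes Y: "finite Y" "inj_on b Y" "b ` Y \<subseteq> diag n t" and t: "\<And>i k. i \<le> k \<Longrightarrow> t k \<le> t i"
    and inj: "inj_on (\<lambda>k. (\<rho> k, snd (b k))) Y"
  shows "card {k \<in> Y. \<rho> k < r} \<le> (\<Sum>i<r. t i)"
proof -
  let ?E = "\<lambda>a. {k \<in> {k \<in> Y. \<rho> k < r}. snd (b k) = a}"
  have col: "snd (b k) < t 0" if "k \<in> Y" for k
  proof -
    have "b k \<in> diag n t" using Y(3) that by auto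
    then have "snd (b k) < t (fst (b k))" by (auto simp: diag_def)
    then show ?thesis using t[of 0 "fst (b k)"] by simp
  qed
  have le: "card (?E a) \<le> card {i \<in> {..<r}. a < t i}" for a
  proof (cases "\<forall>i<r. a < t i")
    case True
    have "card (?E a) \<le> card {..<r}"
    proof (rule card_inj_on_le[of \<rho>])
      show "inj_on \<rho> (?E a)" using inj by (auto simp: inj_on_def)
    qed auto
    moreover have "{i \<in> {..<r}. a < t i} = {..<r}" using True by auto
    ultimately show ?thesis by simp
  next
    case False
    then obtain i0 where i0: "i0 < r" "t i0 \<le> a" by (auto simp: not_less)
    show ?thesis
    proof (rule card_inj_on_le[of "\<lambda>k. fst (b k)"])
      show "inj_on (\<lambda>k. fst (b k)) (?E a)"
        using Y(2) by (auto simp: inj_on_def prod_eq_iff)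
      show "(\<lambda>k. fst (b k)) ` ?E a \<subseteq> {i \<in> {..<r}. a < t i}"
      proof
        fix i assume "i \<in> (\<lambda>k. fst (b k)) ` ?E a"
        then obtain k where k: "k \<in> Y" "snd (b k) = a" "i = fst (b k)" by auto
        have "b k \<in> diag n t" using Y(3) k by auto
        then have a: "a < t i" using k by (auto simp: diag_def)
        then have "i < i0" using i0(2) t[of i0 i] by (meson leD le_trans linorder_le_less_linear)
        then show "i \<in> {i \<in> {..<r}. a < t i}" using a i0 by auto
      qed
    qed auto
  qed
  have "card {k \<in> Y. \<rho> k < r} = (\<Sum>a<t 0. card (?E a))"
  proof -
    have "(\<Sum>a<t 0. \<Sum>k\<in>?E a. 1) = (\<Sum>k\<in>{k \<in> Y. \<rho> k < r}. (1::nat))"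
      using Y(1) col by (intro sum.group) auto
    then show ?thesis by simp
  qed
  also have "\<dots> \<le> (\<Sum>a<t 0. card {i \<in> {..<r}. a < t i})" by (rule sum_mono) (rule le)
  also have "\<dots> = (\<Sum>a<t 0. \<Sum>i<r. if a < t i then 1 else 0)" by (simp add: sum.If_cases Int_def)
  also have "\<dots> = (\<Sum>i<r. \<Sum>a<t 0. if a < t i then 1 else 0)" by (rule sum.swap)
  also have "\<dots> = (\<Sum>i<r. t i)"
  proof (rule sum.cong[OF refl])
    fix i
    have "{a. a < t 0 \<and> a < t i} = {..<t i}" using t[of 0 i] by auto
    then show "(\<Sum>a<t 0. if a < t i then 1 else 0) = t i" by (simp add: sum.If_cases Int_def)
  qed
  finally show ?thesis .
qed

lemma surjs_bij:
  assumes "b \<in> surjs K D" "finite K" "card K = card D"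
  shows "inj_on b K" "b ` K = D"
  using assms by (auto simp: surjs_def eq_card_imp_inj_on)

lemma card_diag_low: "r \<le> n \<Longrightarrow> card {k \<in> diag n s. fst k < r} = (\<Sum>i<r. s i)"
proof -
  assume "r \<le> n"
  then have "{k \<in> diag n s. fst k < r} = diag r s" by (auto simp: diag_def)
  then show ?thesis by (simp add: card_diag)
qed

lemma dominated_rows:
  assumes b: "b \<in> surjs (diag n s) (diag n t)" and c: "card (diag n s) = card (diag n t)"
    and t: "\<And>i k. i \<le> k \<Longrightarrow> t k \<le> t i"
    and ne: "\<And>k k'. k \<in> diag n s \<Longrightarrow> k' \<in> diag n s \<Longrightarrow> k \<noteq> k' \<Longrightarrow> fst k = fst k' \<Longrightarrow> snd (b k) \<noteq> snd (b k')"
  shows "dominated n s t"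
  unfolding dominated_def
proof (intro allI impI)
  fix r assume r: "r \<le> n"
  note bb = surjs_bij[OF b finite_diag c]
  have "card {k \<in> diag n s. fst k < r} \<le> (\<Sum>i<r. t i)"
  proof (rule card_low_rows_le[OF finite_diag, where b = b and n = n])
    show "inj_on (\<lambda>k. (fst k, snd (b k))) (diag n s)"
      by (rule inj_onI) (metis ne prod.inject)
  qed (use bb t in auto)
  then show "(\<Sum>i<r. s i) \<le> (\<Sum>i<r. t i)" by (simp add: card_diag_low[OF r])
qed

text \<open>The roles of the diagrams are exchanged: the inverse of \<open>b\<close> places the
  cells of \<open>t\<close>, ranked by row, into the diagram of \<open>s\<close>, and by hypothesis
  no column of \<open>s\<close> receives two cells from the same row of \<open>t\<close>.\<close>

lemma dominated_columns:
  assumes b: "b \<in> surjs (diag n s) (diag n t)" and c: "card (diag n s) = card (diag n t)"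
    and s: "\<And>i k. i \<le> k \<Longrightarrow> s k \<le> s i"
    and ne: "\<And>k k'. k \<in> diag n s \<Longrightarrow> k' \<in> diag n s \<Longrightarrow> k \<noteq> k' \<Longrightarrow> snd k = snd k' \<Longrightarrow> fst (b k) \<noteq> fst (b k')"
  shows "dominated n t s"
  unfolding dominated_def
proof (intro allI impI)
  fix r assume r: "r \<le> n"
  note bb = surjs_bij[OF b finite_diag c]
  let ?h = "inv_into (diag n s) b"
  have hb: "b (?h k) = k" "?h k \<in> diag n s" if "k \<in> diag n t" for k
    using that bb(2) by (auto intro: f_inv_into_f inv_into_into)
  have "card {k \<in> diag n t. fst k < r} \<le> (\<Sum>i<r. s i)"
  proof (rule card_low_rows_le[OF finite_diag, where b = ?h and n = n])
    show "inj_on ?h (diag n t)" using bb(2) by (metis inj_on_inv_into subset_refl)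
    show "?h ` diag n t \<subseteq> diag n s" using hb by auto
    show "inj_on (\<lambda>k. (fst k, snd (?h k))) (diag n t)"
    proof (rule inj_onI)
      fix k k' assume k: "k \<in> diag n t" "k' \<in> diag n t" "(fst k, snd (?h k)) = (fst k', snd (?h k'))"
      have "?h k = ?h k'" using ne[OF hb(2)[OF k(1)] hb(2)[OF k(2)]] k hb by auto
      then show "k = k'" using hb(1) k by metis
    qed
  qed (rule s)
  then show "(\<Sum>i<r. t i) \<le> (\<Sum>i<r. s i)" by (simp add: card_diag_low[OF r])
qed

lemma sum_lessThan_card_le:
  fixes S :: "nat set"
  assumes "finite S"
  shows "(\<Sum>i<card S. i) \<le> \<Sum>S"
  using assms
proof (induction S rule: finite_linorder_max_induct)
  case (insert m S)
  have "S \<subseteq> {..<m}" using insert by auto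
  then have "card S \<le> m" using card_mono[of "{..<m}" S] by simp
  then show ?case using insert by auto
qed simp

lemma sum_delta_inj_le:
  assumes p: "inj_on p {..<r}" "p ` {..<r} \<subseteq> {..<n}" and r: "r \<le> n"
  shows "(\<Sum>i<r. delta n (p i)) \<le> (\<Sum>i<r. delta n i)"
proof -
  have "(\<Sum>i<r. i) \<le> \<Sum>(p ` {..<r})"
    using sum_lessThan_card_le[of "p ` {..<r}"] p(1) by (simp add: card_image)
  then have 1: "(\<Sum>i<r. i) \<le> (\<Sum>i<r. p i)" using p(1) by (simp add: sum.reindex)
  have "(\<Sum>i<r. delta n (p i)) + (\<Sum>i<r. p i) = (\<Sum>i<r. delta n (p i) + p i)" by (simp add: sum.distrib)
  also have "\<dots> = (\<Sum>i<r. delta n i + i)"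
  proof (rule sum.cong[OF refl])
    fix i assume "i \<in> {..<r}"
    then have "p i < n" "i < n" using p r by auto
    then show "delta n (p i) + p i = delta n i + i" by (simp add: delta_def)
  qed
  also have "\<dots> = (\<Sum>i<r. delta n i) + (\<Sum>i<r. i)" by (simp add: sum.distrib)
  finally show ?thesis using 1 by linarith
qed

text \<open>The first \<open>r\<close> values of \<open>delta\<close> are its largest, so permuting
  \<open>delta\<close> can only lower the partial sums that are subtracted from those of
  \<open>s + delta\<close>.\<close>

lemma dominated_shift:
  assumes p: "p permutes {..<n}" and a: "\<And>i. i < n \<Longrightarrow> a i + delta n (p i) = s i + delta n i"
  shows "dominated n s a"
  unfolding dominated_def
proof (intro allI impI)
  fix r assume r: "r \<le> n"
  have "(\<Sum>i<r. a i) + (\<Sum>i<r. delta n (p i)) = (\<Sum>i<r. s i) + (\<Sum>i<r. delta n i)"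
    unfolding sum.distrib[symmetric] using a r by (intro sum.cong) auto
  moreover have "(\<Sum>i<r. delta n (p i)) \<le> (\<Sum>i<r. delta n i)"
    using permutes_inj_on[OF p] permutes_in_image[OF p] r by (intro sum_delta_inj_le) auto
  ultimately show "(\<Sum>i<r. s i) \<le> (\<Sum>i<r. a i)" by linarith
qed

lemma dominated_shift_id:
  assumes p: "p permutes {..<n}" and a: "\<And>i. i < n \<Longrightarrow> a i + delta n (p i) = s i + delta n i"
    and d: "dominated n a s"
  shows "p = id"
proof
  fix i
  show "p i = id i"
  proof (cases "i < n")
    case True
    have "s i = a i" by (rule dominated_antisym[OF dominated_shift[OF p a] d True])
    then have "delta n (p i) = delta n i" using a[OF True] by simp
    moreover have "p i < n" using permutes_in_image[OF p] True by simp
    ultimately show ?thesis using True by (auto simp: delta_def)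
  qed (use permutes_not_in[OF p] in auto)
qed

lemma hw_functional_sum:
  assumes "finite I"
  shows "hw_functional n D (\<lambda>x. \<Sum>i\<in>I. a i * f i x) = (\<Sum>i\<in>I. a i * hw_functional n D (f i))"
proof -
  have "hw_functional n D (\<lambda>x. \<Sum>i\<in>I. a i * f i x) = (\<Sum>c\<in>colperms D. \<Sum>T\<in>Pow D. \<Sum>i\<in>I. a i * (of_int (sign c) * ((- 1) ^ (card D - card T) *
     f i (eigs n (\<lambda>r s. \<Sum>u\<in>T. of_bool (r = fst u \<and> s = fst (c u)))))))"
    unfolding hw_functional_def by (simp add: sum_distrib_left mult_ac)
  also have "\<dots> = (\<Sum>i\<in>I. a i * hw_functional n D (f i))"
    unfolding hw_functional_def sum_distrib_left by (simp only: sum.swap[of _ I])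
  finally show ?thesis .
qed

lemma hw_functional_scale: "hw_functional n D (\<lambda>x. a * f x) = a * hw_functional n D f"
  using hw_functional_sum[of "{()}" n D "\<lambda>_. a" "\<lambda>_. f"] by simp

lemma poly_schur_fn: "poly (schur_fn n t y) c = schur_fn n t (\<lambda>i. poly (y i) c)"
  by (induction n arbitrary: t) (simp_all add: poly_sum)

lemma poly_hsym: "poly (hsym n m y) c = hsym n m (\<lambda>i. poly (y i) c)"
  by (induction n arbitrary: m) (simp_all add: poly_sum)

lemma poly_hsymz: "poly (hsymz n k y) c = hsymz n k (\<lambda>i. poly (y i) c)"
  by (simp add: hsymz_def poly_hsym)

text \<open>Identities obtained by cancelling the Vandermonde determinant extend to variables with
  repetitions: perturb \<open>x i\<close> to \<open>x i + i t\<close> and evaluate at \<open>t = 0\<close>.\<close>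

definition perturb :: "(nat \<Rightarrow> complex) \<Rightarrow> nat \<Rightarrow> complex poly" where
  "perturb x i = [:x i, of_nat i:]"

lemma inj_perturb: "inj_on (perturb x) S"
  by (auto simp: perturb_def inj_on_def)

lemma poly_perturb: "poly (perturb x i) 0 = x i"
  by (simp add: perturb_def)

lemma jacobi_trudi:
  fixes x :: "nat \<Rightarrow> complex"
  assumes t: "t \<in> parts n d"
  shows "schur_fn n t x = (\<Sum>p | p permutes {..<n}. of_int (sign p) *
      (\<Prod>i<n. hsymz n (int (t i + delta n i) - int (delta n (p i))) x))"
proof -
  let ?y = "perturb x"
  let ?J = "\<lambda>x. \<Sum>p | p permutes {..<n}. of_int (sign p) *
      (\<Prod>i<n. hsymz n (int (t i + delta n i) - int (delta n (p i))) x)"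
  have "schur_fn n t ?y * alternant n (delta n) ?y = ?J ?y * alternant n (delta n) ?y"
    using parts_antimono[OF t] jacobi_trudi_alternant[of n "\<lambda>i. t i + delta n i" ?y] by (subst alternant_eq_schur_fn[symmetric]) auto
  then have "schur_fn n t ?y = ?J ?y" using alternant_delta_nonzero[OF inj_perturb[of x "{..<n}"]] by simp
  then have "poly (schur_fn n t ?y) 0 = poly (?J ?y) 0" by simp
  then show ?thesis by (simp add: poly_schur_fn poly_sum poly_prod poly_hsymz poly_perturb)
qed

lemma symmetric_words_expansion_idom:
  fixes x :: "nat \<Rightarrow> 'a::idom"
  assumes J: "symmetric_words n A J" and x: "inj_on x {..<n}"
  shows "(\<Sum>j\<in>J. \<Prod>k\<in>A. x (j k)) = (\<Sum>t\<in>parts n (card A). of_int (schur_coeff n A J t) * schur_fn n t x)"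
proof -
  have "(\<Sum>j\<in>J. \<Prod>k\<in>A. x (j k)) * alternant n (delta n) x
    = (\<Sum>t\<in>parts n (card A). of_int (schur_coeff n A J t) * (schur_fn n t x * alternant n (delta n) x))"
    unfolding symmetric_words_alternant_expansion[OF J]
    by (intro sum.cong refl, subst alternant_eq_schur_fn) (auto intro: parts_antimono)
  also have "\<dots> = (\<Sum>t\<in>parts n (card A). of_int (schur_coeff n A J t) * schur_fn n t x) * alternant n (delta n) x"
    by (simp add: sum_distrib_right mult.assoc)
  finally show ?thesis using alternant_delta_nonzero[OF x] by simp
qed

lemma symmetric_words_expansion:
  fixes x :: "nat \<Rightarrow> complex"
  assumes J: "symmetric_words n A J"
  shows "(\<Sum>j\<in>J. \<Prod>k\<in>A. x (j k)) = (\<Sum>t\<in>parts n (card A). of_int (schur_coeff n A J t) * schur_fn n t x)"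
proof -
  have "poly (\<Sum>j\<in>J. \<Prod>k\<in>A. perturb x (j k)) 0
    = poly (\<Sum>t\<in>parts n (card A). of_int (schur_coeff n A J t) * schur_fn n t (perturb x)) 0"
    by (simp only: symmetric_words_expansion_idom[OF J inj_perturb])
  then show ?thesis by (simp add: poly_schur_fn poly_sum poly_prod poly_perturb)
qed

text \<open>Translation by \<open>h\<close> permutes the stabilizer of \<open>j\<close> and
  multiplies the character by -1, so the sum equals its own negative.\<close>

lemma sum_stabilizer_eq_0:
  assumes S: "signed_action K G \<gamma> \<chi>" and h: "h \<in> G" "\<And>k. k \<in> K \<Longrightarrow> j (\<gamma> h k) = j k" "\<chi> h = -1"
  shows "(\<Sum>g | g \<in> G \<and> (\<forall>k\<in>K. j (\<gamma> g k) = j k). \<chi> g) = 0"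
proof -
  have fin: "finite G" and per: "\<gamma> h permutes K" using S h(1) by (auto simp: signed_action_def)
  have hK: "\<gamma> h ` K = K" by (rule permutes_image[OF per])
  let ?s = "\<Sum>g\<in>G. \<chi> g * of_bool (\<forall>k\<in>K. j (\<gamma> g k) = j k)"
  have "?s = (\<Sum>g\<in>G. \<chi> g * \<chi> h * of_bool (\<forall>k\<in>K. j ((\<gamma> g \<circ> \<gamma> h) k) = j k))"
    by (rule signed_action_reindex[OF S h(1), where F = "\<lambda>p s. s * of_bool (\<forall>k\<in>K. j (p k) = j k)"])
  also have "\<dots> = - ?s"
    unfolding sum_negf[symmetric]
  proof (rule sum.cong[OF refl])
    fix g
    have "(\<forall>k\<in>K. j ((\<gamma> g \<circ> \<gamma> h) k) = j k) \<longleftrightarrow> (\<forall>k\<in>K. j (\<gamma> g (\<gamma> h k)) = j (\<gamma> h k))"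
      using h(2) by simp
    also have "\<dots> \<longleftrightarrow> (\<forall>k\<in>\<gamma> h ` K. j (\<gamma> g k) = j k)" by blast
    finally show "\<chi> g * \<chi> h * of_bool (\<forall>k\<in>K. j ((\<gamma> g \<circ> \<gamma> h) k) = j k) = - (\<chi> g * of_bool (\<forall>k\<in>K. j (\<gamma> g k) = j k))"
      by (simp add: hK h(3))
  qed
  finally have "?s = 0" by simp
  moreover have "(\<Sum>g | g \<in> G \<and> (\<forall>k\<in>K. j (\<gamma> g k) = j k). \<chi> g) = ?s"
    using fin by (simp add: sum.inter_filter of_bool_def if_distrib cong: if_cong)
  ultimately show ?thesis by simp
qed

text \<open>The monomials of these words sum to the product, over the columns of \<open>D\<close>,
  of the elementary symmetric polynomial of the column length times the factorial of that
  length.\<close>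

definition colinj :: "nat \<Rightarrow> (nat \<times> nat) set \<Rightarrow> (nat \<times> nat \<Rightarrow> nat) set" where
  "colinj n D = {j \<in> D \<rightarrow>\<^sub>E {..<n}. \<forall>k\<in>D. \<forall>k'\<in>D. k \<noteq> k' \<longrightarrow> snd k = snd k' \<longrightarrow> j k \<noteq> j k'}"

lemma colinj_permute:
  assumes w: "w permutes {..<n}" and j: "j \<in> colinj n D"
  shows "(\<lambda>k\<in>D. w (j k)) \<in> colinj n D"
proof -
  have "w (j k) < n" if "k \<in> D" for k
    using permutes_in_image[OF w] j that by (auto simp: colinj_def)
  moreover have "w (j k) = w (j k') \<longleftrightarrow> j k = j k'" for k k'
    by (rule inj_eq[OF permutes_inj[OF w]])
  ultimately show ?thesis using j by (auto simp: colinj_def)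
qed

lemma symmetric_words_colinj: "finite D \<Longrightarrow> symmetric_words n D (colinj n D)"
  by (rule symmetric_wordsI) (auto simp: colinj_permute, auto simp: colinj_def)

text \<open>A column-injective word has trivial stabilizer in the column group; any other word is
  fixed by a transposition inside a column, so its signed stabilizer sum vanishes.\<close>

lemma signed_word_poly_columns:
  fixes x :: "nat \<Rightarrow> 'a::comm_ring_1"
  assumes D: "finite D"
  shows "signed_word_poly n D D (colperms D) (\<lambda>g. g) sign x = (\<Sum>j\<in>colinj n D. \<Prod>k\<in>D. x (j k))"
proof -
  let ?G = "colperms D"
  note S = signed_action_labperms(1)[OF D, of snd]
  have st: "(\<Sum>g | g \<in> ?G \<and> (\<forall>k\<in>D. j (g k) = j k). sign g) = of_bool (j \<in> colinj n D)"
    if j: "j \<in> D \<rightarrow>\<^sub>E {..<n}" for j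
  proof (cases "j \<in> colinj n D")
    case True
    have "{g. g \<in> ?G \<and> (\<forall>k\<in>D. j (g k) = j k)} = {id}"
    proof (intro equalityI subsetI)
      fix g assume g: "g \<in> {g. g \<in> ?G \<and> (\<forall>k\<in>D. j (g k) = j k)}"
      then have gp: "g permutes D" by (auto simp: labperms_def)
      have "g k = k" for k
      proof (cases "k \<in> D")
        case kD: True
        have "g k \<in> D" using permutes_in_image[OF gp] kD by simp
        moreover have "snd (g k) = snd k" "j (g k) = j k" using g kD by (auto simp: labperms_def)
        ultimately show ?thesis using True kD by (auto simp: colinj_def)
      qed (rule permutes_not_in[OF gp])
      then show "g \<in> {id}" by auto
    qed (auto intro: id_labperms)
    then show ?thesis using True by simp
  next
    case False
    then obtain k k' where k: "k \<in> D" "k' \<in> D" "k \<noteq> k'" "snd k = snd k'" "j k = j k'"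
      using j by (auto simp: colinj_def)
    have "transpose k k' \<in> ?G" by (rule transpose_labperms[OF k(1,2,4)])
    then have "(\<Sum>g | g \<in> ?G \<and> (\<forall>k\<in>D. j (g k) = j k). sign g) = 0"
      by (rule sum_stabilizer_eq_0[OF S]) (use k in \<open>auto simp: transpose_def sign_swap_id\<close>)
    then show ?thesis using False by simp
  qed
  have W: "finite (D \<rightarrow>\<^sub>E {..<n})" using D by (simp add: finite_PiE)
  have "signed_word_poly n D D ?G (\<lambda>g. g) sign x = (\<Sum>j\<in>D \<rightarrow>\<^sub>E {..<n}. of_int (of_bool (j \<in> colinj n D)) * (\<Prod>k\<in>D. x (j k)))"
    unfolding signed_word_poly_words[OF D finite_labperms[OF D]] by (intro sum.cong refl) (simp only: st)
  also have "\<dots> = (\<Sum>j\<in>colinj n D. \<Prod>k\<in>D. x (j k))"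
    by (rule sum.mono_neutral_cong_right[OF W]) (auto simp: colinj_def)
  finally show ?thesis .
qed

lemma sum_part: "t \<in> parts n d \<Longrightarrow> (\<Sum>i<n. t i) = d"
  by (simp add: parts_def)

lemma hw_functional_hsym_nonzero:
  assumes t: "t \<in> parts n d" and a: "(\<Sum>i<n. a i) = d"
    and nz: "hw_functional n (diag n t) (\<lambda>x. \<Prod>i<n. hsym n (a i) x) \<noteq> 0"
  shows "dominated n a t"
proof -
  let ?K = "diag n a" and ?D = "diag n t"
  let ?f = "signed_word_poly n ?K ?K (labperms fst ?K) (\<lambda>g. g) (\<lambda>_. 1) :: (nat \<Rightarrow> complex) \<Rightarrow> complex"
  have "?f = (\<lambda>x. (\<Prod>i<n. fact (a i)) * (\<Prod>i<n. hsym n (a i) x))"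
    by (rule ext) (simp add: signed_word_poly_rows prod.distrib)
  then have "hw_functional n ?D ?f = (\<Prod>i<n. fact (a i)) * hw_functional n ?D (\<lambda>x. \<Prod>i<n. hsym n (a i) x)"
    by (simp only: hw_functional_scale)
  then have "hw_functional n ?D ?f \<noteq> 0" using nz by simp
  moreover have "hw_functional n ?D ?f = of_int (hw_form n ?D ?K ?K (labperms fst ?K) (\<lambda>g. g) (\<lambda>_. 1))"
    by (rule hw_functional_signed_word_poly[OF finite_diag subset_refl finite_diag]) (auto dest: labperms_permutes)
  ultimately have "hw_form n ?D ?K ?K (labperms fst ?K) (\<lambda>g. g) (\<lambda>_. 1) \<noteq> 0" by auto
  then obtain b where b: "b \<in> surjs ?K ?D"
    "\<forall>k\<in>?K. \<forall>k'\<in>?K. k \<noteq> k' \<longrightarrow> fst k = fst k' \<longrightarrow> snd (b k) \<noteq> snd (b k')"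
    using hw_form_row_nonzero[OF finite_diag finite_diag diag_rows, of n a n t fst] a sum_part[OF t]
    by (auto simp: card_diag)
  show ?thesis
    by (rule dominated_rows[OF b(1) _ parts_antimono[OF t]]) (use b(2) a sum_part[OF t] in \<open>auto simp: card_diag\<close>)
qed

text \<open>Some Jacobi-Trudi term must pair nontrivially. Its sequence of degrees \<open>a\<close>
  dominates \<open>s\<close> by \<open>dominated_shift\<close> and is dominated by \<open>t\<close>
  by \<open>hw_functional_hsym_nonzero\<close>.\<close>

lemma hw_functional_schur_fn_nonzero:
  assumes t: "t \<in> parts n d" and s: "s \<in> parts n d" and nz: "hw_functional n (diag n t) (schur_fn n s) \<noteq> 0"
  shows "dominated n s t"
proof -
  let ?P = "{p. p permutes {..<n}}"
  let ?z = "\<lambda>p i. int (s i + delta n i) - int (delta n (p i))"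
  have "schur_fn n s = (\<lambda>x :: nat \<Rightarrow> complex. \<Sum>p\<in>?P. of_int (sign p) * (\<Prod>i<n. hsymz n (?z p i) x))"
    using jacobi_trudi[OF s] by (intro ext)
  then have "hw_functional n (diag n t) (schur_fn n s) = (\<Sum>p\<in>?P. of_int (sign p) * hw_functional n (diag n t) (\<lambda>x. \<Prod>i<n. hsymz n (?z p i) x))"
    by (simp only: hw_functional_sum[OF finite_permutations[OF finite_lessThan]])
  then obtain p where p: "p permutes {..<n}" and L: "hw_functional n (diag n t) (\<lambda>x. \<Prod>i<n. hsymz n (?z p i) x) \<noteq> 0"
    using nz by (metis (mono_tags, lifting) mem_Collect_eq mult_zero_right sum.neutral)
  \<comment> \<open>A negative index would make the whole product the zero function, whose pairing
    is 0.\<close>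
  have pos: "0 \<le> ?z p i" if "i < n" for i
  proof (rule ccontr)
    assume "\<not> 0 \<le> ?z p i"
    then have "hsymz n (?z p i) x = 0" for x :: "nat \<Rightarrow> complex" by (simp add: hsymz_def)
    then have "(\<Prod>i<n. hsymz n (?z p i) x) = 0" for x :: "nat \<Rightarrow> complex" using that by (intro prod_zero) auto
    then show False using L by (simp add: hw_functional_def)
  qed
  define a where "a i = nat (?z p i)" for i
  have az: "a i + delta n (p i) = s i + delta n i" if "i < n" for i
    using pos[OF that] by (simp add: a_def)
  have "(\<lambda>x :: nat \<Rightarrow> complex. \<Prod>i<n. hsymz n (?z p i) x) = (\<lambda>x. \<Prod>i<n. hsym n (a i) x)"
  proof (intro ext prod.cong refl)
    fix x :: "nat \<Rightarrow> complex" and i assume "i \<in> {..<n}"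
    then have "\<not> ?z p i < 0" using pos[of i] by simp
    then show "hsymz n (?z p i) x = hsym n (a i) x" by (simp only: hsymz_def a_def if_False)
  qed
  then have L': "hw_functional n (diag n t) (\<lambda>x. \<Prod>i<n. hsym n (a i) x) \<noteq> 0" using L by simp
  have "(\<Sum>i<n. a i) + (\<Sum>i<n. delta n (p i)) = (\<Sum>i<n. s i) + (\<Sum>i<n. delta n i)"
    unfolding sum.distrib[symmetric] using az by (intro sum.cong) auto
  moreover have "(\<Sum>i<n. delta n (p i)) = (\<Sum>i<n. delta n i)"
    using sum.permute[OF p, of "delta n"] by (simp add: o_def)
  ultimately have "(\<Sum>i<n. a i) = d" using sum_part[OF s] by simp
  then have "dominated n a t" by (rule hw_functional_hsym_nonzero[OF t _ L'])
  moreover have "dominated n s a" by (rule dominated_shift[OF p az])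
  ultimately show ?thesis unfolding dominated_def by (meson le_trans)
qed

text \<open>The witness \<open>q\<close> is the value of \<open>hw_form\<close>. Passing to an
  integer is what gives a meaning to the sign of the complex-valued functional.\<close>

lemma hw_functional_columns:
  assumes t: "t \<in> parts n d" and s: "s \<in> parts n d"
  defines "f \<equiv> \<lambda>x :: nat \<Rightarrow> complex. \<Sum>j\<in>colinj n (diag n s). \<Prod>k\<in>diag n s. x (j k)"
  shows "\<exists>q :: int. hw_functional n (diag n t) f = of_int q \<and> (q \<noteq> 0 \<longrightarrow> dominated n t s) \<and> (s = t \<longrightarrow> q > 0)"
proof (intro exI conjI impI)
  let ?K = "diag n s" and ?D = "diag n t"
  let ?q = "hw_form n ?D ?K ?K (colperms ?K) (\<lambda>g. g) sign"
  have "f = signed_word_poly n ?K ?K (colperms ?K) (\<lambda>g. g) sign"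
    unfolding f_def by (rule ext) (simp add: signed_word_poly_columns finite_diag)
  then show "hw_functional n ?D f = of_int ?q"
    by (simp only: hw_functional_signed_word_poly[OF finite_diag subset_refl finite_diag labperms_permutes])
  show "dominated n t s" if nz: "?q \<noteq> 0"
  proof -
    obtain b where b: "b \<in> surjs ?K ?D"
      "\<forall>k\<in>?K. \<forall>k'\<in>?K. k \<noteq> k' \<longrightarrow> snd k = snd k' \<longrightarrow> fst (b k) \<noteq> fst (b k')"
      using hw_form_column_nonzero[OF finite_diag finite_diag diag_rows nz] by blast
    show ?thesis
      by (rule dominated_columns[OF b(1) _ parts_antimono[OF s]])
        (use b(2) sum_part[OF s] sum_part[OF t] in \<open>auto simp: card_diag\<close>)
  qed
  show "0 < ?q" if "s = t"
    unfolding that by (rule hw_form_self_pos[OF finite_diag diag_rows])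
qed

text \<open>In each column the letters below \<open>r\<close> are distinct, so there are at most as
  many of them as the column has cells in the first \<open>r\<close> rows.\<close>

lemma colinj_dominated:
  assumes s: "s \<in> parts n d" and j: "j \<in> colinj n (diag n s)"
  shows "dominated n (wt (diag n s) j) s"
  unfolding dominated_def
proof (intro allI impI)
  fix r assume r: "r \<le> n"
  let ?D = "diag n s"
  have "card {k \<in> ?D. j k < r} \<le> (\<Sum>i<r. s i)"
  proof (rule card_low_rows_le[OF finite_diag, where b = id and n = n])
    show "inj_on (\<lambda>k. (j k, snd (id k))) ?D" using j by (force simp: colinj_def inj_on_def)
  qed (use parts_antimono[OF s] in auto)
  moreover have "card {k \<in> ?D. j k < r} = (\<Sum>i<r. wt ?D j i)"
  proof -
    have "(\<Sum>i<r. \<Sum>k\<in>{k \<in> {k \<in> ?D. j k < r}. j k = i}. 1) = (\<Sum>k\<in>{k \<in> ?D. j k < r}. (1::nat))"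
      using finite_diag by (intro sum.group) auto
    moreover have "{k \<in> {k \<in> ?D. j k < r}. j k = i} = {k \<in> ?D. j k = i}" if "i < r" for i using that by auto
    ultimately show ?thesis by (simp add: wt_def)
  qed
  ultimately show "(\<Sum>i<r. wt ?D j i) \<le> (\<Sum>i<r. s i)" by simp
qed

lemma wt_permute:
  assumes w: "w permutes {..<n}"
  shows "wt A (\<lambda>k\<in>A. w (j k)) i = wt A j (inv_into UNIV w i)"
proof -
  have "w (j k) = i \<longleftrightarrow> j k = inv_into UNIV w i" for k
    using permutes_inv_eq[OF w, of i] by metis
  then show ?thesis unfolding wt_def by (intro arg_cong[of _ _ card]) auto
qed

text \<open>Relabelling the letters by \<open>w\<close> keeps the word column-injective, so the
  permuted content is still dominated by \<open>s\<close>, while by \<open>dominated_shift\<close>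
  it dominates \<open>t\<close>. For \<open>s = t\<close> both relations are equalities, which
  leaves no room for a shift.\<close>

lemma colinj_sorts:
  assumes s: "s \<in> parts n d" and j: "j \<in> colinj n (diag n s)"
    and w: "sorts n (\<lambda>i. delta n i + wt (diag n s) j i) t w"
  shows "dominated n t s" "s = t \<Longrightarrow> w = id"
proof -
  let ?D = "diag n s"
  let ?j = "\<lambda>k\<in>?D. w (j k)" and ?v = "inv_into UNIV w"
  have wp: "w permutes {..<n}" using w by (simp add: sorts_def)
  have v: "?v permutes {..<n}" by (rule permutes_inv[OF wp])
  have j': "?j \<in> colinj n ?D"
    by (rule colinj_permute[OF wp j])
  have eq: "wt ?D ?j i + delta n (?v i) = t i + delta n i" if i: "i < n" for i
  proof -
    have "?v i < n" using permutes_in_image[OF v, of i] i by simp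
    then have "delta n (?v i) + wt ?D j (?v i) = t (w (?v i)) + delta n (w (?v i))"
      using w by (simp add: sorts_def)
    then show ?thesis using permutes_inverses(1)[OF wp] by (simp add: wt_permute[OF wp])
  qed
  have d: "dominated n (wt ?D ?j) s" by (rule colinj_dominated[OF s j'])
  moreover have "dominated n t (wt ?D ?j)" by (rule dominated_shift[OF v eq])
  ultimately show "dominated n t s" unfolding dominated_def by (meson le_trans)
  assume st: "s = t"
  have "?v = id" by (rule dominated_shift_id[OF v eq]) (use d st in auto)
  then show "w = id" using permutes_inverses(1)[OF wp] by (metis eq_id_iff ext)
qed

text \<open>Together the two claims say that the elementary product attached to the columns of
  \<open>s\<close> is a positive multiple of the Schur function of \<open>s\<close> plus a
  combination of Schur functions strictly lower in dominance order.\<close>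

lemma schur_coeff_colinj:
  assumes s: "s \<in> parts n d"
  shows "schur_coeff n (diag n s) (colinj n (diag n s)) t \<noteq> 0 \<Longrightarrow> dominated n t s"
    and "schur_coeff n (diag n s) (colinj n (diag n s)) s > 0"
proof -
  let ?D = "diag n s"
  let ?W = "\<lambda>j t. {w. sorts n (\<lambda>i. delta n i + wt ?D j i) t w}"
  show "dominated n t s" if "schur_coeff n ?D (colinj n ?D) t \<noteq> 0"
  proof (rule ccontr)
    assume "\<not> dominated n t s"
    then have "?W j t = {}" if "j \<in> colinj n ?D" for j using colinj_sorts(1)[OF s that] by blast
    then have "(\<Sum>w\<in>?W j t. sign w) = 0" if "j \<in> colinj n ?D" for j using that by simp
    then have "schur_coeff n ?D (colinj n ?D) t = 0" unfolding schur_coeff_def by (rule sum.neutral[rule_format])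
    then show False using that by simp
  qed
  have nonneg: "0 \<le> (\<Sum>w\<in>?W j s. sign w)" if "j \<in> colinj n ?D" for j
  proof (rule sum_nonneg)
    fix w assume "w \<in> ?W j s"
    then have "w = id" using colinj_sorts(2)[OF s that, of s w] by simp
    then show "0 \<le> sign w" by simp
  qed
  \<comment> \<open>The word that writes into each cell its own row has content \<open>s\<close> and
    is sorted by the identity, so the diagonal coefficient is not 0.\<close>
  let ?j = "restrict fst ?D"
  have j: "?j \<in> colinj n ?D" by (auto simp: colinj_def diag_def)
  have "wt ?D ?j i = s i" if "i < n" for i
  proof -
    have "{k \<in> ?D. ?j k = i} = Pair i ` {..<s i}" using that by (auto simp: diag_def)
    then show ?thesis by (simp add: wt_def card_image inj_on_def)
  qed
  then have "sorts n (\<lambda>i. delta n i + wt ?D ?j i) s id" by (simp add: sorts_def permutes_id)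
  then have "?W ?j s = {id}" using colinj_sorts(2)[OF s j] by auto
  then have "(\<Sum>w\<in>?W ?j s. sign w) = 1" by simp
  then have "0 < (\<Sum>w\<in>?W ?j s. sign w)" by simp
  also have "\<dots> \<le> schur_coeff n ?D (colinj n ?D) s"
    unfolding schur_coeff_def
    by (rule member_le_sum[OF j]) (use nonneg symmetric_words_finite[OF symmetric_words_colinj[OF finite_diag]] in auto)
  finally show "schur_coeff n ?D (colinj n ?D) s > 0" .
qed

text \<open>The sum of all partial sums is the measure for induction along the dominance
  order.\<close>

lemma dominated_sum_less:
  assumes "s \<in> parts n d" "t \<in> parts n d" "dominated n s t" "s \<noteq> t"
  shows "(\<Sum>r\<le>n. \<Sum>i<r. s i) < (\<Sum>r\<le>n. \<Sum>i<r. t i)"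
proof (rule ccontr)
  assume "\<not> ?thesis"
  moreover have le: "(\<Sum>i<r. s i) \<le> (\<Sum>i<r. t i)" if "r \<in> {..n}" for r using assms(3) that by (simp add: dominated_def)
  ultimately have "(\<Sum>r\<le>n. \<Sum>i<r. s i) = (\<Sum>r\<le>n. \<Sum>i<r. t i)" by (meson antisym not_le sum_mono)
  then have "(\<Sum>i<r. s i) = (\<Sum>i<r. t i)" if "r \<in> {..n}" for r
    using sum_mono_inv[of "\<lambda>r. \<Sum>i<r. s i" "{..n}" "\<lambda>r. \<Sum>i<r. t i" r] le that by blast
  then have "dominated n t s" by (simp add: dominated_def)
  then show False using dominated_parts_antisym[OF assms(1-3)] assms(4) by blast
qed

lemma hw_functional_columns_expansion:
  assumes s: "s \<in> parts n d"
  shows "hw_functional n D (\<lambda>x. \<Sum>j\<in>colinj n (diag n s). \<Prod>k\<in>diag n s. x (j k))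
    = (\<Sum>t\<in>parts n d. of_int (schur_coeff n (diag n s) (colinj n (diag n s)) t) * hw_functional n D (schur_fn n t))"
proof -
  have "card (diag n s) = d" using sum_part[OF s] by (simp add: card_diag)
  then show ?thesis
    by (simp only: symmetric_words_expansion[OF symmetric_words_colinj[OF finite_diag]] hw_functional_sum[OF finite_parts])
qed

text \<open>Induction upwards in dominance order. A nonzero value forces \<open>s\<close> to be
  dominated by \<open>t\<close>, hence \<open>t\<close> not to be dominated by \<open>s\<close>, so
  the column product of \<open>s\<close> pairs to 0. In its Schur expansion every \<open>u\<close>
  other than \<open>s\<close> lies strictly below \<open>s\<close>; it differs from \<open>t\<close>
  and pairs to 0 by induction. A positive multiple of the value in question remains and is
  0.\<close>

theorem hw_functional_schur_fn_eq_0: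
  assumes t: "t \<in> parts n d" and s: "s \<in> parts n d" and ne: "s \<noteq> t"
  shows "hw_functional n (diag n t) (schur_fn n s) = 0"
  using s ne
proof (induction "\<Sum>r\<le>n. \<Sum>i<r. s i" arbitrary: s rule: less_induct)
  case less
  let ?L = "hw_functional n (diag n t)"
  let ?k = "schur_coeff n (diag n s) (colinj n (diag n s))"
  show ?case
  proof (rule ccontr)
    assume nz: "?L (schur_fn n s) \<noteq> 0"
    have st: "dominated n s t" by (rule hw_functional_schur_fn_nonzero[OF t less.prems(1) nz])
    have nts: "\<not> dominated n t s" using dominated_parts_antisym[OF less.prems(1) t st] less.prems(2) by blast
    have "?L (\<lambda>x. \<Sum>j\<in>colinj n (diag n s). \<Prod>k\<in>diag n s. x (j k)) = 0"
      using hw_functional_columns[OF t less.prems(1)] nts by auto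
    then have "0 = (\<Sum>u\<in>parts n d. of_int (?k u) * ?L (schur_fn n u))"
      by (simp only: hw_functional_columns_expansion[OF less.prems(1)])
    also have "\<dots> = (\<Sum>u\<in>parts n d. if u = s then of_int (?k s) * ?L (schur_fn n s) else 0)"
    proof (rule sum.cong[OF refl])
      fix u assume u: "u \<in> parts n d"
      show "of_int (?k u) * ?L (schur_fn n u) = (if u = s then of_int (?k s) * ?L (schur_fn n s) else 0)"
      proof (cases "u = s \<or> ?k u = 0")
        case False
        then have us: "dominated n u s" using schur_coeff_colinj(1)[OF less.prems(1)] by blast
        have "u \<noteq> t" using us nts by blast
        then have "?L (schur_fn n u) = 0"
          using less.hyps[OF dominated_sum_less[OF u less.prems(1) us]] u False by blast
        then show ?thesis using False by simp
      qed auto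
    qed
    also have "\<dots> = of_int (?k s) * ?L (schur_fn n s)" using less.prems(1) finite_parts by (simp add: sum.delta)
    finally show False using nz schur_coeff_colinj(2)[OF less.prems(1)] by simp
  qed
qed

text \<open>By orthogonality only the diagonal term of the column expansion remains. Positivity is
  expressed by the integers \<open>q\<close> and \<open>k\<close> because the value itself is a
  complex number.\<close>

theorem hw_functional_schur_fn_self:
  assumes t: "t \<in> parts n d"
  shows "\<exists>q k :: int. 0 < q \<and> 0 < k \<and> of_int k * hw_functional n (diag n t) (schur_fn n t) = of_int q"
proof -
  let ?L = "hw_functional n (diag n t)"
  let ?k = "schur_coeff n (diag n t) (colinj n (diag n t))"
  obtain q :: int where q: "?L (\<lambda>x. \<Sum>j\<in>colinj n (diag n t). \<Prod>k\<in>diag n t. x (j k)) = of_int q" "q > 0"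
    using hw_functional_columns[OF t t] by auto
  have "of_int q = (\<Sum>u\<in>parts n d. of_int (?k u) * ?L (schur_fn n u))"
    unfolding q(1)[symmetric] by (rule hw_functional_columns_expansion[OF t])
  also have "\<dots> = (\<Sum>u\<in>parts n d. if u = t then of_int (?k t) * ?L (schur_fn n t) else 0)"
    by (intro sum.cong refl) (simp add: hw_functional_schur_fn_eq_0[OF t])
  also have "\<dots> = of_int (?k t) * ?L (schur_fn n t)" using t finite_parts by (simp add: sum.delta)
  finally show ?thesis using q(2) schur_coeff_colinj(2)[OF t] by metis
qed

text \<open>Orthogonality isolates the coefficient of \<open>t\<close>. The factor \<open>N\<close>
  accommodates the case in which only a positive multiple of the polynomial is available as a
  combination of signed word sums.\<close>

theorem schur_coeff_nonneg:
  assumes J: "symmetric_words n A J" and t: "t \<in> parts n (card A)"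
    and L: "N * hw_functional n (diag n t) (\<lambda>x. \<Sum>j\<in>J. \<Prod>k\<in>A. x (j k)) = of_int q" "0 \<le> q" and N: "N = of_int N'" "0 < N'"
  shows "0 \<le> schur_coeff n A J t"
proof -
  let ?L = "hw_functional n (diag n t)"
  let ?k = "schur_coeff n A J"
  have "?L (\<lambda>x. \<Sum>j\<in>J. \<Prod>k\<in>A. x (j k)) = (\<Sum>u\<in>parts n (card A). of_int (?k u) * ?L (schur_fn n u))"
    by (simp only: symmetric_words_expansion[OF J] hw_functional_sum[OF finite_parts])
  also have "\<dots> = (\<Sum>u\<in>parts n (card A). if u = t then of_int (?k t) * ?L (schur_fn n t) else 0)"
    by (intro sum.cong refl) (simp add: hw_functional_schur_fn_eq_0[OF t])
  also have "\<dots> = of_int (?k t) * ?L (schur_fn n t)" using t finite_parts by (simp add: sum.delta)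
  finally have 1: "?L (\<lambda>x. \<Sum>j\<in>J. \<Prod>k\<in>A. x (j k)) = of_int (?k t) * ?L (schur_fn n t)" .
  obtain p m :: int where pm: "0 < p" "0 < m" "of_int m * ?L (schur_fn n t) = of_int p"
    using hw_functional_schur_fn_self[OF t] by blast
  have "of_int (m * q) = of_int m * (N * (of_int (?k t) * ?L (schur_fn n t)))" using L(1) 1 by simp
  also have "\<dots> = N * of_int (?k t) * (of_int m * ?L (schur_fn n t))" by (simp only: mult_ac)
  also have "\<dots> = of_int (N' * ?k t * p)" using pm(3) N(1) by simp
  finally have "m * q = N' * ?k t * p" by (simp only: of_int_eq_iff)
  moreover have "0 \<le> m * q" using pm(2) L(2) by simp
  ultimately have "0 \<le> N' * ?k t * p" by simp
  then show ?thesis using pm(1) N(2) by (simp add: zero_le_mult_iff)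
qed

section \<open>Tableaux\<close>

definition cells :: "(nat \<Rightarrow> nat) \<Rightarrow> (nat \<times> nat) set" where
  "cells t = {(i, a). a < t i}"

definition tableaux :: "nat \<Rightarrow> (nat \<Rightarrow> nat) \<Rightarrow> (nat \<times> nat \<Rightarrow> nat) set" where
  "tableaux n t = {T \<in> cells t \<rightarrow>\<^sub>E {1..n}.
     (\<forall>i a a'. a < a' \<and> a' < t i \<longrightarrow> T (i, a) \<le> T (i, a')) \<and>
     (\<forall>i i' a. i < i' \<and> a < t i \<and> a < t i' \<longrightarrow> T (i, a) < T (i', a))}"

lemma tabsD:
  assumes "T \<in> tableaux n t"
  shows "a < t i \<Longrightarrow> 1 \<le> T (i, a)" "a < t i \<Longrightarrow> T (i, a) \<le> n"
    "a \<le> a' \<Longrightarrow> a' < t i \<Longrightarrow> T (i, a) \<le> T (i, a')"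
    "i < i' \<Longrightarrow> a < t i \<Longrightarrow> a < t i' \<Longrightarrow> T (i, a) < T (i', a)"
    "\<not> a < t i \<Longrightarrow> T (i, a) = undefined"
proof -
  have T: "T \<in> cells t \<rightarrow>\<^sub>E {1..n}" using assms by (simp add: tableaux_def)
  show "1 \<le> T (i, a)" "T (i, a) \<le> n" if "a < t i"
    using PiE_mem[OF T, of "(i, a)"] that by (auto simp: cells_def)
  show "T (i, a) \<le> T (i, a')" if "a \<le> a'" "a' < t i"
    using assms that by (cases "a = a'") (auto simp: tableaux_def)
  show "T (i, a) < T (i', a)" if "i < i'" "a < t i" "a < t i'"
    using assms that by (auto simp: tableaux_def)
  show "T (i, a) = undefined" if "\<not> a < t i"
    using PiE_arb[OF T, of "(i, a)"] that by (simp add: cells_def)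
qed

lemma cells_diag: "t \<in> parts n d \<Longrightarrow> cells t = diag n t"
  using parts_zero[of t n d] by (auto simp: cells_def diag_def) (metis gr_implies_not0 not_le)

text \<open>Columns increase strictly from a value of at least 1. For row \<open>n\<close> of a
  tableau with entries up to \<open>n + 1\<close>, this forces all entries of the row to be
  \<open>n + 1\<close>.\<close>

lemma tableaux_ge:
  assumes t: "t \<in> parts n d" and T: "T \<in> tableaux m t" and a: "a < t i"
  shows "Suc i \<le> T (i, a)"
  using a
proof (induction i)
  case 0
  then show ?case using tabsD(1)[OF T] by simp
next
  case (Suc i)
  have "a < t i" using Suc.prems parts_antimono[OF t, of i "Suc i"] by simp
  then show ?case using Suc.IH tabsD(4)[OF T, of i "Suc i" a] Suc.prems by simp
qed

lemma downclosed_eq_lessThan: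
  fixes S :: "nat set"
  assumes "finite S" "\<And>a b. a \<in> S \<Longrightarrow> b < a \<Longrightarrow> b \<in> S"
  shows "S = {..<card S}"
proof -
  define k where "k = (LEAST k. k \<notin> S)"
  have "\<exists>k. k \<notin> S" using assms(1) ex_new_if_finite infinite_UNIV_nat by blast
  then have k: "k \<notin> S" unfolding k_def by (rule LeastI_ex)
  have "b \<in> S" if "b < k" for b using not_less_Least[of b "\<lambda>k. k \<notin> S"] that by (auto simp: k_def)
  moreover have "a < k" if "a \<in> S" for a
    using assms(2)[OF that, of k] k that by (metis linorder_neqE_nat)
  ultimately have "S = {..<k}" by auto
  then show ?thesis by simp
qed

text \<open>Rows increase weakly, so the entries up to \<open>n\<close> fill an initial segment of
  each row; \<open>small\<close> is the shape of the subtableau they form.\<close>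

definition small :: "nat \<Rightarrow> (nat \<Rightarrow> nat) \<Rightarrow> (nat \<times> nat \<Rightarrow> nat) \<Rightarrow> nat \<Rightarrow> nat" where
  "small n t T i = card {a. a < t i \<and> T (i, a) \<le> n}"

lemma small_iff:
  assumes T: "T \<in> tableaux m t"
  shows "a < t i \<and> T (i, a) \<le> n \<longleftrightarrow> a < small n t T i"
proof -
  let ?S = "{a. a < t i \<and> T (i, a) \<le> n}"
  have "?S = {..<card ?S}"
  proof (rule downclosed_eq_lessThan)
    fix a b assume "a \<in> ?S" "b < a"
    then show "b \<in> ?S" using tabsD(3)[OF T, of b a i] by auto
  qed auto
  then show ?thesis unfolding small_def by blast
qed

text \<open>An interlacing sequence, as an element of a dependent product, is
  \<open>undefined\<close> beyond its index set; padding with zeros makes it a member of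
  \<open>parts\<close>.\<close>

definition trunc :: "nat \<Rightarrow> (nat \<Rightarrow> nat) \<Rightarrow> nat \<Rightarrow> nat" where
  "trunc n m i = (if i < n then m i else 0)"

lemma trunc_parts:
  assumes t: "t \<in> parts (Suc n) d" and m: "m \<in> PiE {..<n} (\<lambda>i. {t (Suc i)..t i})"
  shows "trunc n m \<in> parts n (\<Sum>i<n. m i)"
  unfolding parts_def
proof (intro CollectI conjI allI impI)
  fix i show "trunc n m (Suc i) \<le> trunc n m i"
    using PiE_mem[OF m, of i] PiE_mem[OF m, of "Suc i"] by (auto simp: trunc_def)
qed (auto simp: trunc_def)

lemma schur_fn_cong: "(\<And>i. i < n \<Longrightarrow> s i = t i) \<Longrightarrow> schur_fn n s x = schur_fn n t x"
proof (cases n)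
  case (Suc k)
  assume eq: "\<And>i. i < n \<Longrightarrow> s i = t i"
  have "PiE {..<k} (\<lambda>i. {s (Suc i)..s i}) = PiE {..<k} (\<lambda>i. {t (Suc i)..t i})"
    using eq Suc by (intro PiE_cong) auto
  moreover have "(\<Sum>i<Suc k. s i) = (\<Sum>i<Suc k. t i)" using eq Suc by (intro sum.cong) auto
  ultimately show ?thesis unfolding Suc schur_fn.simps by simp
qed simp

lemma tableaux_0: "t \<in> parts 0 d \<Longrightarrow> tableaux 0 t = {\<lambda>_. undefined} \<and> cells t = {}"
proof -
  assume t: "t \<in> parts 0 d"
  then have "t i = 0" for i using parts_zero[OF t] by simp
  then show ?thesis by (auto simp: tableaux_def cells_def)
qed

lemma finite_tableaux: "t \<in> parts n d \<Longrightarrow> finite (tableaux m t)"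
  by (rule finite_subset[of _ "cells t \<rightarrow>\<^sub>E {1..m}"])
    (auto simp: tableaux_def cells_diag finite_diag intro: finite_PiE)

text \<open>Deleting the entries \<open>n + 1\<close> leaves a tableau whose shape interlaces with
  \<open>t\<close>, and every tableau of an interlacing shape arises once. The shift
  \<open>T c - 1\<close> turns entries, counted from 1, into variables, counted from 0.\<close>

theorem sum_tableaux_eq_schur_fn:
  fixes x :: "nat \<Rightarrow> 'a::comm_ring_1"
  assumes "t \<in> parts n d"
  shows "(\<Sum>T\<in>tableaux n t. \<Prod>c\<in>cells t. x (T c - 1)) = schur_fn n t x"
  using assms
proof (induction n arbitrary: t d)
  case 0
  then show ?case using tableaux_0[of t d] by simp
next
  case (Suc n)
  note t = Suc.prems
  let ?M = "PiE {..<n} (\<lambda>i. {t (Suc i)..t i})"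
  let ?w = "\<lambda>m T. (\<Prod>c\<in>cells (trunc n m). x (T c - 1)) * x n ^ ((\<Sum>i<Suc n. t i) - (\<Sum>i<n. m i))"
  let ?glue = "\<lambda>m T. \<lambda>c\<in>cells t. if c \<in> cells (trunc n m) then T c else Suc n"
  let ?sm = "\<lambda>T. restrict (small n t T) {..<n}"
  have mt: "t (Suc i) \<le> m i" "m i \<le> t i" if "m \<in> ?M" "i < n" for m i
    using PiE_mem[OF that(1), of i] that(2) by auto
  have sub: "cells (trunc n m) \<subseteq> cells t" if "m \<in> ?M" for m
    using mt(2)[OF that] by (fastforce simp: cells_def trunc_def split: if_splits)
  have t0: "i \<le> n" if "a < t i" for a i using parts_zero[OF t, of i] that by (cases "i \<le> n") auto
  have big: "T (i, a) = Suc n" if T: "T \<in> tableaux (Suc n) t" and a: "a < t i" "\<not> a < trunc n (?sm T) i" for T i a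
  proof (cases "i < n")
    case True
    then have "\<not> a < small n t T i" using a by (simp add: trunc_def)
    then have "\<not> T (i, a) \<le> n" using small_iff[OF T, of a i n] a by blast
    then show ?thesis using tabsD(2)[OF T a(1)] by simp
  next
    case False
    then have "i = n" using t0[OF a(1)] by simp
    then show ?thesis using tableaux_ge[OF t T a(1)] tabsD(2)[OF T a(1)] by simp
  qed
  have smM: "?sm T \<in> ?M" if T: "T \<in> tableaux (Suc n) t" for T
  proof
    fix i assume "i \<in> {..<n}"
    then have i: "i < n" by simp
    \<comment> \<open>If row \<open>i\<close> had too few entries up to \<open>n\<close>, its next
      cell would still have a cell below it. The entry there is at most \<open>n + 1\<close>, so the
      entry above is at most \<open>n\<close>, a contradiction.\<close>
    have "t (Suc i) \<le> small n t T i"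
    proof (rule ccontr)
      assume neg: "\<not> t (Suc i) \<le> small n t T i"
      let ?a = "small n t T i"
      have a: "?a < t (Suc i)" "?a < t i" using neg parts_antimono[OF t, of i "Suc i"] by auto
      then have "T (i, ?a) < T (Suc i, ?a)" by (intro tabsD(4)[OF T]) auto
      moreover have "T (Suc i, ?a) \<le> Suc n" by (rule tabsD(2)[OF T a(1)])
      ultimately have "T (i, ?a) \<le> n" by simp
      then show False using small_iff[OF T, of ?a i n] a by blast
    qed
    moreover have "small n t T i \<le> t i" unfolding small_def
      by (rule order_trans[OF card_mono[of "{..<t i}"]]) auto
    ultimately show "?sm T i \<in> {t (Suc i)..t i}" using i by simp
  qed auto
  have cellsm: "c \<in> cells (trunc n (?sm T)) \<Longrightarrow> T c \<le> n" if T: "T \<in> tableaux (Suc n) t" for T c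
    using small_iff[OF T, of "snd c" "fst c" n] by (cases c) (auto simp: cells_def trunc_def split: if_splits)
  have fwd: "restrict T (cells (trunc n (?sm T))) \<in> tableaux n (trunc n (?sm T))" if T: "T \<in> tableaux (Suc n) t" for T
  proof -
    note s = sub[OF smM[OF T]]
    have lt: "a < trunc n (?sm T) i \<Longrightarrow> a < t i" for a i using s by (auto simp: cells_def)
    show ?thesis
      unfolding tableaux_def
    proof (intro CollectI conjI allI impI)
      show "restrict T (cells (trunc n (?sm T))) \<in> cells (trunc n (?sm T)) \<rightarrow>\<^sub>E {1..n}"
      proof (rule restrict_PiE_iff[THEN iffD2, rule_format])
        fix c assume c: "c \<in> cells (trunc n (?sm T))"
        have "1 \<le> T c" using c s tabsD(1)[OF T, of "snd c" "fst c"] by (cases c) (auto simp: cells_def)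
        then show "T c \<in> {1..n}" using cellsm[OF T c] by simp
      qed
    next
      fix i a a' assume "a < a' \<and> a' < trunc n (?sm T) i"
      then show "restrict T (cells (trunc n (?sm T))) (i, a) \<le> restrict T (cells (trunc n (?sm T))) (i, a')"
        using tabsD(3)[OF T, of a a' i] lt[of a' i] by (auto simp: cells_def)
    next
      fix i i' a assume "i < i' \<and> a < trunc n (?sm T) i \<and> a < trunc n (?sm T) i'"
      then show "restrict T (cells (trunc n (?sm T))) (i, a) < restrict T (cells (trunc n (?sm T))) (i', a)"
        using tabsD(4)[OF T, of i i' a] lt[of a i] lt[of a i'] by (auto simp: cells_def)
    qed
  qed
  have gcell: "?glue m T (i, a) = (if a < trunc n m i then T (i, a) else Suc n)" if "a < t i" for m T i a
    using that by (simp add: cells_def)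
  have bwd: "?glue m T \<in> tableaux (Suc n) t" if m: "m \<in> ?M" and T: "T \<in> tableaux n (trunc n m)" for m T
    unfolding tableaux_def
  proof (intro CollectI conjI allI impI)
    show "?glue m T \<in> cells t \<rightarrow>\<^sub>E {1..Suc n}"
    proof (rule restrict_PiE_iff[THEN iffD2, rule_format])
      fix c assume "c \<in> cells t"
      show "(if c \<in> cells (trunc n m) then T c else Suc n) \<in> {1..Suc n}"
        using tabsD(1,2)[OF T, of "snd c" "fst c"] by (cases c) (auto simp: cells_def)
    qed
  next
    fix i a a' assume a: "a < a' \<and> a' < t i"
    then have a': "a < t i" "a' < t i" "a \<le> a'" by auto
    show "?glue m T (i, a) \<le> ?glue m T (i, a')"
      unfolding gcell[OF a'(1)] gcell[OF a'(2)]
      using a' tabsD(2)[OF T, of a i] tabsD(3)[OF T a'(3), of i] by auto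
  next
    fix i i' a assume a: "i < i' \<and> a < t i \<and> a < t i'"
    then have a': "a < t i" "a < t i'" by auto
    have i: "i < n" using t0[OF a'(2)] a by simp
    \<comment> \<open>A cell with another cell below it lies in the inner shape, since
      \<open>t (Suc i) \<le> m i\<close>; so it is not filled with \<open>n + 1\<close>, and
      strictness in the column is preserved.\<close>
    have "t i' \<le> t (Suc i)" using a by (intro parts_antimono[OF t]) simp
    then have "a < m i" using a' mt(1)[OF m i] by simp
    then have ac: "a < trunc n m i" using i by (simp add: trunc_def)
    show "?glue m T (i, a) < ?glue m T (i', a)"
      unfolding gcell[OF a'(1)] gcell[OF a'(2)]
      using ac a tabsD(2)[OF T ac] tabsD(4)[OF T, of i i' a] by auto
  qed
  have "(\<Sum>T\<in>tableaux (Suc n) t. \<Prod>c\<in>cells t. x (T c - 1)) = (\<Sum>(m, T)\<in>Sigma ?M (\<lambda>m. tableaux n (trunc n m)). ?w m T)"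
  proof (rule sum.reindex_bij_witness[where i = "\<lambda>(m, T). ?glue m T"
        and j = "\<lambda>T. (?sm T, restrict T (cells (trunc n (?sm T))))"])
    fix T assume T: "T \<in> tableaux (Suc n) t"
    show "(case (?sm T, restrict T (cells (trunc n (?sm T)))) of (m, T) \<Rightarrow> ?glue m T) = T"
    proof
      fix c :: "nat \<times> nat"
      obtain i a where c: "c = (i, a)" by (cases c)
      show "(case (?sm T, restrict T (cells (trunc n (?sm T)))) of (m, T) \<Rightarrow> ?glue m T) c = T c"
        unfolding c prod.case
      proof (cases "a < t i")
        case True
        show "?glue (?sm T) (restrict T (cells (trunc n (?sm T)))) (i, a) = T (i, a)"
          unfolding gcell[OF True] using big[OF T True] by (auto simp: cells_def)
      next
        case False
        then show "?glue (?sm T) (restrict T (cells (trunc n (?sm T)))) (i, a) = T (i, a)"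
          using tabsD(5)[OF T False] by (simp add: cells_def)
      qed
    qed
    show "(?sm T, restrict T (cells (trunc n (?sm T)))) \<in> Sigma ?M (\<lambda>m. tableaux n (trunc n m))"
      using smM[OF T] fwd[OF T] by blast
    note s = sub[OF smM[OF T]]
    have fin: "finite (cells t)" by (simp add: cells_diag[OF t] finite_diag)
    have "(\<Prod>c\<in>cells t. x (T c - 1)) = (\<Prod>c\<in>cells (trunc n (?sm T)). x (T c - 1)) * (\<Prod>c\<in>cells t - cells (trunc n (?sm T)). x (T c - 1))"
      using prod.subset_diff[OF s fin] by (simp add: mult.commute)
    also have "(\<Prod>c\<in>cells t - cells (trunc n (?sm T)). x (T c - 1)) = x n ^ card (cells t - cells (trunc n (?sm T)))"
      using big[OF T] by (subst prod_constant[symmetric]) (intro prod.cong refl, auto simp: cells_def)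
    also have "card (cells t - cells (trunc n (?sm T))) = card (cells t) - card (cells (trunc n (?sm T)))"
      using s fin by (intro card_Diff_subset) (auto intro: finite_subset)
    also have "card (cells t) = (\<Sum>i<Suc n. t i)" by (simp add: cells_diag[OF t] card_diag)
    also have "card (cells (trunc n (?sm T))) = (\<Sum>i<n. ?sm T i)"
      by (simp add: cells_diag[OF trunc_parts[OF t smM[OF T]]] card_diag trunc_def)
    finally show "(case (?sm T, restrict T (cells (trunc n (?sm T)))) of (m, T) \<Rightarrow> ?w m T) = (\<Prod>c\<in>cells t. x (T c - 1))"
      by (simp only: prod.case restrict_apply' cong: prod.cong)
  next
    fix mT assume "mT \<in> Sigma ?M (\<lambda>m. tableaux n (trunc n m))"
    then obtain m T where mT: "mT = (m, T)" and m: "m \<in> ?M" and T: "T \<in> tableaux n (trunc n m)" by auto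
    have sm: "?sm (?glue m T) = m"
    proof (rule PiE_ext[OF smM[OF bwd[OF m T]] m])
      fix i assume i: "i \<in> {..<n}"
      have "{a. a < t i \<and> ?glue m T (i, a) \<le> n} = {..<m i}"
      proof (intro equalityI subsetI)
        fix a assume "a \<in> {a. a < t i \<and> ?glue m T (i, a) \<le> n}"
        then have a: "a < t i" "?glue m T (i, a) \<le> n" by auto
        then show "a \<in> {..<m i}" unfolding gcell[OF a(1)] using i by (auto simp: trunc_def split: if_splits)
      next
        fix a assume a: "a \<in> {..<m i}"
        then have ac: "a < trunc n m i" and at: "a < t i" using i mt(2)[OF m, of i] by (auto simp: trunc_def)
        have "?glue m T (i, a) \<le> n" unfolding gcell[OF at] using ac tabsD(2)[OF T ac] by simp
        then show "a \<in> {a. a < t i \<and> ?glue m T (i, a) \<le> n}" using at by blast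
      qed
      then show "?sm (?glue m T) i = m i" using i by (simp only: small_def restrict_apply' card_lessThan)
    qed
    have "restrict (?glue m T) (cells (trunc n m)) = T"
    proof
      fix c :: "nat \<times> nat"
      obtain i a where c: "c = (i, a)" by (cases c)
      show "restrict (?glue m T) (cells (trunc n m)) c = T c"
      proof (cases "c \<in> cells (trunc n m)")
        case True
        then have "c \<in> cells t" using sub[OF m] by blast
        then show ?thesis using True by simp
      next
        case False
        then show ?thesis using tabsD(5)[OF T, of a i] by (simp add: c cells_def)
      qed
    qed
    then show "(?sm (case mT of (m, T) \<Rightarrow> ?glue m T), restrict (case mT of (m, T) \<Rightarrow> ?glue m T) (cells (trunc n (?sm (case mT of (m, T) \<Rightarrow> ?glue m T))))) = mT"
      unfolding mT prod.case sm by simp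
    show "(case mT of (m, T) \<Rightarrow> ?glue m T) \<in> tableaux (Suc n) t"
      unfolding mT prod.case by (rule bwd[OF m T])
  qed
  also have "\<dots> = (\<Sum>m\<in>?M. \<Sum>T\<in>tableaux n (trunc n m). ?w m T)"
    using finite_tableaux[OF trunc_parts[OF t]] by (subst sum.Sigma) (auto intro: finite_PiE)
  also have "\<dots> = (\<Sum>m\<in>?M. schur_fn n m x * x n ^ ((\<Sum>i<Suc n. t i) - (\<Sum>i<n. m i)))"
  proof (rule sum.cong[OF refl])
    fix m assume m: "m \<in> ?M"
    have "(\<Sum>T\<in>tableaux n (trunc n m). \<Prod>c\<in>cells (trunc n m). x (T c - 1)) = schur_fn n m x"
      unfolding Suc.IH[OF trunc_parts[OF t m]] by (rule schur_fn_cong) (simp add: trunc_def)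
    then show "(\<Sum>T\<in>tableaux n (trunc n m). ?w m T) = schur_fn n m x * x n ^ ((\<Sum>i<Suc n. t i) - (\<Sum>i<n. m i))"
      by (simp only: sum_distrib_right[symmetric])
  qed
  finally show ?case by simp
qed

definition row_len :: "nat list \<Rightarrow> nat \<Rightarrow> nat" where
  "row_len \<mu> i = (if i < length \<mu> then \<mu> ! i else 0)"

lemma row_len_parts:
  assumes \<mu>: "is_partition \<mu>" and n: "length \<mu> \<le> n"
  shows "row_len \<mu> \<in> parts n (sum_list \<mu>)"
  unfolding parts_def
proof (intro CollectI conjI allI impI)
  fix i
  have "\<mu> ! Suc i \<le> \<mu> ! i" if "Suc i < length \<mu>"
    using \<mu> that sorted_wrt_nth_less[of "(\<ge>)" \<mu> i "Suc i"] by (simp add: is_partition_def)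
  then show "row_len \<mu> (Suc i) \<le> row_len \<mu> i" by (auto simp: row_len_def)
next
  have "(\<Sum>i<n. row_len \<mu> i) = (\<Sum>i<length \<mu>. \<mu> ! i)"
    using n by (intro sum.mono_neutral_cong_right) (auto simp: row_len_def)
  then show "(\<Sum>i<n. row_len \<mu> i) = sum_list \<mu>" by (simp add: sum_list_sum_nth atLeast0LessThan)
qed (use n in \<open>auto simp: row_len_def\<close>)

lemma schur_poly_eq_schur_fn:
  assumes \<mu>: "is_partition \<mu>" and n: "length \<mu> \<le> n"
  shows "schur_poly n \<mu> = schur_fn n (row_len \<mu>) (\<lambda>i. X (Suc i))"
proof -
  have c: "young_diagram \<mu> = cells (row_len \<mu>)" by (auto simp: young_diagram_def cells_def row_len_def split: if_splits)
  have m: "(i, a) \<in> young_diagram \<mu> \<longleftrightarrow> a < row_len \<mu> i" for i a by (simp add: c cells_def)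
  have "ssyt n \<mu> = tableaux n (row_len \<mu>)"
    unfolding ssyt_def tableaux_def c[symmetric] m by (auto intro: less_trans)
  then have "schur_poly n \<mu> = (\<Sum>T\<in>tableaux n (row_len \<mu>). \<Prod>c\<in>cells (row_len \<mu>). X (Suc (T c - 1)))"
    unfolding schur_poly_def c
  proof (intro sum.cong prod.cong refl arg_cong[of _ _ X])
    fix T c assume "T \<in> tableaux n (row_len \<mu>)" "c \<in> cells (row_len \<mu>)"
    then have "1 \<le> T c" using tabsD(1)[of T n "row_len \<mu>" "snd c" "fst c"] by (cases c) (auto simp: cells_def)
    then show "T c = Suc (T c - 1)" by simp
  qed
  then show ?thesis using sum_tableaux_eq_schur_fn[OF row_len_parts[OF assms], of "\<lambda>i. X (Suc i)"] by simp
qed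

text \<open>Distinctness of the variables makes the Vandermonde determinant nonzero, so that it can
  be cancelled.\<close>

lemma inj_X: "inj_on (\<lambda>i. X (Suc i)) S"
proof (rule inj_onI)
  fix i k assume "X (Suc i) = X (Suc k)"
  then have "Poly_Mapping.lookup (X (Suc i)) (Poly_Mapping.single (Suc i) 1) = Poly_Mapping.lookup (X (Suc k)) (Poly_Mapping.single (Suc i) 1)"
    by simp
  then have "Poly_Mapping.single (Suc i) (1::nat) = Poly_Mapping.single (Suc k) 1"
    by (auto simp: X_def lookup_single when_def split: if_splits)
  then have "Poly_Mapping.lookup (Poly_Mapping.single (Suc i) (1::nat)) (Suc i) = Poly_Mapping.lookup (Poly_Mapping.single (Suc k) 1) (Suc i)"
    by simp
  then show "i = k" by (auto simp: lookup_single when_def split: if_splits)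
qed

text \<open>As partitions are lists without zeros, the length of the list is recovered as the first
  index where the padded function vanishes.\<close>

lemma row_len_bij:
  "bij_betw row_len {\<mu>. is_partition \<mu> \<and> length \<mu> \<le> n \<and> sum_list \<mu> = d} (parts n d)"
  unfolding bij_betw_def
proof (intro conjI inj_onI equalityI subsetI)
  fix \<mu> \<nu> assume \<mu>: "\<mu> \<in> {\<mu>. is_partition \<mu> \<and> length \<mu> \<le> n \<and> sum_list \<mu> = d}"
    and \<nu>: "\<nu> \<in> {\<mu>. is_partition \<mu> \<and> length \<mu> \<le> n \<and> sum_list \<mu> = d}" and eq: "row_len \<mu> = row_len \<nu>"
  have "i < length \<mu> \<longleftrightarrow> row_len \<mu> i \<noteq> 0" if "is_partition \<mu>" for i \<mu>
  proof -
    have "\<mu> ! i \<noteq> 0" if "i < length \<mu>"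
      using \<open>is_partition \<mu>\<close> nth_mem[OF that] by (metis is_partition_def)
    then show ?thesis by (simp add: row_len_def)
  qed
  then have "i < length \<mu> \<longleftrightarrow> i < length \<nu>" for i using \<mu> \<nu> eq by auto
  then have len: "length \<mu> = length \<nu>" by (metis linorder_neqE_nat less_irrefl)
  moreover have "\<mu> ! i = \<nu> ! i" if "i < length \<mu>" for i
    using fun_cong[OF eq, of i] that len by (simp add: row_len_def)
  ultimately show "\<mu> = \<nu>" by (rule nth_equalityI)
next
  fix t assume "t \<in> row_len ` {\<mu>. is_partition \<mu> \<and> length \<mu> \<le> n \<and> sum_list \<mu> = d}"
  then show "t \<in> parts n d" using row_len_parts by auto
next
  fix t assume t: "t \<in> parts n d"
  define k where "k = (LEAST k. t k = 0)"
  have tk: "t k = 0" unfolding k_def by (rule LeastI[of _ n]) (simp add: parts_zero[OF t])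
  have kn: "k \<le> n" unfolding k_def by (rule Least_le) (simp add: parts_zero[OF t])
  have pos: "t i \<noteq> 0" if "i < k" for i using not_less_Least[of i "\<lambda>k. t k = 0"] that by (simp add: k_def)
  have zero: "t i = 0" if "k \<le> i" for i using parts_antimono[OF t that] tk by simp
  let ?\<mu> = "map t [0..<k]"
  have "0 \<notin> set ?\<mu>" 
  proof
    assume "0 \<in> set ?\<mu>"
    then obtain i where "i < k" "t i = 0" by auto
    then show False using pos by blast
  qed
  then have p: "is_partition ?\<mu>"
    unfolding is_partition_def using parts_antimono[OF t] by (simp add: sorted_wrt_iff_nth_less)
  have r: "row_len ?\<mu> = t" using zero by (auto simp: row_len_def fun_eq_iff)
  have "sum_list ?\<mu> = d" using sum_part[OF row_len_parts[OF p, of n]] kn sum_part[OF t] r by simp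
  then have "?\<mu> \<in> {\<mu>. is_partition \<mu> \<and> length \<mu> \<le> n \<and> sum_list \<mu> = d}" using p kn by simp
  then show "t \<in> row_len ` {\<mu>. is_partition \<mu> \<and> length \<mu> \<le> n \<and> sum_list \<mu> = d}" using r by (metis imageI)
qed

theorem schur_positiveI:
  assumes J: "symmetric_words n A J" and nonneg: "\<And>t. t \<in> parts n (card A) \<Longrightarrow> 0 \<le> schur_coeff n A J t"
  shows "schur_positive n (\<Sum>j\<in>J. \<Prod>k\<in>A. X (Suc (j k)))"
proof -
  let ?P = "{\<mu>. is_partition \<mu> \<and> length \<mu> \<le> n \<and> sum_list \<mu> = card A}"
  \<comment> \<open>Partitions of another size or with more than \<open>n\<close> rows receive the
    coefficient 0, which makes the support finite.\<close>
  define \<kappa> where "\<kappa> \<mu> = (if \<mu> \<in> ?P then nat (schur_coeff n A J (row_len \<mu>)) else 0)" for \<mu>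
  have fin: "finite ?P" using bij_betw_finite[OF row_len_bij[of n "card A"]] finite_parts by blast
  have sub: "{\<mu>. is_partition \<mu> \<and> \<kappa> \<mu> \<noteq> 0} \<subseteq> ?P" by (auto simp: \<kappa>_def split: if_splits)
  have "(\<Sum>j\<in>J. \<Prod>k\<in>A. X (Suc (j k)))
    = (\<Sum>t\<in>parts n (card A). of_int (schur_coeff n A J t) * schur_fn n t (\<lambda>i. X (Suc i)))"
    by (rule symmetric_words_expansion_idom[OF J inj_X])
  also have "\<dots> = (\<Sum>\<mu>\<in>?P. of_int (schur_coeff n A J (row_len \<mu>)) * schur_fn n (row_len \<mu>) (\<lambda>i. X (Suc i)))"
    by (rule sum.reindex_bij_betw[OF row_len_bij, symmetric])
  also have "\<dots> = (\<Sum>\<mu>\<in>?P. of_nat (\<kappa> \<mu>) * schur_poly n \<mu>)"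
  proof (rule sum.cong[OF refl])
    fix \<mu> assume \<mu>: "\<mu> \<in> ?P"
    then have "row_len \<mu> \<in> parts n (card A)" using row_len_parts[of \<mu> n] by auto
    then have "of_nat (\<kappa> \<mu>) = (of_int (schur_coeff n A J (row_len \<mu>)) :: mpolynomial)"
      using \<mu> nonneg by (simp add: \<kappa>_def)
    then show "of_int (schur_coeff n A J (row_len \<mu>)) * schur_fn n (row_len \<mu>) (\<lambda>i. X (Suc i)) = of_nat (\<kappa> \<mu>) * schur_poly n \<mu>"
      using \<mu> schur_poly_eq_schur_fn[of \<mu> n] by simp
  qed
  also have "\<dots> = (\<Sum>\<mu> | is_partition \<mu> \<and> \<kappa> \<mu> \<noteq> 0. of_nat (\<kappa> \<mu>) * schur_poly n \<mu>)"
    by (rule sum.mono_neutral_right[OF fin sub]) auto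
  finally show ?thesis
    unfolding schur_positive_def using finite_subset[OF sub fin] by (intro exI[of _ \<kappa>] conjI)
qed

section \<open>Products over subsets\<close>

definition layers :: "nat \<Rightarrow> nat set \<Rightarrow> nat set set" where
  "layers n Z = {S. S \<subseteq> {..<n} \<and> card S \<in> Z}"

lemma finite_layers: "finite (layers n Z)"
  by (rule finite_subset[of _ "Pow {..<n}"]) (auto simp: layers_def)

lemma layers_finite_mem: "S \<in> layers n Z \<Longrightarrow> finite S"
  by (auto simp: layers_def intro: finite_subset)

definition slots :: "nat \<Rightarrow> nat set \<Rightarrow> (nat set \<times> nat) set" where
  "slots n Z = Sigma (layers n Z) (\<lambda>S. S)"

lemma finite_slots: "finite (slots n Z)"
  unfolding slots_def using finite_layers layers_finite_mem by blast

text \<open>The group acts on the slots and respects the blocks. Exchanging two equal blocks of size \<open>k\<close>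
  has sign \<open>(-1)^k\<close> on the slots; recording the permutation of the even blocks separately makes
  \<open>block_sign\<close> take the value \<open>-1\<close> on every such exchange.\<close>

definition block_group :: "nat \<Rightarrow> nat set \<Rightarrow> ((nat set \<Rightarrow> nat set) \<times> (nat set \<times> nat \<Rightarrow> nat set \<times> nat)) set" where
  "block_group n Z = {(\<rho>, g). \<rho> permutes {S \<in> layers n Z. even (card S)} \<and> g permutes slots n Z \<and>
     (\<forall>S\<in>layers n Z. \<forall>i\<in>S. card (fst (g (S, i))) = card S \<and>
        (even (card S) \<longrightarrow> fst (g (S, i)) = \<rho> S) \<and> (\<forall>i'\<in>S. fst (g (S, i)) = fst (g (S, i'))))}"

definition block_sign :: "(nat set \<Rightarrow> nat set) \<times> (nat set \<times> nat \<Rightarrow> nat set \<times> nat) \<Rightarrow> int" where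
  "block_sign h = sign (fst h) * sign (snd h)"

lemma block_groupD:
  assumes g: "(\<rho>, g) \<in> block_group n Z" and S: "S \<in> layers n Z" "i \<in> S"
  shows "card (fst (g (S, i))) = card S" "even (card S) \<Longrightarrow> fst (g (S, i)) = \<rho> S"
    "i' \<in> S \<Longrightarrow> fst (g (S, i)) = fst (g (S, i'))"
proof -
  have *: "card (fst (g (S, i))) = card S \<and>
        (even (card S) \<longrightarrow> fst (g (S, i)) = \<rho> S) \<and> (\<forall>i'\<in>S. fst (g (S, i)) = fst (g (S, i')))"
    using g S unfolding block_group_def mem_Collect_eq prod.case by (elim conjE) (rule bspec, rule bspec)
  show "card (fst (g (S, i))) = card S" using * by (rule conjunct1)
  show "fst (g (S, i)) = \<rho> S" if "even (card S)" using * that by blast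
  show "fst (g (S, i)) = fst (g (S, i'))" if "i' \<in> S" using * that by blast
qed

lemma block_groupI:
  assumes "\<rho> permutes {S \<in> layers n Z. even (card S)}" "g permutes slots n Z"
    and "\<And>S i. S \<in> layers n Z \<Longrightarrow> i \<in> S \<Longrightarrow> card (fst (g (S, i))) = card S \<and>
        (even (card S) \<longrightarrow> fst (g (S, i)) = \<rho> S) \<and> (\<forall>i'\<in>S. fst (g (S, i)) = fst (g (S, i')))"
  shows "(\<rho>, g) \<in> block_group n Z"
  unfolding block_group_def mem_Collect_eq prod.case using assms by (intro conjI ballI) blast+

lemma block_group_compose:
  assumes g: "(\<rho>, g) \<in> block_group n Z" and h: "(\<sigma>, h) \<in> block_group n Z"
  shows "(\<rho> \<circ> \<sigma>, g \<circ> h) \<in> block_group n Z"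
proof -
  have gp: "g permutes slots n Z" and rp: "\<rho> permutes {S \<in> layers n Z. even (card S)}"
    and hp: "h permutes slots n Z" and sp: "\<sigma> permutes {S \<in> layers n Z. even (card S)}"
    using g h unfolding block_group_def by blast+
  note G = block_groupD[OF g] and H = block_groupD[OF h]
  have "card (fst ((g \<circ> h) (S, i))) = card S \<and> (even (card S) \<longrightarrow> fst ((g \<circ> h) (S, i)) = (\<rho> \<circ> \<sigma>) S) \<and>
      (\<forall>i'\<in>S. fst ((g \<circ> h) (S, i)) = fst ((g \<circ> h) (S, i')))" if S: "S \<in> layers n Z" "i \<in> S" for S i
  proof -
    obtain S1 i1 where h1: "h (S, i) = (S1, i1)" by (cases "h (S, i)")
    have "(S, i) \<in> slots n Z" using S by (simp add: slots_def)
    then have "h (S, i) \<in> slots n Z" using permutes_in_image[OF hp] by simp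
    then have S1: "S1 \<in> layers n Z" "i1 \<in> S1" by (auto simp: slots_def h1)
    have c: "card S1 = card S" using H(1)[OF S] h1 by simp
    have e: "S1 = \<sigma> S" if "even (card S)" using H(2)[OF S that] h1 by simp
    have "fst (g (S1, i1)) = fst (g (h (S, i')))" if i': "i' \<in> S" for i'
    proof -
      obtain S2 i2 where h2: "h (S, i') = (S2, i2)" by (cases "h (S, i')")
      have "S2 = S1" using H(3)[OF S i'] h1 h2 by simp
      have "(S, i') \<in> slots n Z" using S i' by (simp add: slots_def)
      then have "h (S, i') \<in> slots n Z" using permutes_in_image[OF hp] by simp
      then have "i2 \<in> S1" using \<open>S2 = S1\<close> by (auto simp: slots_def h2)
      then show ?thesis using G(3)[OF S1] h2 \<open>S2 = S1\<close> by simp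
    qed
    then show ?thesis using G(1)[OF S1] G(2)[OF S1] c e by (simp add: h1)
  qed
  then show ?thesis
    by (rule block_groupI[OF permutes_compose[OF sp rp] permutes_compose[OF hp gp]])
qed

lemma id_block_group: "(id, id) \<in> block_group n Z"
  by (simp add: block_group_def permutes_id)

lemma signed_action_block_group: "signed_action (slots n Z) (block_group n Z) snd block_sign"
  unfolding signed_action_def
proof (intro conjI ballI)
  let ?E = "{S \<in> layers n Z. even (card S)}"
  have E: "finite ?E" using finite_layers by simp
  have "block_group n Z \<subseteq> {\<rho>. \<rho> permutes ?E} \<times> {g. g permutes slots n Z}" by (auto simp: block_group_def)
  then show "finite (block_group n Z)"
    by (rule finite_subset) (simp add: finite_permutations E finite_slots)
  show "block_group n Z \<noteq> {}" using id_block_group by blast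
  show "snd g permutes slots n Z" if "g \<in> block_group n Z" for g using that by (auto simp: block_group_def)
  show "block_sign g * block_sign g = 1" for g
    using sign_mult_self[of "fst g"] sign_mult_self[of "snd g"] by (simp add: block_sign_def algebra_simps)
  fix h assume h: "h \<in> block_group n Z"
  obtain \<sigma> h' where hh: "h = (\<sigma>, h')" by (cases h)
  have hp: "h' permutes slots n Z" "\<sigma> permutes ?E" using h hh by (auto simp: block_group_def)
  let ?\<pi> = "\<lambda>g. (fst g \<circ> \<sigma>, snd g \<circ> h')"
  have "inj_on ?\<pi> (block_group n Z)"
  proof (rule inj_onI)
    fix g g' assume "?\<pi> g = ?\<pi> g'"
    then have "fst g \<circ> \<sigma> = fst g' \<circ> \<sigma>" "snd g \<circ> h' = snd g' \<circ> h'" by auto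
    then have "fst g = fst g'" "snd g = snd g'"
      using inj_compose_right[OF permutes_surj[OF hp(1)], of UNIV] inj_compose_right[OF permutes_surj[OF hp(2)], of UNIV]
      by (auto dest: injD)
    then show "g = g'" by (rule prod_eqI)
  qed
  moreover have "?\<pi> ` block_group n Z \<subseteq> block_group n Z"
    using block_group_compose h unfolding hh by auto
  moreover have "block_sign (?\<pi> g) = block_sign g * block_sign h" if "g \<in> block_group n Z" for g
  proof -
    have "snd g permutes slots n Z" "fst g permutes ?E" using that by (auto simp: block_group_def)
    then show ?thesis
      using sign_compose_permutes[OF finite_slots _ hp(1)] sign_compose_permutes[OF E _ hp(2)]
      by (simp add: block_sign_def hh)
  qed
  ultimately show "\<exists>\<pi>. inj_on \<pi> (block_group n Z) \<and> \<pi> ` block_group n Z \<subseteq> block_group n Z \<and>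
      (\<forall>g\<in>block_group n Z. snd (\<pi> g) = snd g \<circ> snd h \<and> block_sign (\<pi> g) = block_sign g * block_sign h)"
    by (intro exI[of _ ?\<pi>]) (simp add: hh)
qed

definition separating_words :: "nat \<Rightarrow> nat set \<Rightarrow> (nat set \<times> nat \<Rightarrow> nat) set" where
  "separating_words n Z = {j \<in> slots n Z \<rightarrow>\<^sub>E {..<n}. (\<forall>S\<in>layers n Z. inj_on (\<lambda>i. j (S, i)) S) \<and>
     inj_on (\<lambda>S. (\<lambda>i. j (S, i)) ` S) (layers n Z)}"

text \<open>The exchange is a product of \<open>card I\<close> disjoint transpositions, composed one
  at a time.\<close>

lemma swap_permutation_exists:
  assumes "finite I" "inj_on e I" "inj_on e' I" "e ` I \<inter> e' ` I = {}"
  shows "\<exists>p. p permutes (e ` I \<union> e' ` I) \<and> (\<forall>i\<in>I. p (e i) = e' i \<and> p (e' i) = e i) \<and> sign p = (-1) ^ card I"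
  using assms
proof (induction I rule: finite_induct)
  case empty
  then show ?case by (intro exI[of _ id]) (simp add: id_def)
next
  case (insert i I)
  then obtain p where p: "p permutes (e ` I \<union> e' ` I)" "\<forall>i\<in>I. p (e i) = e' i \<and> p (e' i) = e i" "sign p = (-1) ^ card I"
    by auto
  let ?K = "e ` insert i I \<union> e' ` insert i I"
  let ?t = "transpose (e i) (e' i)"
  have ne: "e i \<noteq> e' i" "e i \<notin> e ` I" "e' i \<notin> e' ` I" "e i \<notin> e' ` I" "e' i \<notin> e ` I"
    using insert.prems insert.hyps by (auto simp: inj_on_def)
  have pK: "p permutes ?K" by (rule permutes_subset[OF p(1)]) auto
  have tK: "?t permutes ?K" by (rule permutes_swap_id) auto
  have fix1: "p (e i) = e i" "p (e' i) = e' i" using permutes_not_in[OF p(1)] ne by auto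
  have "(?t \<circ> p) (e k) = e' k \<and> (?t \<circ> p) (e' k) = e k" if "k \<in> insert i I" for k
  proof (cases "k = i")
    case True
    then show ?thesis using fix1 by simp
  next
    case False
    then have k: "k \<in> I" using that by simp
    have "e k \<noteq> e i" "e k \<noteq> e' i" "e' k \<noteq> e i" "e' k \<noteq> e' i" using ne k by (metis imageI)+
    then show ?thesis using p(2) k by (simp add: transpose_def)
  qed
  moreover have "sign (?t \<circ> p) = (-1) ^ card (insert i I)"
    using sign_compose_permutes[OF _ tK pK] p(3) insert.hyps ne(1) by (simp add: sign_swap_id)
  ultimately show ?case using permutes_compose[OF pK tK] by blast
qed

text \<open>Equal letters of the two blocks are matched by \<open>\<phi>\<close>, so that exchanging
  the blocks fixes the word. For odd block size the slots already give sign -1; for even size the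
  component \<open>\<rho>\<close> supplies it.\<close>

lemma bad_block_stabilizer:
  assumes j: "j \<in> slots n Z \<rightarrow>\<^sub>E {..<n}" and inj: "\<And>S. S \<in> layers n Z \<Longrightarrow> inj_on (\<lambda>i. j (S, i)) S"
    and S: "S \<in> layers n Z" "S' \<in> layers n Z" "S \<noteq> S'" and im: "(\<lambda>i. j (S, i)) ` S = (\<lambda>i. j (S', i)) ` S'"
  shows "\<exists>h\<in>block_group n Z. (\<forall>k\<in>slots n Z. j (snd h k) = j k) \<and> block_sign h = -1"
proof -
  note fin = layers_finite_mem[OF S(1)]
  define \<phi> where "\<phi> i = inv_into S' (\<lambda>i. j (S', i)) (j (S, i))" for i
  have phi: "\<phi> i \<in> S'" "j (S', \<phi> i) = j (S, i)" if "i \<in> S" for i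
  proof -
    have "j (S, i) \<in> (\<lambda>i. j (S', i)) ` S'" using that im by blast
    then show "\<phi> i \<in> S'" "j (S', \<phi> i) = j (S, i)"
      unfolding \<phi>_def by (rule inv_into_into, rule f_inv_into_f[of _ "\<lambda>i. j (S', i)"])
  qed
  have phi_inj: "inj_on \<phi> S"
    using phi(2) inj[OF S(1)] by (metis (no_types, lifting) inj_on_def)
  have cards: "card S = card S'"
    using card_image[OF inj[OF S(1)]] card_image[OF inj[OF S(2)]] im by simp
  have phi_surj: "\<phi> ` S = S'"
    by (rule card_subset_eq) (use phi(1) phi_inj cards layers_finite_mem[OF S(2)] in \<open>auto simp: card_image\<close>)
  have "\<exists>p. p permutes (Pair S ` S \<union> (\<lambda>i. (S', \<phi> i)) ` S) \<and>
      (\<forall>i\<in>S. p (S, i) = (S', \<phi> i) \<and> p (S', \<phi> i) = (S, i)) \<and> sign p = (-1) ^ card S"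
    by (rule swap_permutation_exists[OF fin]) (use S(3) phi_inj in \<open>auto simp: inj_on_def\<close>)
  then obtain p where p: "p permutes (Pair S ` S \<union> (\<lambda>i. (S', \<phi> i)) ` S)"
    "\<And>i. i \<in> S \<Longrightarrow> p (S, i) = (S', \<phi> i)" "\<And>i. i \<in> S \<Longrightarrow> p (S', \<phi> i) = (S, i)" "sign p = (-1) ^ card S"
    by blast
  have p': "\<exists>k\<in>S. i = \<phi> k \<and> p (S', i) = (S, k)" if "i \<in> S'" for i
    using that p(3) phi_surj by blast
  have pfix: "p (T, i) = (T, i)" if "T \<noteq> S" "T \<noteq> S'" for T i
    by (rule permutes_not_in[OF p(1)]) (use that in auto)
  have pK: "p permutes slots n Z"
    by (rule permutes_subset[OF p(1)]) (use S phi(1) in \<open>auto simp: slots_def\<close>)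
  define \<rho> where "\<rho> = (if even (card S) then transpose S S' else id)"
  have rp: "\<rho> permutes {S \<in> layers n Z. even (card S)}"
    unfolding \<rho>_def using S cards by (auto intro: permutes_swap_id permutes_id)
  have "(\<rho>, p) \<in> block_group n Z"
    unfolding block_group_def
  proof (intro CollectI case_prodI conjI rp pK ballI impI)
    fix T i assume T: "T \<in> layers n Z" "i \<in> T"
    have fp: "fst (p (T, i)) = transpose S S' T" if "i \<in> T" for i
      using p(2)[of i] p'[of i] pfix[of T i] that by (cases "T = S"; cases "T = S'") auto
    show "card (fst (p (T, i))) = card T"
      unfolding fp[OF T(2)] using cards by (auto simp: transpose_def)
    show "fst (p (T, i)) = fst (p (T, i'))" if "i' \<in> T" for i' using fp[OF T(2)] fp[OF that] by simp
    assume e: "even (card T)"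
    have "\<rho> T = transpose S S' T"
    proof (cases "even (card S)")
      case True
      then show ?thesis by (simp add: \<rho>_def)
    next
      case False
      then have "T \<noteq> S" "T \<noteq> S'" using e cards by metis+
      then show ?thesis using False by (simp add: \<rho>_def transpose_def)
    qed
    then show "fst (p (T, i)) = \<rho> T" using fp[OF T(2)] by simp
  qed
  moreover have "j (p k) = j k" if kK: "k \<in> slots n Z" for k
  proof -
    obtain T i where k: "k = (T, i)" "i \<in> T" using kK by (auto simp: slots_def)
    show ?thesis
      using k p(2)[of i] p'[of i] pfix[of T i] phi(2) by (cases "T = S"; cases "T = S'") auto
  qed
  moreover have "block_sign (\<rho>, p) = -1"
    using S(3) p(4) by (cases "even (card S)") (simp_all add: block_sign_def \<rho>_def sign_swap_id)
  ultimately show ?thesis by (metis snd_conv)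
qed

text \<open>An element fixing a separating word sends each block to a block with the same set of
  letters, hence to itself, and fixes its slots by injectivity. Any other word is fixed by an
  element of sign -1: an exchange of two slots of a block with a repeated letter, or of two blocks
  with the same letters.\<close>

lemma sum_block_stabilizer:
  assumes Z: "0 \<notin> Z" and j: "j \<in> slots n Z \<rightarrow>\<^sub>E {..<n}"
  shows "(\<Sum>g | g \<in> block_group n Z \<and> (\<forall>k\<in>slots n Z. j (snd g k) = j k). block_sign g) = of_bool (j \<in> separating_words n Z)"
proof (cases "j \<in> separating_words n Z")
  case True
  have inj: "inj_on (\<lambda>i. j (S, i)) S" if "S \<in> layers n Z" for S using True that by (simp add: separating_words_def)
  have inj2: "inj_on (\<lambda>S. (\<lambda>i. j (S, i)) ` S) (layers n Z)" using True by (simp add: separating_words_def)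
  have "{g. g \<in> block_group n Z \<and> (\<forall>k\<in>slots n Z. j (snd g k) = j k)} = {(id, id)}"
  proof (intro equalityI subsetI)
    fix h assume h: "h \<in> {g. g \<in> block_group n Z \<and> (\<forall>k\<in>slots n Z. j (snd g k) = j k)}"
    obtain \<rho> g where hg: "h = (\<rho>, g)" by (cases h)
    have gp: "g permutes slots n Z" and rp: "\<rho> permutes {S \<in> layers n Z. even (card S)}"
      using h unfolding hg block_group_def by blast+
    have st: "j (g k) = j k" if "k \<in> slots n Z" for k using h that by (simp add: hg)
    have "(\<rho>, g) \<in> block_group n Z" using h by (simp add: hg)
    note G = block_groupD[OF this]
    have g_id: "g (S, i) = (S, i)" if S: "S \<in> layers n Z" "i \<in> S" for S i
    proof -
      obtain T l where gk: "g (S, i) = (T, l)" by (cases "g (S, i)")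
      have in1: "(S, i) \<in> slots n Z" using S by (simp add: slots_def)
      have "g (S, i) \<in> slots n Z" using permutes_in_image[OF gp] in1 by simp
      then have T: "T \<in> layers n Z" "l \<in> T" by (auto simp: slots_def gk)
      have "(\<lambda>i. j (S, i)) ` S \<subseteq> (\<lambda>i. j (T, i)) ` T"
      proof
        fix v assume "v \<in> (\<lambda>i. j (S, i)) ` S"
        then obtain i' where i': "i' \<in> S" "v = j (S, i')" by blast
        have in2: "(S, i') \<in> slots n Z" using S i' by (simp add: slots_def)
        obtain T' l' where gk': "g (S, i') = (T', l')" by (cases "g (S, i')")
        have "T' = T" using G(3)[OF S i'(1)] gk gk' by simp
        have "g (S, i') \<in> slots n Z" using permutes_in_image[OF gp] in2 by simp
        then have "l' \<in> T" using \<open>T' = T\<close> by (auto simp: slots_def gk')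
        moreover have "v = j (T, l')" using st[OF in2] i' gk' \<open>T' = T\<close> by simp
        ultimately show "v \<in> (\<lambda>i. j (T, i)) ` T" by blast
      qed
      moreover have "card ((\<lambda>i. j (S, i)) ` S) = card ((\<lambda>i. j (T, i)) ` T)"
        using card_image[OF inj[OF S(1)]] card_image[OF inj[OF T(1)]] G(1)[OF S] gk by simp
      ultimately have "(\<lambda>i. j (S, i)) ` S = (\<lambda>i. j (T, i)) ` T"
        using layers_finite_mem[OF T(1)] by (intro card_subset_eq) auto
      then have ST: "S = T" using inj_onD[OF inj2] S(1) T(1) by blast
      have "j (S, l) = j (S, i)" using st[OF in1] gk ST by simp
      then have "l = i" using inj_onD[OF inj[OF S(1)]] S(2) T(2) ST by blast
      then show ?thesis using gk ST by simp
    qed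
    have "g = id"
    proof
      fix k show "g k = id k"
        using g_id permutes_not_in[OF gp, of k] by (cases "k \<in> slots n Z") (auto simp: slots_def)
    qed
    moreover have "\<rho> = id"
    proof
      fix S show "\<rho> S = id S"
      proof (cases "S \<in> layers n Z \<and> even (card S)")
        case True
        \<comment> \<open>An empty block has no slots, so the action on the slots would not
          determine \<open>\<rho>\<close> there; this is where \<open>0 \<notin> Z\<close>
          enters.\<close>
        then have "S \<noteq> {}" using Z by (auto simp: layers_def)
        then obtain i where i: "i \<in> S" by blast
        show ?thesis using G(2)[of S i] g_id[of S i] True i by simp
      qed (use permutes_not_in[OF rp] in auto)
    qed
    ultimately show "h \<in> {(id, id)}" by (simp add: hg)
  qed (auto simp: id_block_group)
  then show ?thesis using True by (simp add: block_sign_def)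
next
  case False
  have "\<exists>h\<in>block_group n Z. (\<forall>k\<in>slots n Z. j (snd h k) = j k) \<and> block_sign h = -1"
  proof (cases "\<forall>S\<in>layers n Z. inj_on (\<lambda>i. j (S, i)) S")
    case inj: True
    then have "\<not> inj_on (\<lambda>S. (\<lambda>i. j (S, i)) ` S) (layers n Z)" using False j by (simp add: separating_words_def)
    then obtain S S' where "S \<in> layers n Z" "S' \<in> layers n Z" "S \<noteq> S'" "(\<lambda>i. j (S, i)) ` S = (\<lambda>i. j (S', i)) ` S'"
      by (auto simp: inj_on_def)
    then show ?thesis using bad_block_stabilizer[OF j] inj by blast
  next
    case ninj: False
    then obtain S i i' where S: "S \<in> layers n Z" "i \<in> S" "i' \<in> S" "i \<noteq> i'" "j (S, i) = j (S, i')"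
      by (auto simp: inj_on_def)
    let ?t = "transpose (S, i) (S, i')"
    have t: "?t permutes slots n Z" using S by (intro permutes_swap_id) (auto simp: slots_def)
    have f: "fst (?t k) = fst k" for k by (auto simp: transpose_def)
    have "(id, ?t) \<in> block_group n Z" using t f by (simp add: block_group_def permutes_id)
    moreover have "j (?t k) = j k" for k using S by (auto simp: transpose_def)
    moreover have "block_sign (id, ?t) = -1" using S(4) by (simp add: block_sign_def sign_swap_id)
    ultimately show ?thesis by (metis snd_conv)
  qed
  then have "(\<Sum>g | g \<in> block_group n Z \<and> (\<forall>k\<in>slots n Z. j (snd g k) = j k). block_sign g) = 0"
    using sum_stabilizer_eq_0[OF signed_action_block_group] by blast
  then show ?thesis using False by simp
qed

definition marked :: "nat \<Rightarrow> nat set \<Rightarrow> (nat set \<Rightarrow> nat) \<Rightarrow> (nat set \<times> nat) set" where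
  "marked n Z m = (\<lambda>S. (S, m S)) ` layers n Z"

lemma finite_separating_words: "finite (separating_words n Z)"
  by (rule finite_subset[of _ "slots n Z \<rightarrow>\<^sub>E {..<n}"]) (auto simp: separating_words_def finite_slots intro: finite_PiE)

text \<open>The tautological word, with letter \<open>i\<close> in slot \<open>(S, i)\<close>,
  separates. Hence the multiplicity with which the product is represented is positive.\<close>

lemma separating_words_nonempty: "separating_words n Z \<noteq> {}"
proof -
  have "(\<lambda>(S, i)\<in>slots n Z. i) \<in> separating_words n Z"
    unfolding separating_words_def
  proof (intro CollectI conjI ballI)
    show "(\<lambda>(S, i)\<in>slots n Z. i) \<in> slots n Z \<rightarrow>\<^sub>E {..<n}" by (auto simp: slots_def layers_def)
    show "inj_on (\<lambda>i. (\<lambda>(S, i)\<in>slots n Z. i) (S, i)) S" if "S \<in> layers n Z" for S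
      using that by (auto simp: inj_on_def slots_def)
    have "(\<lambda>i. (\<lambda>(S, i)\<in>slots n Z. i) (S, i)) ` S = S" if "S \<in> layers n Z" for S
      using that by (auto simp: slots_def)
    then show "inj_on (\<lambda>S. (\<lambda>i. (\<lambda>(S, i)\<in>slots n Z. i) (S, i)) ` S) (layers n Z)"
      by (auto simp: inj_on_def)
  qed
  then show ?thesis by blast
qed

text \<open>Summing over the markings gives, for each separating word, the product over
  \<open>S\<close> of the sums of the variables named by the letters in block \<open>S\<close>. The
  map from \<open>S\<close> to this set of letters preserves size and is injective, so it permutes
  the layers, and each word gives the full product.\<close>

lemma sum_marked_signed_word_poly:
  fixes x :: "nat \<Rightarrow> 'a::comm_ring_1"
  assumes Z: "0 \<notin> Z"
  shows "(\<Sum>m\<in>PiE (layers n Z) (\<lambda>S. S). signed_word_poly n (slots n Z) (marked n Z m) (block_group n Z) snd block_sign x)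
    = of_nat (card (separating_words n Z)) * (\<Prod>S\<in>layers n Z. \<Sum>i\<in>S. x i)"
proof -
  let ?L = "layers n Z" and ?K = "slots n Z"
  let ?m = "PiE ?L (\<lambda>S. S)"
  have W: "finite (?K \<rightarrow>\<^sub>E {..<n})" using finite_slots by (auto intro: finite_PiE)
  have fin: "finite (block_group n Z)" using signed_action_block_group by (auto simp: signed_action_def)
  have "signed_word_poly n ?K (marked n Z m) (block_group n Z) snd block_sign x = (\<Sum>j\<in>separating_words n Z. \<Prod>S\<in>?L. x (j (S, m S)))" for m
  proof -
    have "signed_word_poly n ?K (marked n Z m) (block_group n Z) snd block_sign x
      = (\<Sum>j\<in>?K \<rightarrow>\<^sub>E {..<n}. of_int (of_bool (j \<in> separating_words n Z)) * (\<Prod>k\<in>marked n Z m. x (j k)))"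
      unfolding signed_word_poly_words[OF finite_slots fin] by (intro sum.cong refl) (simp only: sum_block_stabilizer[OF Z])
    also have "\<dots> = (\<Sum>j\<in>separating_words n Z. \<Prod>k\<in>marked n Z m. x (j k))"
      by (rule sum.mono_neutral_cong_right[OF W]) (auto simp: separating_words_def)
    also have "\<dots> = (\<Sum>j\<in>separating_words n Z. \<Prod>S\<in>?L. x (j (S, m S)))"
      unfolding marked_def by (intro sum.cong refl, subst prod.reindex) (auto simp: inj_on_def)
    finally show ?thesis .
  qed
  then have "(\<Sum>m\<in>?m. signed_word_poly n ?K (marked n Z m) (block_group n Z) snd block_sign x)
    = (\<Sum>m\<in>?m. \<Sum>j\<in>separating_words n Z. \<Prod>S\<in>?L. x (j (S, m S)))" by simp
  also have "\<dots> = (\<Sum>j\<in>separating_words n Z. \<Sum>m\<in>?m. \<Prod>S\<in>?L. x (j (S, m S)))" by (rule sum.swap)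
  also have "\<dots> = (\<Sum>j\<in>separating_words n Z. \<Prod>S\<in>?L. \<Sum>i\<in>S. x (j (S, i)))"
    using layers_finite_mem by (intro sum.cong refl, subst prod_sum_PiE) (auto simp: finite_layers)
  also have "\<dots> = (\<Sum>j\<in>separating_words n Z. \<Prod>S\<in>?L. \<Sum>i\<in>S. x i)"
  proof (rule sum.cong[OF refl])
    fix j assume j: "j \<in> separating_words n Z"
    let ?F = "\<lambda>S. (\<lambda>i. j (S, i)) ` S"
    have inj: "inj_on (\<lambda>i. j (S, i)) S" if "S \<in> ?L" for S using j that by (simp add: separating_words_def)
    have "?F S \<in> ?L" if "S \<in> ?L" for S
    proof -
      have "j (S, i) < n" if "i \<in> S" for i
        using j \<open>S \<in> ?L\<close> that by (auto simp: separating_words_def slots_def PiE_def Pi_def)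
      then show ?thesis using that card_image[OF inj[OF that]] by (auto simp: layers_def)
    qed
    moreover have injF: "inj_on ?F ?L" using j by (simp add: separating_words_def)
    ultimately have "?F ` ?L = ?L" using finite_layers by (intro endo_inj_surj) auto
    then have "bij_betw ?F ?L ?L" using injF by (simp add: bij_betw_def)
    then have "(\<Prod>S\<in>?L. \<Sum>i\<in>?F S. x i) = (\<Prod>S\<in>?L. \<Sum>i\<in>S. x i)"
      by (rule prod.reindex_bij_betw)
    then show "(\<Prod>S\<in>?L. \<Sum>i\<in>S. x (j (S, i))) = (\<Prod>S\<in>?L. \<Sum>i\<in>S. x i)"
      by (simp add: sum.reindex[OF inj])
  qed
  finally show ?thesis by simp
qed

definition choices :: "nat \<Rightarrow> nat set \<Rightarrow> (nat set \<Rightarrow> nat) set" where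
  "choices n Z = PiE (layers n Z) (\<lambda>S. S)"

lemma prod_sum_choices:
  fixes x :: "nat \<Rightarrow> 'a::comm_ring_1"
  shows "(\<Prod>S\<in>layers n Z. \<Sum>i\<in>S. x i) = (\<Sum>j\<in>choices n Z. \<Prod>S\<in>layers n Z. x (j S))"
  unfolding choices_def using finite_layers layers_finite_mem by (rule prod_sum_PiE)

lemma layers_image:
  assumes w: "w permutes {..<n}"
  shows "S \<in> layers n Z \<Longrightarrow> w ` S \<in> layers n Z"
  using permutes_in_image[OF w] card_image[OF inj_on_subset[OF permutes_inj[OF w] subset_UNIV], of S]
  by (auto simp: layers_def)

text \<open>A choice must pick an element of \<open>S\<close> for each \<open>S\<close>, which plain
  relabelling of letters would violate. The bijection therefore takes the element chosen for the
  preimage of \<open>S\<close> under \<open>w\<close> and applies \<open>w\<close> to it.\<close>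

lemma symmetric_words_choices: "symmetric_words n (layers n Z) (choices n Z)"
  unfolding symmetric_words_def
proof (intro conjI allI impI)
  let ?L = "layers n Z"
  show "finite ?L" by (rule finite_layers)
  show "choices n Z \<subseteq> ?L \<rightarrow>\<^sub>E {..<n}" by (auto simp: choices_def layers_def PiE_def Pi_def)
  fix w assume w: "w permutes {..<n}"
  let ?v = "inv_into UNIV w"
  have v: "?v permutes {..<n}" by (rule permutes_inv[OF w])
  have vw: "?v ` w ` S = S" "w ` ?v ` S = S" for S
    using permutes_inverses[OF w] by (auto simp: image_image)
  let ?f = "\<lambda>w v j. \<lambda>S\<in>?L. w (j (v ` S))"
  have f: "?f w v j \<in> choices n Z"
    if j: "j \<in> choices n Z" and v: "v permutes {..<n}" and wv: "\<And>S. w ` v ` S = S" for w v j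
  proof -
    have "w (j (v ` S)) \<in> S" if S: "S \<in> ?L" for S
    proof -
      have "j (v ` S) \<in> v ` S" using j layers_image[OF v S] by (auto simp: choices_def)
      then have "w (j (v ` S)) \<in> w ` v ` S" by blast
      then show ?thesis by (simp only: wv)
    qed
    then show ?thesis by (simp add: choices_def)
  qed
  have inv: "?f v w (?f w v j) = j" if j: "j \<in> choices n Z" and wv: "w permutes {..<n}" "\<And>S. v ` w ` S = S" "\<And>i. v (w i) = i" for w v j
  proof
    fix S show "?f v w (?f w v j) S = j S"
      using j layers_image[OF wv(1)] wv(2,3) by (cases "S \<in> ?L") (auto simp: choices_def PiE_def extensional_def)
  qed
  have "bij_betw (?f w ?v) (choices n Z) (choices n Z)"
    using f[OF _ v vw(2)] f[OF _ w vw(1)] inv[OF _ w vw(1) permutes_inverses(2)[OF w]] inv[OF _ v vw(2) permutes_inverses(1)[OF w]]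
    by (intro bij_betwI[where g = "?f ?v w"]) auto
  moreover have "wt ?L (?f w ?v j) (w i) = wt ?L j i" for j i
  proof -
    have "bij_betw (\<lambda>S. w ` S) {S \<in> ?L. j S = i} {S \<in> ?L. ?f w ?v j S = w i}"
    proof (rule bij_betwI[where g = "\<lambda>S. ?v ` S"])
      show "(\<lambda>S. w ` S) \<in> {S \<in> ?L. j S = i} \<rightarrow> {S \<in> ?L. ?f w ?v j S = w i}"
        using layers_image[OF w] vw(1) by auto
      show "(\<lambda>S. ?v ` S) \<in> {S \<in> ?L. ?f w ?v j S = w i} \<rightarrow> {S \<in> ?L. j S = i}"
        using layers_image[OF v] inj_eq[OF permutes_inj[OF w]] by auto
    qed (use vw in auto)
    then show ?thesis unfolding wt_def by (rule bij_betw_same_card[symmetric])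
  qed
  ultimately show "\<exists>\<phi>. bij_betw \<phi> (choices n Z) (choices n Z) \<and>
      (\<forall>j\<in>choices n Z. \<forall>i<n. wt ?L (\<phi> j) (w i) = wt ?L j i)" by blast
qed

text \<open>A positive multiple of the product is a sum, over the choices of marked slots, of signed
  word polynomials for one common group; each of these pairs nonnegatively, with its own sum of
  squares.\<close>

theorem schur_positive_layers:
  assumes Z: "0 \<notin> Z"
  shows "schur_positive n (\<Prod>S\<in>layers n Z. \<Sum>i\<in>S. X (Suc i))"
proof -
  let ?L = "layers n Z" and ?K = "slots n Z"
  let ?m = "PiE ?L (\<lambda>S. S)"
  have "schur_positive n (\<Sum>j\<in>choices n Z. \<Prod>S\<in>?L. X (Suc (j S)))"
  proof (rule schur_positiveI[OF symmetric_words_choices])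
    fix t assume t: "t \<in> parts n (card ?L)"
    let ?D = "diag n t"
    let ?q = "\<lambda>m. hw_form n ?D ?K (marked n Z m) (block_group n Z) snd block_sign"
    let ?f = "\<lambda>x :: nat \<Rightarrow> complex. \<Sum>j\<in>choices n Z. \<Prod>S\<in>?L. x (j S)"
    have mK: "marked n Z m \<subseteq> ?K" if "m \<in> ?m" for m using that by (auto simp: marked_def slots_def PiE_def Pi_def)
    have perm: "\<And>g. g \<in> block_group n Z \<Longrightarrow> snd g permutes ?K" by (auto simp: block_group_def)
    have fm: "finite ?m" using finite_layers layers_finite_mem by (auto intro: finite_PiE)
    have "of_nat (card (separating_words n Z)) * hw_functional n ?D ?f = hw_functional n ?D (\<lambda>x. of_nat (card (separating_words n Z)) * ?f x)"
      by (rule hw_functional_scale[symmetric])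
    also have "\<dots> = hw_functional n ?D (\<lambda>x. \<Sum>m\<in>?m. 1 * signed_word_poly n ?K (marked n Z m) (block_group n Z) snd block_sign x)"
      by (simp only: sum_marked_signed_word_poly[OF Z] prod_sum_choices mult_1_left)
    also have "\<dots> = (\<Sum>m\<in>?m. 1 * hw_functional n ?D (signed_word_poly n ?K (marked n Z m) (block_group n Z) snd block_sign))"
      by (rule hw_functional_sum[OF fm])
    also have "\<dots> = (\<Sum>m\<in>?m. of_int (?q m))"
      by (intro sum.cong refl) (simp add: hw_functional_signed_word_poly[OF finite_slots mK finite_diag perm])
    finally have eq: "of_nat (card (separating_words n Z)) * hw_functional n ?D ?f = of_int (\<Sum>m\<in>?m. ?q m)" by simp
    show "0 \<le> schur_coeff n ?L (choices n Z) t"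
    proof (rule schur_coeff_nonneg[OF symmetric_words_choices t eq])
      show "0 \<le> (\<Sum>m\<in>?m. ?q m)"
        by (rule sum_nonneg) (rule hw_form_nonneg[OF finite_slots mK finite_diag diag_rows signed_action_block_group])
      show "of_nat (card (separating_words n Z)) = (of_int (int (card (separating_words n Z))) :: complex)" by simp
      show "0 < int (card (separating_words n Z))" using finite_separating_words separating_words_nonempty by (simp add: card_gt_0_iff)
    qed
  qed
  then show ?thesis by (simp only: prod_sum_choices)
qed

lemma prod_layers_shift:
  "(\<Prod>S\<in>layers n Z. \<Sum>i\<in>S. X (Suc i)) = (\<Prod>S | S \<subseteq> {1..n} \<and> card S \<in> Z. \<Sum>i\<in>S. X i)"
proof (rule prod.reindex_bij_witness[where i = "\<lambda>S. (\<lambda>i. i - 1) ` S" and j = "\<lambda>S. Suc ` S"])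
  fix S assume S: "S \<in> layers n Z"
  show "(\<lambda>i. i - 1) ` Suc ` S = S" by (auto simp: image_image)
  show "Suc ` S \<in> {S. S \<subseteq> {1..n} \<and> card S \<in> Z}"
    using S by (auto simp: layers_def card_image)
  show "(\<Sum>i\<in>Suc ` S. X i) = (\<Sum>i\<in>S. X (Suc i))" by (simp add: sum.reindex)
next
  fix S assume S: "S \<in> {S. S \<subseteq> {1..n} \<and> card S \<in> Z}"
  then have s: "Suc (i - 1) = i" "i - 1 < n" if "i \<in> S" for i using that by (force simp: subset_iff)+
  show "Suc ` (\<lambda>i. i - 1) ` S = S" using s(1) by (force simp: image_image)
  have "inj_on (\<lambda>i. i - 1) S"
  proof (rule inj_onI)
    fix i k assume "i \<in> S" "k \<in> S" "i - 1 = k - 1"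
    then show "i = k" using s(1)[of i] s(1)[of k] by simp
  qed
  then show "(\<lambda>i. i - 1) ` S \<in> layers n Z"
    using S s(2) by (auto simp: layers_def card_image)
qed

theorem theorem1p1:
  fixes n :: nat
  assumes "n \<ge> 1"
  shows "(\<forall>k. 1 \<le> k \<and> k \<le> n \<longrightarrow> schur_positive n (boolean_product n k))
    \<and> schur_positive n (total_boolean_product n)"
proof (intro conjI allI impI)
  fix k :: nat assume k: "1 \<le> k \<and> k \<le> n"
  have "boolean_product n k = (\<Prod>S\<in>layers n {k}. \<Sum>i\<in>S. X (Suc i))"
    unfolding boolean_product_def prod_layers_shift by simp
  then show "schur_positive n (boolean_product n k)" using schur_positive_layers[of "{k}" n] k by simp
next
  \<comment> \<open>Subsets of all sizes are gathered into one index set, so that one group acts on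
    all their slots and no product of Schur polynomials has to be expanded.\<close>
  have "total_boolean_product n = (\<Prod>k=1..n. \<Prod>S\<in>{S \<in> {S. S \<subseteq> {1..n} \<and> card S \<in> {1..n}}. card S = k}. \<Sum>i\<in>S. X i)"
    unfolding total_boolean_product_def boolean_product_def by (intro prod.cong) auto
  also have "\<dots> = (\<Prod>S | S \<subseteq> {1..n} \<and> card S \<in> {1..n}. \<Sum>i\<in>S. X i)"
  proof (rule prod.group)
    show "finite {S. S \<subseteq> {1..n} \<and> card S \<in> {1..n}}" by (rule finite_subset[of _ "Pow {1..n}"]) auto
  qed auto
  also have "\<dots> = (\<Prod>S\<in>layers n {1..n}. \<Sum>i\<in>S. X (Suc i))" by (rule prod_layers_shift[symmetric])
  finally show "schur_positive n (total_boolean_product n)" using schur_positive_layers[of "{1..n}" n] by simp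
qed

end
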